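(* There is a constant $C_J>0$, depending on the kernel $J$ but independent of $h$, such that if the time step $\tau>0$ satisfies $\tau<\frac{2\gamma_0}{C_J\varepsilon^4}$, then every sequence $(u_h^n,\omega_h^n)_n$ in $\mathcal{C}^{per}_{N\times N}\times\mathcal{C}^{per}_{N\times N}$ with $(u_h^1\|\mathbf 1)=(u_h^0\|\mathbf 1)$ generated by the BDF2 scheme, i.e. satisfying for all $n\ge1$ $$\frac{3u_h^{n+1}-4u_h^n+u_h^{n-1}}{2\tau}=\Delta_h\omega_h^{n+1},\qquad \omega_h^{n+1}=F'(u_h^{n+1})+\varepsilon^2[J\circledast\mathbf 1]u_h^{n+1}-\varepsilon^2[J\circledast u_h^{n+1}],$$ converges as $n\to\infty$ to a steady state $(u_h^\infty,\omega_h^\infty)\in\mathcal{C}^{per}_{N\times N}\times\mathcal{C}^{per}_{N\times N}$, i.e. a solution of $$(u_h^\infty\|\mathbf 1)=(u_h^0\|\mathbf 1),\qquad \omega_h^\infty=F'(u_h^\infty)+\varepsilon^2[J\circledast\mathbf 1]u_h^\infty-\varepsilon^2[J\circledast u_h^\infty],\qquad \omega_h^\infty\ \text{constant (equivalently } \Delta_h\omega_h^\infty=0).$$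
   Context: Setting. $\Omega=(0,L)\times(0,L)$, $h=L/N$ with $N\in\mathbb{Z}^+$, and $\varepsilon>0$. The kernel $J:\mathbb{R}^2\to\mathbb{R}$ is $C^\infty$, $\Omega$-periodic ($L$-periodic in each variable) and even ($J(\mathbf x)=J(-\mathbf x)$), with $J*1=\int_\Omega J\,d\mathbf x>0$. $\mathcal{C}^{per}_{N\times N}$ is the finite-dimensional space of real periodic cell-centered grid functions $\phi=(\phi_{i,j})$ (values at $((i-\tfrac12)h,(j-\tfrac12)h)$), extended $N$-periodically in both indices $i,j\in\mathbb{Z}$. $\mathbf 1$ is the constant grid function $1$; products, powers and $F'(u_h)$ are taken componentwise. $(\phi\|\psi)=\sum_{i,j=1}^N\phi_{i,j}\psi_{i,j}$. Convergence is in this finite-dimensional space. Discrete Laplacian: $(\Delta_h\phi)_{i,j}=h^{-2}(\phi_{i+1,j}+\phi_{i-1,j}+\phi_{i,j+1}+\phi_{i,j-1}-4\phi_{i,j})$. Discrete convolution: with $J_{k+\frac12,l+\frac12}:=J(kh,lh)$, $[J\circledast\phi]_{i,j}=h^2\sum_{k=1}^N\sum_{l=1}^N J_{k+\frac12,l+\frac12}\,\phi_{i-k,j-l}$. $[J\circledast\mathbf 1]$ is a constant grid function, identified with the number $h^2\sum_{k,l=1}^N J(kh,lh)$. Standing assumption: $\gamma:=\varepsilon^2(J*1)-1>0$ and its discrete analogue $\gamma_0:=\varepsilon^2[J\circledast\mathbf 1]-1>0$. Potential: $F(r)=\frac14(r^2-1)^2$, so $F'(r)=r^3-r$. *)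

theory Defs
  imports "HOL-Analysis.Analysis"
begin

section \<open>The kernel\<close>

text \<open>\<open>C_k k f\<close>: \<open>f\<close> is of class \<open>C\<^sup>k\<close> on the whole space, i.e. all iterated directional
  derivatives up to order \<open>k\<close> exist and are continuous.\<close>

primrec C_k :: "nat \<Rightarrow> ('a::real_normed_vector \<Rightarrow> 'b::real_normed_vector) \<Rightarrow> bool" where
  "C_k 0 f \<longleftrightarrow> continuous_on UNIV f"
| "C_k (Suc k) f \<longleftrightarrow> (\<forall>x. f differentiable (at x)) \<and>
     (\<forall>v. C_k k (\<lambda>x. frechet_derivative f (at x) v))"

definition C_infinity :: "('a::real_normed_vector \<Rightarrow> 'b::real_normed_vector) \<Rightarrow> bool" where
  "C_infinity f \<longleftrightarrow> (\<forall>k. C_k k f)"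

definition Omega :: "real \<Rightarrow> (real \<times> real) set" where
  "Omega L = {0<..<L} \<times> {0<..<L}"

definition Omega_periodic :: "real \<Rightarrow> (real \<times> real \<Rightarrow> real) \<Rightarrow> bool" where
  "Omega_periodic L J \<longleftrightarrow> (\<forall>x y. J (x + L, y) = J (x, y) \<and> J (x, y + L) = J (x, y))"

text \<open>The number \<open>J * 1\<close>.\<close>

definition kernel_mass :: "real \<Rightarrow> (real \<times> real \<Rightarrow> real) \<Rightarrow> real" where
  "kernel_mass L J = integral (Omega L) J"

definition admissible_kernel :: "real \<Rightarrow> (real \<times> real \<Rightarrow> real) \<Rightarrow> bool" where
  "admissible_kernel L J \<longleftrightarrow> C_infinity J \<and> Omega_periodic L J \<and> (\<forall>x. J (- x) = J x) \<and>
     kernel_mass L J > 0"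

section \<open>Periodic cell-centered grid functions\<close>

text \<open>The number \<open>N\<close> of cells per direction is quantified inside the theorem, so grid functions
  are functions of two integer indices that are \<open>N\<close>-periodic in each of them.\<close>

type_synonym grid = "int \<Rightarrow> int \<Rightarrow> real"

definition C_per :: "nat \<Rightarrow> grid set" where
  "C_per N = {\<phi>. \<forall>i j. \<phi> (i + int N) j = \<phi> i j \<and> \<phi> i (j + int N) = \<phi> i j}"

definition grid_one :: grid where
  "grid_one = (\<lambda>i j. 1)"

definition grid_inner :: "nat \<Rightarrow> grid \<Rightarrow> grid \<Rightarrow> real" where
  "grid_inner N \<phi> \<psi> = (\<Sum>i=1..int N. \<Sum>j=1..int N. \<phi> i j * \<psi> i j)"

definition grid_norm :: "nat \<Rightarrow> grid \<Rightarrow> real" where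
  "grid_norm N \<phi> = sqrt (grid_inner N \<phi> \<phi>)"

definition grid_converges :: "nat \<Rightarrow> (nat \<Rightarrow> grid) \<Rightarrow> grid \<Rightarrow> bool" where
  "grid_converges N u v \<longleftrightarrow> (\<lambda>n. grid_norm N (\<lambda>i j. u n i j - v i j)) \<longlonglongrightarrow> 0"

definition mesh :: "real \<Rightarrow> nat \<Rightarrow> real" where
  "mesh L N = L / real N"

definition disc_laplacian :: "real \<Rightarrow> grid \<Rightarrow> grid" where
  "disc_laplacian h \<phi> = (\<lambda>i j.
     (\<phi> (i + 1) j + \<phi> (i - 1) j + \<phi> i (j + 1) + \<phi> i (j - 1) - 4 * \<phi> i j) / h\<^sup>2)"

definition disc_conv :: "real \<Rightarrow> nat \<Rightarrow> (real \<times> real \<Rightarrow> real) \<Rightarrow> grid \<Rightarrow> grid" where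
  "disc_conv h N J \<phi> = (\<lambda>i j. h\<^sup>2 *
     (\<Sum>k=1..int N. \<Sum>l=1..int N. J (of_int k * h, of_int l * h) * \<phi> (i - k) (j - l)))"

text \<open>The number with which the constant grid function \<open>disc_conv h N J grid_one\<close> is identified.\<close>

definition disc_kernel_mass :: "real \<Rightarrow> nat \<Rightarrow> (real \<times> real \<Rightarrow> real) \<Rightarrow> real" where
  "disc_kernel_mass h N J = h\<^sup>2 * (\<Sum>k=1..int N. \<Sum>l=1..int N. J (of_int k * h, of_int l * h))"

lemma disc_conv_one: "disc_conv h N J grid_one i j = disc_kernel_mass h N J"
  by (simp add: disc_conv_def disc_kernel_mass_def grid_one_def)

definition gamma_cont :: "real \<Rightarrow> real \<Rightarrow> (real \<times> real \<Rightarrow> real) \<Rightarrow> real" where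
  "gamma_cont L \<epsilon> J = \<epsilon>\<^sup>2 * kernel_mass L J - 1"

definition gamma_disc :: "real \<Rightarrow> nat \<Rightarrow> real \<Rightarrow> (real \<times> real \<Rightarrow> real) \<Rightarrow> real" where
  "gamma_disc h N \<epsilon> J = \<epsilon>\<^sup>2 * disc_kernel_mass h N J - 1"

section \<open>The scheme and its steady states\<close>

definition potential :: "real \<Rightarrow> real" where
  "potential r = (r\<^sup>2 - 1)\<^sup>2 / 4"

lemma deriv_potential: "deriv potential r = r ^ 3 - r"
proof (rule DERIV_imp_deriv)
  have "((\<lambda>r::real. (r\<^sup>2 - 1)\<^sup>2 / 4) has_field_derivative (r ^ 3 - r)) (at r)"
    by (auto intro!: derivative_eq_intros simp: field_simps power2_eq_square power3_eq_cube)
  then show "(potential has_field_derivative (r ^ 3 - r)) (at r)"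
    by (simp add: potential_def[abs_def])
qed

definition chem_potential :: "real \<Rightarrow> nat \<Rightarrow> real \<Rightarrow> (real \<times> real \<Rightarrow> real) \<Rightarrow> grid \<Rightarrow> grid" where
  "chem_potential h N \<epsilon> J u = (\<lambda>i j. deriv potential (u i j)
     + \<epsilon>\<^sup>2 * disc_kernel_mass h N J * u i j - \<epsilon>\<^sup>2 * disc_conv h N J u i j)"

definition BDF2_scheme ::
  "real \<Rightarrow> nat \<Rightarrow> real \<Rightarrow> (real \<times> real \<Rightarrow> real) \<Rightarrow> real \<Rightarrow> (nat \<Rightarrow> grid) \<Rightarrow> (nat \<Rightarrow> grid) \<Rightarrow> bool" where
  "BDF2_scheme h N \<epsilon> J \<tau> u \<omega> \<longleftrightarrow> (\<forall>n\<ge>1.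
     (\<forall>i j. (3 * u (n + 1) i j - 4 * u n i j + u (n - 1) i j) / (2 * \<tau>)
              = disc_laplacian h (\<omega> (n + 1)) i j) \<and>
     \<omega> (n + 1) = chem_potential h N \<epsilon> J (u (n + 1)))"

definition steady_state ::
  "real \<Rightarrow> nat \<Rightarrow> real \<Rightarrow> (real \<times> real \<Rightarrow> real) \<Rightarrow> grid \<Rightarrow> grid \<Rightarrow> grid \<Rightarrow> bool" where
  "steady_state h N \<epsilon> J u0 u \<omega> \<longleftrightarrow>
     grid_inner N u grid_one = grid_inner N u0 grid_one \<and>
     \<omega> = chem_potential h N \<epsilon> J u \<and>
     (\<exists>c. \<forall>i j. \<omega> i j = c)"

end

theory Submission
  imports Defs "HOL-Computational_Algebra.Polynomial"
begin

text \<open>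
  The scheme is written through a flux: \<open>u\<^sup>n\<^sup>+\<^sup>1 - u\<^sup>n\<close> is the negative divergence of a flux \<open>q\<^sup>n\<^sup>+\<^sup>1\<close>, and
  the BDF2 relation becomes \<open>3 q\<^sup>n\<^sup>+\<^sup>1 - q\<^sup>n = - 2 \<tau> \<nabla>\<^sub>h \<omega>\<^sup>n\<^sup>+\<^sup>1\<close>. The nonlocal term is controlled by the
  Lipschitz constant of the kernel, and for small \<open>\<tau>\<close> the energy plus \<open>\<parallel>q\<^sup>n\<parallel>\<^sup>2 / (4 \<tau>)\<close> decreases by a
  multiple of \<open>\<parallel>q\<^sup>n\<^sup>+\<^sup>1\<parallel>\<^sup>2\<close>. Hence all cluster points are equilibria, and they form a connected compact
  set. It remains to exclude more than one cluster point, although continua of equilibria can occur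
  (for example when \<open>N\<close> is divisible by 3).

  The Lojasiewicz inequality is replaced by an algebraic argument special to the cubic nonlinearity.
  Equilibria solve \<open>u\<^sub>i\<^sup>3 + (A u)\<^sub>i = c\<close> for all \<open>i\<close>. Fix an index \<open>a\<close> and call an equilibrium degenerate if
  some \<open>w \<noteq> 0\<close> with \<open>w\<^sub>a = 0\<close> makes \<open>3 u\<^sub>i\<^sup>2 w\<^sub>i + (A w)\<^sub>i\<close> independent of \<open>i\<close>. Comparing sizes with respect to
  a valuation ring of the reals containing \<open>1/3\<close> and the entries of \<open>A\<close> shows that the entries of a
  degenerate equilibrium lie in every such ring; they are therefore algebraic over a countable ring,
  and there are only countably many degenerate equilibria. A connected set of equilibria with two
  points is uncountable, so it contains a nondegenerate one, near which it is a curve with a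
  gradient inequality of exponent 1/2. This forces convergence, which contradicts the two cluster
  points.
\<close>

section \<open>Valuation rings of the real numbers\<close>

definition real_subring :: "real set \<Rightarrow> bool" where
  "real_subring S \<longleftrightarrow> 0 \<in> S \<and> 1 \<in> S \<and> (\<forall>x\<in>S. \<forall>y\<in>S. x - y \<in> S \<and> x * y \<in> S)"

lemma real_subringD:
  assumes "real_subring S"
  shows "0 \<in> S" "1 \<in> S" "x \<in> S \<Longrightarrow> y \<in> S \<Longrightarrow> x - y \<in> S"
    "x \<in> S \<Longrightarrow> y \<in> S \<Longrightarrow> x * y \<in> S" "x \<in> S \<Longrightarrow> - x \<in> S"
    "x \<in> S \<Longrightarrow> y \<in> S \<Longrightarrow> x + y \<in> S"
proof -
  show *: "0 \<in> S" "1 \<in> S" and d: "\<And>x y. x \<in> S \<Longrightarrow> y \<in> S \<Longrightarrow> x - y \<in> S"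
    and "x \<in> S \<Longrightarrow> y \<in> S \<Longrightarrow> x * y \<in> S"
    using assms by (auto simp: real_subring_def)
  show m: "x \<in> S \<Longrightarrow> - x \<in> S" for x using d[of 0 x] * by simp
  show "x \<in> S \<Longrightarrow> y \<in> S \<Longrightarrow> x + y \<in> S" using d[of x "- y"] m[of y] by simp
qed

lemma real_subring_sum:
  assumes "real_subring S" "\<And>i. i \<in> A \<Longrightarrow> f i \<in> S"
  shows "sum f A \<in> S"
  using assms(2) by (induction A rule: infinite_finite_induct) (auto intro: real_subringD[OF assms(1)])

definition real_adjoin :: "real set \<Rightarrow> real \<Rightarrow> real set" where
  "real_adjoin S x = {poly p x | p. \<forall>i. coeff p i \<in> S}"

lemma real_adjoin_subring:
  assumes S: "real_subring S"
  shows "real_subring (real_adjoin S x)"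
  unfolding real_subring_def
proof (intro conjI ballI)
  show "0 \<in> real_adjoin S x"
    unfolding real_adjoin_def using real_subringD[OF S] by (auto intro!: exI[of _ 0])
  show "1 \<in> real_adjoin S x"
    unfolding real_adjoin_def using real_subringD[OF S]
    by (auto intro!: exI[of _ 1] simp: coeff_pCons split: nat.splits)
next
  fix y z assume "y \<in> real_adjoin S x" "z \<in> real_adjoin S x"
  then obtain p q where p: "y = poly p x" "\<forall>i. coeff p i \<in> S" and q: "z = poly q x" "\<forall>i. coeff q i \<in> S"
    unfolding real_adjoin_def by auto
  show "y - z \<in> real_adjoin S x"
    unfolding real_adjoin_def using p q real_subringD[OF S] by (auto intro!: exI[of _ "p - q"])
  show "y * z \<in> real_adjoin S x"
    unfolding real_adjoin_def using p q real_subringD[OF S]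
    by (auto intro!: exI[of _ "p * q"] real_subring_sum[OF S] simp: coeff_mult)
qed

lemma real_adjoin_superset:
  assumes "real_subring S"
  shows "S \<subseteq> real_adjoin S x" "x \<in> real_adjoin S x"
proof -
  note S = real_subringD[OF assms]
  show "S \<subseteq> real_adjoin S x"
  proof
    fix s assume "s \<in> S"
    then show "s \<in> real_adjoin S x" unfolding real_adjoin_def
      using S by (auto intro!: exI[of _ "[:s:]"] simp: coeff_pCons split: nat.splits)
  qed
  show "x \<in> real_adjoin S x" unfolding real_adjoin_def
      using S by (auto intro!: exI[of _ "[:0,1:]"] simp: coeff_pCons split: nat.splits)
qed

definition real_valuation_ring :: "real set \<Rightarrow> bool" where
  "real_valuation_ring S \<longleftrightarrow> real_subring S \<and> (\<forall>x. x \<in> S \<or> inverse x \<in> S)"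

text \<open>Truncated coefficient sequences replace polynomials, because the descent below shortens
  the length \<open>n\<close> of the sum; the last coefficient may vanish.\<close>

lemma real_adjoin_sum:
  assumes S: "real_subring S" and "t \<in> real_adjoin S x"
  shows "\<exists>n a. (\<forall>i. a i \<in> S) \<and> t = (\<Sum>i\<le>n. a i * x ^ i)"
proof -
  obtain p where "t = poly p x" "\<forall>i. coeff p i \<in> S" using assms(2) unfolding real_adjoin_def by blast
  then show ?thesis unfolding poly_altdef by (intro exI[of _ "degree p"] exI[of _ "coeff p"]) simp
qed

text \<open>Both expansions cannot have minimal length: the shorter one rewrites the leading term of the
  longer one.\<close>

lemma reduce_expansion:
  assumes S: "real_subring S" and unit: "\<And>s. s \<in> S \<Longrightarrow> inverse (1 - s * inverse t) \<in> S"
    and tS: "inverse t \<in> S" "t \<notin> S" and x: "x \<noteq> 0"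
    and a: "\<forall>i. a i \<in> S" "t = (\<Sum>i\<le>n. a i * x ^ i)"
    and b: "\<forall>i. b i \<in> S" "t = (\<Sum>i\<le>m. b i * inverse x ^ i)"
    and mn: "m \<le> n"
  shows "\<exists>k<n. \<exists>a. (\<forall>i. a i \<in> S) \<and> t = (\<Sum>i\<le>k. a i * x ^ i)"
proof -
  note Sr = real_subringD[OF S]
  have t0: "t \<noteq> 0" using tS Sr by auto
  have "t \<noteq> b 0" using tS b by auto
  \<comment> \<open>\<open>v\<close> is the inverse of
    \<open>t - b 0 = t * (1 - b 0 * inverse t)\<close>. It lies in \<open>S\<close> because the
    second factor is a unit of \<open>S\<close> and \<open>inverse t\<close> belongs to
    \<open>S\<close>.\<close>
  define v where "v = inverse (1 - b 0 * inverse t) * inverse t"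
  have vS: "v \<in> S" unfolding v_def using unit b tS Sr by blast
  have vt: "v * (t - b 0) = 1"
    unfolding v_def using t0 \<open>t \<noteq> b 0\<close> by (simp add: field_simps)
  have n0: "n \<noteq> 0" using a tS by (cases n) auto
  then obtain k where k: "n = Suc k" by (cases n) auto
  have "t - b 0 = (\<Sum>i\<in>{1..m}. b i * inverse x ^ i)"
  proof -
    have "{..m} = insert 0 {1..m}" by auto
    then show ?thesis unfolding b(2) by simp
  qed
  then have "1 = v * (\<Sum>i\<in>{1..m}. b i * inverse x ^ i)" using vt by simp
  \<comment> \<open>Multiplication by \<open>x ^ n\<close> clears the negative powers since
    \<open>m \<le> n\<close>, and only exponents below \<open>n\<close> remain since the sum starts
    at \<open>1\<close>.\<close>
  then have "x ^ n = v * (\<Sum>i\<in>{1..m}. b i * inverse x ^ i) * x ^ n" by simp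
  also have "\<dots> = (\<Sum>i\<in>{1..m}. v * b i * x ^ (n - i))"
    unfolding sum_distrib_left sum_distrib_right
  proof (rule sum.cong)
    fix i assume "i \<in> {1..m}"
    then have "x ^ n = x ^ i * x ^ (n - i)" using mn by (simp flip: power_add)
    then show "v * (b i * inverse x ^ i) * x ^ n = v * b i * x ^ (n - i)"
      using x by (simp add: power_inverse)
  qed simp
  also have "\<dots> = (\<Sum>j\<in>{n-m..k}. v * b (n - j) * x ^ j)"
    by (rule sum.reindex_bij_witness[of _ "\<lambda>j. n - j" "\<lambda>i. n - i"]) (use mn k in auto)
  also have "\<dots> = (\<Sum>j\<le>k. (if n - m \<le> j then v * b (n - j) else 0) * x ^ j)"
    by (rule sum.mono_neutral_cong_left) auto
  finally have xn: "x ^ n = (\<Sum>j\<le>k. (if n - m \<le> j then v * b (n - j) else 0) * x ^ j)" .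
  have "t = (\<Sum>i\<le>k. a i * x ^ i) + a n * x ^ n" using a k by simp
  also have "\<dots> = (\<Sum>i\<le>k. (a i + a n * (if n - m \<le> i then v * b (n - i) else 0)) * x ^ i)"
    unfolding xn by (simp add: sum_distrib_left sum.distrib algebra_simps)
  finally have "t = (\<Sum>i\<le>k. (a i + a n * (if n - m \<le> i then v * b (n - i) else 0)) * x ^ i)" .
  moreover have "\<forall>i. (a i + a n * (if n - m \<le> i then v * b (n - i) else 0)) \<in> S"
    using a b vS Sr by auto
  moreover have "k < n" using k by simp
  ultimately show ?thesis by (intro exI[of _ k] conjI exI[of _ "\<lambda>i. a i + a n * (if n - m \<le> i then v * b (n - i) else 0)"])
qed

text \<open>Maximality is used twice. It makes every \<open>1 - s * inverse t\<close> a unit, and it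
  puts \<open>t\<close> into both \<open>S[x]\<close> and \<open>S[inverse x]\<close> if neither
  \<open>x\<close> nor its inverse lies in \<open>S\<close>. Two expansions of \<open>t\<close> of
  minimal length then contradict \<open>reduce_expansion\<close>.\<close>

lemma maximal_subring_valuation:
  assumes S: "real_subring S" "inverse t \<in> S" "t \<notin> S"
    and max: "\<And>T. real_subring T \<Longrightarrow> S \<subseteq> T \<Longrightarrow> t \<notin> T \<Longrightarrow> T = S"
  shows "real_valuation_ring S"
proof -
  note Sr = real_subringD[OF S(1)]
  have t0: "t \<noteq> 0" using S Sr by auto
  have unit: "inverse (1 - s * inverse t) \<in> S" if s: "s \<in> S" for s
  proof -
    \<comment> \<open>\<open>T\<close> is the localisation of \<open>S\<close> at the elements
      \<open>1 - z * inverse t\<close>. It still avoids \<open>t\<close>, since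
      \<open>t * (1 - z * inverse t) = t - z\<close> would give \<open>t = y + z\<close> in
      \<open>S\<close>; so maximality collapses it to \<open>S\<close>.\<close>
    define T where "T = {y / (1 - z * inverse t) | y z. y \<in> S \<and> z \<in> S}"
    have ne: "1 - z * inverse t \<noteq> 0" if "z \<in> S" for z
      using that S t0 by (auto simp: field_simps)
    have sub: "real_subring T" unfolding real_subring_def
    proof (intro conjI ballI)
      show "0 \<in> T" unfolding T_def using Sr by (auto intro!: exI[of _ 0])
      show "1 \<in> T" unfolding T_def using Sr by (auto intro!: exI[of _ 1] exI[of _ 0])
    next
      fix p q assume "p \<in> T" "q \<in> T"
      then obtain y z y' z' where p: "p = y / (1 - z * inverse t)" "y \<in> S" "z \<in> S"
        and q: "q = y' / (1 - z' * inverse t)" "y' \<in> S" "z' \<in> S" unfolding T_def by auto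
      \<comment> \<open>The denominators are closed under multiplication: \<open>z''\<close> is the
        element that belongs to the product of two of them.\<close>
      define z'' where "z'' = z + z' - z * z' * inverse t"
      have z'': "z'' \<in> S" "1 - z'' * inverse t = (1 - z * inverse t) * (1 - z' * inverse t)"
        unfolding z''_def using p q Sr S by (auto simp: algebra_simps)
      have "p * q = (y * y') / (1 - z'' * inverse t)" unfolding z'' p q by simp
      then show "p * q \<in> T" unfolding T_def using Sr p q z'' by blast
      have "p - q = (y * (1 - z' * inverse t) - y' * (1 - z * inverse t)) / (1 - z'' * inverse t)"
        unfolding z'' p q using ne[OF p(3)] ne[OF q(3)] by (simp add: diff_frac_eq)
      moreover have "y * (1 - z' * inverse t) - y' * (1 - z * inverse t) \<in> S"
        using p q S by (intro Sr) auto
      ultimately show "p - q \<in> T" unfolding T_def using z'' by blast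
    qed
    have "S \<subseteq> T"
    proof
      fix y assume "y \<in> S"
      moreover have "y = y / (1 - 0 * inverse t)" by simp
      ultimately show "y \<in> T" unfolding T_def using Sr(1) by blast
    qed
    have "t \<notin> T"
    proof
      assume "t \<in> T"
      then obtain y z where yz: "t = y / (1 - z * inverse t)" "y \<in> S" "z \<in> S" unfolding T_def by auto
      then have "t * (1 - z * inverse t) = y" using ne[of z] by (metis nonzero_eq_divide_eq)
      moreover have "t * (1 - z * inverse t) = t - z" using t0 by (simp add: right_diff_distrib)
      ultimately have "t = y + z" by simp
      then show False using Sr(6)[OF yz(2,3)] S(3) by simp
    qed
    then have "T = S" using max sub \<open>S \<subseteq> T\<close> by blast
    moreover have "inverse (1 - s * inverse t) = 1 / (1 - s * inverse t)" by (simp add: divide_inverse)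
    then have "inverse (1 - s * inverse t) \<in> T" unfolding T_def using s Sr(2) by blast
    ultimately show ?thesis by simp
  qed
  \<comment> \<open>\<open>Q y n\<close> says that \<open>t\<close> has an expansion of length
    \<open>n\<close> in powers of \<open>y\<close>; it is minimised for \<open>y = x\<close> and for
    \<open>y = inverse x\<close>.\<close>
  define Q where "Q = (\<lambda>x n. \<exists>a. (\<forall>i. a i \<in> S) \<and> t = (\<Sum>i\<le>n::nat. a i * x ^ i))"
  have "x \<in> S \<or> inverse x \<in> S" for x
  proof (rule ccontr)
    assume "\<not> ?thesis"
    then have xs: "x \<notin> S" "inverse x \<notin> S" by auto
    then have x0: "x \<noteq> 0" using Sr by auto
    have "t \<in> real_adjoin S y" if "y \<notin> S" for y
      using max[of "real_adjoin S y"] real_adjoin_subring real_adjoin_superset S(1) that by blast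
    then have ex: "\<exists>n. Q y n" if "y \<notin> S" for y
      unfolding Q_def using real_adjoin_sum[OF S(1)] that by blast
    obtain n where n: "Q x n" "\<forall>k<n. \<not> Q x k" using ex[OF xs(1)] exists_least_iff[of "Q x"] by blast
    obtain m where m: "Q (inverse x) m" "\<forall>k<m. \<not> Q (inverse x) k"
      using ex[OF xs(2)] exists_least_iff[of "Q (inverse x)"] by blast
    obtain a where a: "\<forall>i. a i \<in> S" "t = (\<Sum>i\<le>n. a i * x ^ i)" using n unfolding Q_def by blast
    obtain b where b: "\<forall>i. b i \<in> S" "t = (\<Sum>i\<le>m. b i * inverse x ^ i)" using m unfolding Q_def by blast
    show False
    proof (cases "m \<le> n")
      case True
      from reduce_expansion[OF S(1) unit S(2,3) x0 a b True] n(2) show False unfolding Q_def by blast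
    next
      case False
      \<comment> \<open>The same reduction with \<open>x\<close> and \<open>inverse x\<close>
        exchanged.\<close>
      have "\<exists>k<m. \<exists>a. (\<forall>i. a i \<in> S) \<and> t = (\<Sum>i\<le>k. a i * inverse x ^ i)"
        by (rule reduce_expansion[OF S(1) unit S(2,3), of _ b m a n]) (use x0 a b False in auto)
      with m(2) show False unfolding Q_def by blast
    qed
  qed
  then show ?thesis unfolding real_valuation_ring_def using S by blast
qed

text \<open>Zorn's lemma is applied to the subrings that contain \<open>R\<close> and
  \<open>inverse t\<close> but not \<open>t\<close>; the hypothesis makes
  \<open>R[inverse t]\<close> one of them. A ring maximal in this family is maximal among all its
  overrings avoiding \<open>t\<close>, because these contain \<open>R\<close> and
  \<open>inverse t\<close> as well.\<close>

lemma exists_valuation_ring_avoiding: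
  assumes R: "real_subring R" and t: "t \<notin> real_adjoin R (inverse t)"
  shows "\<exists>S. real_valuation_ring S \<and> R \<subseteq> S \<and> t \<notin> S"
proof -
  define F where "F = {S. real_subring S \<and> R \<subseteq> S \<and> inverse t \<in> S \<and> t \<notin> S}"
  have "\<exists>M\<in>F. \<forall>X\<in>F. M \<subseteq> X \<longrightarrow> X = M"
  proof (rule subset_Zorn_nonempty)
    show "F \<noteq> {}" using real_adjoin_subring[OF R] real_adjoin_superset[OF R] t unfolding F_def by blast
  next
    fix C assume C: "C \<noteq> {}" "subset.chain F C"
    then have CF: "\<And>S. S \<in> C \<Longrightarrow> S \<in> F" unfolding subset.chain_def by blast
    have "real_subring (\<Union>C)" unfolding real_subring_def
    proof (intro conjI ballI)
      show "0 \<in> \<Union>C" "1 \<in> \<Union>C" using C CF real_subringD unfolding F_def by blast+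
      fix x y assume "x \<in> \<Union>C" "y \<in> \<Union>C"
      then obtain X Y where X: "X \<in> C" "x \<in> X" "Y \<in> C" "y \<in> Y" by blast
      then have "X \<subseteq> Y \<or> Y \<subseteq> X" using C unfolding subset.chain_def by blast
      then obtain Z where Z: "Z \<in> C" "x \<in> Z" "y \<in> Z" using X by blast
      then have "x - y \<in> Z" "x * y \<in> Z" using CF[OF Z(1)] real_subringD[of Z] unfolding F_def by auto
      then show "x - y \<in> \<Union>C" "x * y \<in> \<Union>C" using Z by auto
    qed
    then show "\<Union>C \<in> F" using C CF unfolding F_def by blast
  qed
  then obtain S where S: "S \<in> F" "\<And>X. X \<in> F \<Longrightarrow> S \<subseteq> X \<Longrightarrow> X = S" by blast
  have "real_valuation_ring S"
    by (rule maximal_subring_valuation[of S t]) (use S in \<open>auto simp: F_def\<close>)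
  then show ?thesis using S unfolding F_def by blast
qed

section \<open>Countability of the elements common to all valuation rings over a countable
  set\<close>

text \<open>Closing under differences and products countably often preserves countability, and any
  two elements of the union already occur together at a finite stage.\<close>

lemma countable_subring_superset:
  assumes "countable F"
  shows "\<exists>R. real_subring R \<and> countable R \<and> F \<subseteq> R"
proof -
  define c where "c = rec_nat (F \<union> {0,1}) (\<lambda>_ X. X \<union> (\<lambda>(x,y). x - y) ` (X \<times> X) \<union> (\<lambda>(x,y). x * y) ` (X \<times> X))"
  have c0: "c 0 = F \<union> {0,1}" and
    cS: "\<And>n. c (Suc n) = c n \<union> (\<lambda>(x,y). x - y) ` (c n \<times> c n) \<union> (\<lambda>(x,y). x * y) ` (c n \<times> c n)"
    unfolding c_def by simp_all
  have cc: "countable (c n)" for n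
    by (induction n) (use assms c0 cS in auto)
  have mono: "c n \<subseteq> c m" if "n \<le> m" for n m
    using that by (induction rule: dec_induct) (use cS in auto)
  have "real_subring (\<Union>n. c n)" unfolding real_subring_def
  proof (intro conjI ballI)
    show "0 \<in> (\<Union>n. c n)" "1 \<in> (\<Union>n. c n)" using c0 by blast+
    fix x y assume "x \<in> (\<Union>n. c n)" "y \<in> (\<Union>n. c n)"
    then obtain n m where "x \<in> c n" "y \<in> c m" by blast
    then have "x \<in> c (max n m)" "y \<in> c (max n m)" using mono[of n "max n m"] mono[of m "max n m"] by auto
    then have "x - y \<in> c (Suc (max n m))" "x * y \<in> c (Suc (max n m))" unfolding cS by auto
    then show "x - y \<in> (\<Union>n. c n)" "x * y \<in> (\<Union>n. c n)" by blast+
  qed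
  moreover have "F \<subseteq> (\<Union>n. c n)" using c0 by blast
  ultimately show ?thesis using cc by blast
qed

text \<open>Coefficient lists over a countable set are countable in number, and each nonzero
  polynomial has finitely many roots.\<close>

lemma countable_algebraic_over:
  assumes "countable (R :: real set)"
  shows "countable {t. \<exists>p. p \<noteq> 0 \<and> (\<forall>i. coeff p i \<in> R) \<and> poly p t = 0}"
proof -
  define P where "P = {p::real poly. p \<noteq> 0 \<and> (\<forall>i. coeff p i \<in> R)}"
  have "P \<subseteq> Poly ` lists R"
  proof
    fix p assume "p \<in> P"
    then have "coeffs p \<in> lists R" unfolding P_def by (auto simp: coeffs_def)
    moreover have "p = Poly (coeffs p)" by simp
    ultimately show "p \<in> Poly ` lists R" by blast
  qed
  then have "countable P" using assms by (meson countable_image countable_lists countable_subset)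
  then have "countable (\<Union>p\<in>P. {t. poly p t = 0})"
    by (intro countable_UN) (auto simp: P_def intro: countable_finite poly_roots_finite)
  moreover have "{t. \<exists>p. p \<noteq> 0 \<and> (\<forall>i. coeff p i \<in> R) \<and> poly p t = 0} = (\<Union>p\<in>P. {t. poly p t = 0})"
    unfolding P_def by auto
  ultimately show ?thesis by simp
qed

text \<open>Multiplying \<open>t = (\<Sum>i\<le>n. a i * inverse t ^ i)\<close> by
  \<open>t ^ n\<close> gives a monic equation for \<open>t\<close>. The case \<open>t = 0\<close> is
  separate since \<open>inverse 0 = 0\<close>.\<close>

lemma adjoin_inverse_algebraic:
  assumes R: "real_subring R" and t: "t \<in> real_adjoin R (inverse t)"
  shows "\<exists>p. p \<noteq> 0 \<and> (\<forall>i. coeff p i \<in> R) \<and> poly p t = 0"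
proof (cases "t = 0")
  case True
  then show ?thesis using real_subringD[OF R]
    by (auto intro!: exI[of _ "[:0,1:]"] simp: coeff_pCons split: nat.splits)
next
  case False
  obtain n a where a: "\<forall>i. a i \<in> R" "t = (\<Sum>i\<le>n. a i * inverse t ^ i)"
    using real_adjoin_sum[OF R t] by blast
  define p where "p = monom 1 (Suc n) - (\<Sum>i\<le>n. monom (a i) (n - i))"
  have co: "coeff p k = (if k = Suc n then 1 else 0) - (\<Sum>i\<le>n. if n - i = k then a i else 0)" for k
    unfolding p_def by (simp add: coeff_sum)
  have "coeff p (Suc n) = 1" unfolding co by (auto intro: sum.neutral)
  then have "p \<noteq> 0" by auto
  moreover have "coeff p k \<in> R" for k
  proof -
    have "(\<Sum>i\<le>n. if n - i = k then a i else 0) \<in> R"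
      using real_subringD[OF R] a by (intro real_subring_sum[OF R]) auto
    then show ?thesis unfolding co using real_subringD[OF R] by auto
  qed
  moreover have "poly p t = 0"
  proof -
    have "poly p t = t ^ Suc n - (\<Sum>i\<le>n. a i * t ^ (n - i))"
      unfolding p_def by (simp add: poly_sum poly_monom)
    also have "(\<Sum>i\<le>n. a i * t ^ (n - i)) = (\<Sum>i\<le>n. a i * inverse t ^ i) * t ^ n"
      unfolding sum_distrib_right
    proof (rule sum.cong)
      fix i assume "i \<in> {..n}"
      then have "t ^ n = t ^ i * t ^ (n - i)" by (simp flip: power_add)
      then show "a i * t ^ (n - i) = a i * inverse t ^ i * t ^ n"
        using False by (simp add: power_inverse)
    qed simp
    also have "\<dots> = t * t ^ n" using a(2) by simp
    finally show ?thesis by simp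
  qed
  ultimately show ?thesis by blast
qed

text \<open>With \<open>R\<close> a countable ring containing \<open>F\<close>, an element outside
  \<open>R[inverse t]\<close> is avoided by some valuation ring over \<open>R\<close>. Hence the
  common elements are roots of nonzero polynomials over \<open>R\<close>.\<close>

lemma countable_common_valuation_elements:
  assumes "countable F"
  shows "countable {t. \<forall>S. real_valuation_ring S \<and> F \<subseteq> S \<longrightarrow> t \<in> S}"
proof -
  obtain R where R: "real_subring R" "countable R" "F \<subseteq> R"
    using countable_subring_superset[OF assms] by blast
  have "{t. \<forall>S. real_valuation_ring S \<and> F \<subseteq> S \<longrightarrow> t \<in> S}
      \<subseteq> {t. \<exists>p. p \<noteq> 0 \<and> (\<forall>i. coeff p i \<in> R) \<and> poly p t = 0}"
  proof (intro subsetI CollectI)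
    fix t assume t: "t \<in> {t. \<forall>S. real_valuation_ring S \<and> F \<subseteq> S \<longrightarrow> t \<in> S}"
    have "t \<in> real_adjoin R (inverse t)"
    proof (rule ccontr)
      assume "t \<notin> real_adjoin R (inverse t)"
      then obtain S where "real_valuation_ring S" "R \<subseteq> S" "t \<notin> S"
        using exists_valuation_ring_avoiding[OF R(1)] by metis
      moreover from this have "F \<subseteq> S" using R(3) by blast
      ultimately show False using t by blast
    qed
    then show "\<exists>p. p \<noteq> 0 \<and> (\<forall>i. coeff p i \<in> R) \<and> poly p t = 0"
      by (rule adjoin_inverse_algebraic[OF R(1)])
  qed
  then show ?thesis using countable_algebraic_over[OF R(2)] countable_subset by blast
qed

text \<open>A special case of integral closedness: if \<open>x\<close> were missing, then
  \<open>inverse x\<close> would be present, and \<open>x\<close> is the product of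
  \<open>x\<^sup>2\<close> and \<open>inverse x\<close>.\<close>

lemma valuation_ring_power2:
  assumes "real_valuation_ring S" "x\<^sup>2 \<in> S"
  shows "x \<in> S"
proof (rule ccontr)
  assume "x \<notin> S"
  moreover from this have "inverse x \<in> S" using assms unfolding real_valuation_ring_def by blast
  moreover have "x = x\<^sup>2 * inverse x" by (cases "x = 0") (auto simp: power2_eq_square)
  ultimately show False using assms real_subringD(4)[of S "x\<^sup>2" "inverse x"]
    unfolding real_valuation_ring_def by metis
qed

text \<open>Divisibility is total in a valuation ring, so a finite family has an entry of largest
  size. In the induction the new entry either is divisible by the old dominant one or replaces
  it.\<close>

lemma valuation_ring_dominant:
  assumes S: "real_valuation_ring S" and "finite I" "\<exists>i\<in>I. f i \<noteq> (0::real)"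
  shows "\<exists>j\<in>I. f j \<noteq> 0 \<and> (\<forall>i\<in>I. f i / f j \<in> S)"
  using assms(2,3)
proof (induction I)
  case (insert k I)
  have Sr: "real_subring S" using S unfolding real_valuation_ring_def by blast
  note Sr' = real_subringD[OF Sr]
  show ?case
  proof (cases "\<exists>i\<in>I. f i \<noteq> 0")
    case False
    then have "f k \<noteq> 0" using insert by auto
    then show ?thesis using False Sr' by (intro bexI[of _ k]) auto
  next
    case True
    then obtain j where j: "j \<in> I" "f j \<noteq> 0" "\<forall>i\<in>I. f i / f j \<in> S" using insert by blast
    show ?thesis
    proof (cases "f k / f j \<in> S")
      case True
      then show ?thesis using j by (intro bexI[of _ j]) auto
    next
      case False
      then have k0: "f k \<noteq> 0" using Sr' by auto
      have "inverse (f k / f j) \<in> S" using False S unfolding real_valuation_ring_def by blast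
      then have "f j / f k \<in> S" by simp
      then have "f i / f k \<in> S" if "i \<in> I" for i
        using Sr'(4)[of "f i / f j" "f j / f k"] j that by auto
      then show ?thesis using k0 Sr' by (intro bexI[of _ k]) auto
    qed
  qed
qed auto

text \<open>If \<open>w\<close> lies in the kernel of the linearisation and vanishes at \<open>a\<close>, then after normalising \<open>w\<close> at
  its dominant index \<open>b\<close> the row \<open>a\<close> bounds the multiplier, and the row \<open>b\<close> bounds \<open>u b\<close>; the
  equilibrium equation then bounds the dominant entry of \<open>u\<close>.\<close>

lemma degenerate_equilibrium_in_valuation_ring:
  assumes S: "real_valuation_ring S" and I: "finite I"
    and AS: "\<And>i k. i \<in> I \<Longrightarrow> k \<in> I \<Longrightarrow> A i k \<in> S" and third: "1/3 \<in> S"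
    and crit: "\<And>i. i \<in> I \<Longrightarrow> u i ^ 3 + (\<Sum>k\<in>I. A i k * u k) = c"
    and ker: "\<And>i. i \<in> I \<Longrightarrow> 3 * (u i)\<^sup>2 * w i + (\<Sum>k\<in>I. A i k * w k) = d"
    and a: "a \<in> I" "w a = 0" and w: "\<exists>i\<in>I. w i \<noteq> 0" and i: "i \<in> I"
  shows "u i \<in> S"
proof -
  have Sr: "real_subring S" using S unfolding real_valuation_ring_def by blast
  note Sr' = real_subringD[OF Sr]
  \<comment> \<open>Linear terms divided by a dominant entry stay in \<open>S\<close>, for
    \<open>w\<close> as well as for \<open>u\<close>.\<close>
  have rows: "(\<Sum>k\<in>I. A i k * f k) / f j \<in> S" if "i \<in> I" "\<forall>k\<in>I. f k / f j \<in> S" for i j f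
    unfolding sum_divide_distrib
    using AS that Sr' by (intro real_subring_sum[OF Sr]) (simp flip: times_divide_eq_right)
  obtain b where b: "b \<in> I" "w b \<noteq> 0" "\<forall>i\<in>I. w i / w b \<in> S"
    using valuation_ring_dominant[OF S I w] by blast
  \<comment> \<open>Since \<open>w a = 0\<close>, the term with \<open>(u a)\<^sup>2\<close> is
    absent from row \<open>a\<close>, which thus bounds \<open>d\<close> by linear terms
    alone.\<close>
  have "d / w b \<in> S" using rows[OF a(1) b(3)] ker[OF a(1)] a by simp
  moreover have "3 * (u b)\<^sup>2 + (\<Sum>k\<in>I. A b k * w k) / w b = d / w b"
    using ker[OF b(1)] b(2) by (simp add: field_simps)
  ultimately have "3 * (u b)\<^sup>2 \<in> S" using rows[OF b(1) b(3)] Sr'(3) by (metis add_diff_cancel_right')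
  then have "(u b)\<^sup>2 \<in> S" using Sr'(4)[OF third, of "3 * (u b)\<^sup>2"] by simp
  then have ub: "u b \<in> S" by (rule valuation_ring_power2[OF S])
  show ?thesis
  proof (cases "\<exists>i\<in>I. u i \<noteq> 0")
    case True
    obtain j where j: "j \<in> I" "u j \<noteq> 0" "\<forall>i\<in>I. u i / u j \<in> S"
      using valuation_ring_dominant[OF S I True] by blast
    have uj: "u j \<in> S"
    proof (rule ccontr)
      assume nj: "u j \<notin> S"
      then have inv: "inverse (u j) \<in> S" using S unfolding real_valuation_ring_def by blast
      \<comment> \<open>Rows \<open>j\<close> and \<open>b\<close> have the same right-hand side.
        After division by \<open>u j\<close> all linear terms lie in \<open>S\<close>, and so does
        the cubic term of row \<open>b\<close>, because \<open>u b\<close> and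
        \<open>inverse (u j)\<close> do; what remains is \<open>(u j)\<^sup>2\<close>.\<close>
      have "u j ^ 3 + (\<Sum>k\<in>I. A j k * u k) = u b ^ 3 + (\<Sum>k\<in>I. A b k * u k)"
        using crit j b by simp
      then have "(u j)\<^sup>2 + (\<Sum>k\<in>I. A j k * u k) / u j
          = u b * u b * u b * inverse (u j) + (\<Sum>k\<in>I. A b k * u k) / u j"
        using j(2) by (simp add: field_simps power2_eq_square power3_eq_cube)
      then have "(u j)\<^sup>2 = u b * u b * u b * inverse (u j) + (\<Sum>k\<in>I. A b k * u k) / u j
          - (\<Sum>k\<in>I. A j k * u k) / u j" by simp
      also have "\<dots> \<in> S" using rows[OF b(1) j(3)] rows[OF j(1) j(3)] ub inv Sr' by simp
      finally show False using valuation_ring_power2[OF S] nj by blast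
    qed
    then show ?thesis using j i Sr'(4)[of "u i / u j" "u j"] by simp
  next
    case False
    then show ?thesis using i Sr' by auto
  qed
qed

section \<open>Cluster points of slowly varying sequences\<close>

definition cluster_set :: "(nat \<Rightarrow> 'a::metric_space) \<Rightarrow> 'a set" where
  "cluster_set x = {l. \<exists>r. strict_mono r \<and> (x \<circ> r) \<longlonglongrightarrow> l}"

lemma cluster_set_frequently:
  assumes "l \<in> cluster_set x" "open U" "l \<in> U"
  shows "\<exists>\<^sub>F n in sequentially. x n \<in> U"
proof -
  obtain r where r: "strict_mono r" "(x \<circ> r) \<longlonglongrightarrow> l" using assms unfolding cluster_set_def by auto
  then have ev: "\<forall>\<^sub>F n in sequentially. x (r n) \<in> U" using assms(2,3) by (auto dest: topological_tendstoD)
  show ?thesis unfolding frequently_sequentially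
  proof
    fix N
    obtain M where "\<forall>n\<ge>M. x (r n) \<in> U" using ev unfolding eventually_sequentially by auto
    then have "x (r (max M N)) \<in> U" by auto
    moreover have "N \<le> r (max M N)" using seq_suble[OF r(1), of "max M N"] by simp
    ultimately show "\<exists>n\<ge>N. x n \<in> U" by blast
  qed
qed

lemma cluster_set_meets:
  assumes K: "compact K" "\<And>n. x n \<in> K" and C: "closed C" and f: "\<exists>\<^sub>F n in sequentially. x n \<in> C"
  shows "\<exists>l\<in>cluster_set x. l \<in> C"
proof -
  obtain r :: "nat \<Rightarrow> nat" where r: "strict_mono r" "\<And>n. x (r n) \<in> C"
  proof -
    have "infinite {n. x n \<in> C}" using f unfolding cofinite_eq_sequentially[symmetric]
      by (simp add: frequently_cofinite)
    then show thesis using infinite_enumerate[of "{n. x n \<in> C}"] that by auto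
  qed
  obtain l s where s: "strict_mono (s::nat\<Rightarrow>nat)" "((x \<circ> r) \<circ> s) \<longlonglongrightarrow> l"
    using seq_compactE[OF compact_imp_seq_compact[OF K(1)], of "x \<circ> r"] K(2)
    by (metis comp_apply)
  have "l \<in> C" by (rule closed_sequentially[OF C _ s(2)]) (use r in auto)
  moreover have "l \<in> cluster_set x"
    unfolding cluster_set_def using strict_mono_o[OF r(1) s(1)] s(2) by (auto simp: o_assoc)
  ultimately show ?thesis by blast
qed

lemma closed_cluster_set: "closed (cluster_set (x :: nat \<Rightarrow> 'a::metric_space))"
proof -
  have "l \<in> cluster_set x" if l: "l \<in> closure (cluster_set x)" for l
  proof -
    have fr: "\<exists>\<^sub>F n in sequentially. x n \<in> ball l e" if "e > 0" for e
    proof -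
      obtain y where "y \<in> cluster_set x" "dist y l < e"
        using l \<open>e > 0\<close> by (auto simp: closure_approachable)
      then show ?thesis by (intro cluster_set_frequently[of y]) (auto simp: dist_commute)
    qed
    have "\<forall>N n. \<exists>m>N. dist (x m) l < inverse (Suc n)"
    proof (intro allI)
      fix N n :: nat
      have "\<exists>m\<ge>Suc N. x m \<in> ball l (inverse (Suc n))"
        using fr[of "inverse (Suc n)"] unfolding frequently_sequentially by auto
      then show "\<exists>m>N. dist (x m) l < inverse (Suc n)" by (auto simp: dist_commute Suc_le_eq)
    qed
    then obtain g where g: "\<And>N n. g N n > N \<and> dist (x (g N n)) l < inverse (Suc n)" by metis
    \<comment> \<open>A diagonal choice: each new index exceeds the previous one and halts at
      distance below \<open>inverse (Suc n)\<close> from \<open>l\<close>.\<close>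
    define r where "r = rec_nat (g 0 0) (\<lambda>n k. g k (Suc n))"
    have r: "r 0 = g 0 0" "\<And>n. r (Suc n) = g (r n) (Suc n)" unfolding r_def by auto
    have sm: "strict_mono r" unfolding strict_mono_Suc_iff r(2) using g by blast
    have d: "dist (x (r n)) l < inverse (real (Suc n))" for n
    proof (cases n)
      case 0
      show ?thesis unfolding 0 r(1) using g by blast
    next
      case (Suc m)
      show ?thesis unfolding Suc r(2) using g by blast
    qed
    have lim: "(\<lambda>n. dist (x (r n)) l) \<longlonglongrightarrow> 0"
    proof (rule tendsto_sandwich[OF _ _ tendsto_const LIMSEQ_inverse_real_of_nat])
      show "\<forall>\<^sub>F n in sequentially. 0 \<le> dist (x (r n)) l" by simp
      show "\<forall>\<^sub>F n in sequentially. dist (x (r n)) l \<le> inverse (real (Suc n))"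
        by (rule always_eventually, rule allI, rule less_imp_le, rule d)
    qed
    have "(x \<circ> r) \<longlonglongrightarrow> l" unfolding comp_def by (rule tendsto_dist_iff[THEN iffD2, OF lim])
    with sm show ?thesis unfolding cluster_set_def by blast
  qed
  then have "closure (cluster_set x) \<subseteq> cluster_set x" by blast
  then show ?thesis by (simp only: closure_subset_eq)
qed

lemma cluster_set_subset: "closed K \<Longrightarrow> (\<And>n. x n \<in> K) \<Longrightarrow> cluster_set x \<subseteq> K"
proof
  fix l assume K: "closed K" "\<And>n. x n \<in> K" and "l \<in> cluster_set x"
  then obtain r where "(x \<circ> r) \<longlonglongrightarrow> l" unfolding cluster_set_def by blast
  then show "l \<in> K" by (rule closed_sequentially[OF K(1), rotated]) (simp add: K(2))
qed

text \<open>A discrete intermediate value argument: just before the first positive value after a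
  negative one, the sequence is at most zero, and the step across zero is shorter than
  \<open>e\<close>.\<close>

lemma frequently_small_between:
  fixes y :: "nat \<Rightarrow> real"
  assumes step: "(\<lambda>n. y (Suc n) - y n) \<longlonglongrightarrow> 0" and e: "e > 0"
    and neg: "\<exists>\<^sub>F n in sequentially. y n < 0" and pos: "\<exists>\<^sub>F n in sequentially. y n > 0"
  shows "\<exists>\<^sub>F n in sequentially. \<bar>y n\<bar> \<le> e"
  unfolding frequently_sequentially
proof
  fix N0
  obtain N where N: "\<forall>n\<ge>N. \<bar>y (Suc n) - y n\<bar> < e"
    using LIMSEQ_D[OF step e] by auto
  obtain n where n: "n \<ge> max N0 N" "y n < 0" using neg unfolding frequently_sequentially by blast
  obtain m where m: "m \<ge> n" "y m > 0" using pos unfolding frequently_sequentially by blast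
  define k where "k = (LEAST k. k \<ge> n \<and> y k > 0)"
  have k: "k \<ge> n" "y k > 0" using LeastI[of "\<lambda>k. k \<ge> n \<and> y k > 0" m] m unfolding k_def by auto
  then have "k \<noteq> n" using n by auto
  then obtain j where j: "k = Suc j" "j \<ge> n" using k by (cases k) auto
  then have "y j \<le> 0" using not_less_Least[of j "\<lambda>k. k \<ge> n \<and> y k > 0"] unfolding k_def[symmetric] by auto
  moreover have "\<bar>y (Suc j) - y j\<bar> < e" using N j n by auto
  ultimately have "\<bar>y j\<bar> \<le> e" using k j by auto
  then show "\<exists>n\<ge>N0. \<bar>y n\<bar> \<le> e" using j n by (intro exI[of _ j]) auto
qed

text \<open>If the cluster set split into two closed pieces, the difference \<open>f\<close> of the
  distances to them would change sign infinitely often with vanishing steps. It would then be small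
  at some cluster point, while \<open>\<bar>f\<bar>\<close> has a positive minimum on the compact
  cluster set.\<close>

lemma connected_cluster_set:
  fixes x :: "nat \<Rightarrow> 'a::metric_space"
  assumes K: "compact K" "\<And>n. x n \<in> K" and step: "(\<lambda>n. dist (x (Suc n)) (x n)) \<longlonglongrightarrow> 0"
  shows "connected (cluster_set x)"
  unfolding connected_closed
proof (rule notI, elim exE conjE)
  fix A B assume AB: "closed A" "closed B" "cluster_set x \<subseteq> A \<union> B" "A \<inter> B \<inter> cluster_set x = {}"
    "A \<inter> cluster_set x \<noteq> {}" "B \<inter> cluster_set x \<noteq> {}"
  let ?L = "cluster_set x"
  have cL: "compact ?L"
    using closed_cluster_set cluster_set_subset[of K x] K compact_imp_closed
      compact_Int_closed[OF K(1), of ?L] by (metis Int_absorb1)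
  define f where "f y = infdist y (A \<inter> ?L) - infdist y (B \<inter> ?L)" for y
  have cf: "continuous_on UNIV f" unfolding f_def by (intro continuous_intros)
  have clos: "closed (A \<inter> ?L)" "closed (B \<inter> ?L)" using AB closed_cluster_set by auto
  have fA: "f y < 0" if "y \<in> A \<inter> ?L" for y
  proof -
    have "y \<notin> B \<inter> ?L" using AB that by auto
    then have "infdist y (B \<inter> ?L) > 0" using infdist_pos_not_in_closed[OF clos(2)] AB by auto
    then show ?thesis unfolding f_def using that by simp
  qed
  have fB: "f y > 0" if "y \<in> B \<inter> ?L" for y
  proof -
    have "y \<notin> A \<inter> ?L" using AB that by auto
    then have "infdist y (A \<inter> ?L) > 0" using infdist_pos_not_in_closed[OF clos(1)] AB by auto
    then show ?thesis unfolding f_def using that by simp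
  qed
  obtain l0 where l0: "l0 \<in> ?L" "\<And>l. l \<in> ?L \<Longrightarrow> \<bar>f l0\<bar> \<le> \<bar>f l\<bar>"
    using continuous_attains_inf[OF cL, of "\<lambda>l. \<bar>f l\<bar>"] AB
    by (metis Int_empty_right cf continuous_on_rabs continuous_on_subset subset_UNIV)
  have f0: "\<bar>f l0\<bar> > 0" using fA[of l0] fB[of l0] AB(3) l0(1) by (cases "l0 \<in> A") auto
  have "\<exists>\<^sub>F n in sequentially. \<bar>f (x n)\<bar> \<le> \<bar>f l0\<bar> / 2"
  proof (rule frequently_small_between)
    have lip: "\<bar>f (x (Suc n)) - f (x n)\<bar> \<le> 2 * dist (x (Suc n)) (x n)" for n
      unfolding f_def using infdist_triangle[of "x (Suc n)" "A \<inter> ?L" "x n"]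
        infdist_triangle[of "x n" "A \<inter> ?L" "x (Suc n)"] infdist_triangle[of "x (Suc n)" "B \<inter> ?L" "x n"]
        infdist_triangle[of "x n" "B \<inter> ?L" "x (Suc n)"] by (simp add: dist_commute)
    have "(\<lambda>n. 2 * dist (x (Suc n)) (x n)) \<longlonglongrightarrow> 0" using tendsto_mult_left[OF step, of 2] by simp
    then show "(\<lambda>n. f (x (Suc n)) - f (x n)) \<longlonglongrightarrow> 0"
      by (rule Lim_null_comparison[rotated]) (use lip in auto)
    obtain a where a: "a \<in> A \<inter> ?L" using AB by auto
    show "\<exists>\<^sub>F n in sequentially. f (x n) < 0"
      using cluster_set_frequently[of a x "{y. f y < 0}"] a fA[OF a]
        open_Collect_less[OF cf continuous_on_const, of 0] by simp
    obtain b where b: "b \<in> B \<inter> ?L" using AB by auto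
    show "\<exists>\<^sub>F n in sequentially. f (x n) > 0"
      using cluster_set_frequently[of b x "{y. f y > 0}"] b fB[OF b]
        open_Collect_less[OF continuous_on_const cf, of 0] by simp
  qed (use f0 in auto)
  moreover have "closed {y. \<bar>f y\<bar> \<le> \<bar>f l0\<bar> / 2}"
    by (intro closed_Collect_le continuous_on_rabs cf continuous_on_const)
  ultimately have "\<exists>l\<in>?L. \<bar>f l\<bar> \<le> \<bar>f l0\<bar> / 2" using cluster_set_meets[OF K, of "{y. \<bar>f y\<bar> \<le> \<bar>f l0\<bar> / 2}"] by auto
  then show False using l0(2) f0 by force
qed

section \<open>Metric and compactness in the space of functions\<close>

text \<open>The metric on functions over a countable type is a series with weights
  \<open>(1/2) ^ n\<close>. Each truncated coordinate distance is at most the whole sum over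
  \<open>I\<close>, and the weights add up to \<open>2\<close>.\<close>

lemma dist_fun_le_l1:
  fixes x y :: "'i::countable \<Rightarrow> real"
  assumes "finite I" "\<And>i. i \<notin> I \<Longrightarrow> x i = y i"
  shows "dist x y \<le> 2 * (\<Sum>i\<in>I. \<bar>x i - y i\<bar>)"
proof -
  let ?s = "\<Sum>i\<in>I. \<bar>x i - y i\<bar>"
  have le: "min (dist (x i) (y i)) 1 \<le> ?s" for i
  proof (cases "i \<in> I")
    case True
    then show ?thesis using member_le_sum[of i I "\<lambda>i. \<bar>x i - y i\<bar>"] assms(1) by (auto simp: dist_real_def)
  next
    case False
    then show ?thesis using assms(2) by (auto intro!: sum_nonneg)
  qed
  have geo: "summable (\<lambda>n. (1/2::real) ^ n)" by (simp add: summable_geometric_iff)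
  have "dist x y \<le> (\<Sum>n. (1/2) ^ n * ?s)"
    unfolding dist_fun_def
  proof (rule suminf_le)
    show "(1/2)^n * min (dist (x (from_nat n)) (y (from_nat n))) 1 \<le> (1/2) ^ n * ?s" for n
      using le by (intro mult_left_mono) auto
    show "summable (\<lambda>n. (1/2)^n * min (dist (x (from_nat n)) (y (from_nat n))) 1)"
      by (rule summable_comparison_test'[OF geo]) auto
    show "summable (\<lambda>n. (1/2) ^ n * ?s)" by (rule summable_mult2[OF geo])
  qed
  also have "\<dots> = (\<Sum>n. (1/2) ^ n) * ?s" by (rule suminf_mult2[OF geo, symmetric])
  also have "\<dots> = 2 * ?s" using suminf_geometric[of "1/2::real"] by simp
  finally show ?thesis .
qed

text \<open>Tychonoff's theorem for intervals on \<open>I\<close> and the singleton of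
  \<open>0\<close> elsewhere.\<close>

lemma compact_box:
  fixes R :: real
  shows "compact {x :: 'i \<Rightarrow> real. (\<forall>i\<in>I. \<bar>x i\<bar> \<le> R) \<and> (\<forall>i. i \<notin> I \<longrightarrow> x i = 0)}"
proof -
  define S where "S i = (if i \<in> I then {-R..R} else {0::real})" for i
  have "compactin (product_topology (\<lambda>i. euclidean) UNIV) (PiE UNIV S)"
    unfolding compactin_PiE by (auto simp: S_def)
  then have "compact (PiE UNIV S)" unfolding euclidean_product_topology by simp
  moreover have "PiE UNIV S = {x. (\<forall>i\<in>I. \<bar>x i\<bar> \<le> R) \<and> (\<forall>i. i \<notin> I \<longrightarrow> x i = 0)}"
    by (auto simp: S_def PiE_iff abs_le_iff split: if_splits) (metis minus_le_iff)+
  ultimately show ?thesis by simp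
qed

section \<open>Systems with a cubic diagonal nonlinearity\<close>

text \<open>In the application \<open>I\<close> is the set of grid cells and \<open>A\<close> is the
  linear part of the chemical potential. The index \<open>a\<close> serves to normalise kernel
  vectors and as the parameter of curves of equilibria.\<close>

locale cubic_system =
  fixes I :: "'i::countable set" and A :: "'i \<Rightarrow> 'i \<Rightarrow> real" and a :: 'i
  assumes finite_I: "finite I" and sym: "\<And>i k. A i k = A k i" and a_in: "a \<in> I"
begin

definition gradient :: "('i \<Rightarrow> real) \<Rightarrow> 'i \<Rightarrow> real" where
  "gradient x i = x i ^ 3 + (\<Sum>k\<in>I. A i k * x k)"

definition energy :: "('i \<Rightarrow> real) \<Rightarrow> real" where
  "energy x = (\<Sum>i\<in>I. x i ^ 4) / 4 + (\<Sum>i\<in>I. \<Sum>k\<in>I. A i k * x i * x k) / 2"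

definition linearised :: "('i \<Rightarrow> real) \<Rightarrow> ('i \<Rightarrow> real) \<Rightarrow> 'i \<Rightarrow> real" where
  "linearised u v i = 3 * (u i)\<^sup>2 * v i + (\<Sum>k\<in>I. A i k * v k)"

text \<open>Conservation of mass leaves a Lagrange multiplier in the equilibrium equation; the
  oscillation is the size of a gradient that ignores such a constant.\<close>

definition osc :: "('i \<Rightarrow> real) \<Rightarrow> real" where
  "osc w = (\<Sum>i\<in>I. \<Sum>j\<in>I. \<bar>w i - w j\<bar>)"

definition l1 :: "('i \<Rightarrow> real) \<Rightarrow> real" where
  "l1 v = (\<Sum>i\<in>I. \<bar>v i\<bar>)"

text \<open>Extension by zero makes agreement on \<open>I\<close> the same as equality of functions,
  so that cluster sets and countability can be treated in the full function type.\<close>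

definition supported :: "('i \<Rightarrow> real) set" where
  "supported = {x. \<forall>i. i \<notin> I \<longrightarrow> x i = 0}"

definition equilibria :: "('i \<Rightarrow> real) set" where
  "equilibria = {u \<in> supported. osc (gradient u) = 0}"

text \<open>Normalising the kernel vector to vanish at \<open>a\<close> removes the one-dimensional kernel that is
  unavoidable along a curve of equilibria.\<close>

definition degenerate :: "('i \<Rightarrow> real) set" where
  "degenerate = {u \<in> equilibria. \<exists>w. osc (linearised u w) = 0 \<and> w a = 0 \<and> (\<exists>i\<in>I. w i \<noteq> 0)}"

lemma osc_nonneg: "0 \<le> osc w" and l1_nonneg: "0 \<le> l1 w"
  by (auto simp: osc_def l1_def intro!: sum_nonneg)

lemma osc_eq_0_iff: "osc w = 0 \<longleftrightarrow> (\<forall>i\<in>I. \<forall>j\<in>I. w i = w j)"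
  unfolding osc_def using finite_I by (simp add: sum_nonneg_eq_0_iff sum_nonneg)

lemma l1_eq_0_iff: "l1 w = 0 \<longleftrightarrow> (\<forall>i\<in>I. w i = 0)"
  unfolding l1_def using finite_I by (simp add: sum_nonneg_eq_0_iff)

lemma abs_le_l1: "i \<in> I \<Longrightarrow> \<bar>v i\<bar> \<le> l1 v"
  unfolding l1_def using finite_I by (intro member_le_sum) auto

lemma l1_triangle: "l1 (\<lambda>i. x i - z i) \<le> l1 (\<lambda>i. x i - y i) + l1 (\<lambda>i. y i - z i)"
  unfolding l1_def sum.distrib[symmetric] by (intro sum_mono) auto

lemma osc_diff_le: "osc (\<lambda>i. v i - w i) \<le> osc v + osc w"
  unfolding osc_def sum.distrib[symmetric] by (intro sum_mono) auto

lemma osc_le_l1: "osc w \<le> 2 * card I * l1 w"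
proof -
  have "osc w \<le> (\<Sum>i\<in>I. \<Sum>j\<in>I. \<bar>w i\<bar> + \<bar>w j\<bar>)" unfolding osc_def by (intro sum_mono) auto
  also have "\<dots> = 2 * card I * l1 w" unfolding l1_def by (simp add: sum.distrib sum_distrib_left mult.assoc)
  finally show ?thesis .
qed

text \<open>All entries of a degenerate equilibrium lie in the countable set \<open>T\<close> of
  elements common to the valuation rings over \<open>F\<close>, and finitely many entries determine
  the equilibrium.\<close>

lemma countable_degenerate: "countable degenerate"
proof -
  define F where "F = insert (1/3) ((\<lambda>(i,k). A i k) ` (I \<times> I))"
  define T where "T = {t. \<forall>S. real_valuation_ring S \<and> F \<subseteq> S \<longrightarrow> t \<in> S}"
  have "countable T" unfolding T_def
    by (rule countable_common_valuation_elements) (auto simp: F_def finite_I intro: countable_finite)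
  then have c: "countable (PiE I (\<lambda>_. T))" using finite_I by (intro countable_PiE) auto
  have "degenerate \<subseteq> (\<lambda>f i. if i \<in> I then f i else 0) ` PiE I (\<lambda>_. T)"
  proof
    fix u assume u: "u \<in> degenerate"
    then obtain w where w: "osc (linearised u w) = 0" "w a = 0" "\<exists>i\<in>I. w i \<noteq> 0" and eq: "osc (gradient u) = 0"
      and sup: "u \<in> supported"
      unfolding degenerate_def equilibria_def by auto
    have "u i \<in> T" if i: "i \<in> I" for i
      unfolding T_def
    proof (intro CollectI allI impI, elim conjE)
      fix S assume S: "real_valuation_ring S" "F \<subseteq> S"
      show "u i \<in> S"
      proof (rule degenerate_equilibrium_in_valuation_ring[OF S(1) finite_I, where A = A and a = a
            and w = w and c = "gradient u a" and d = "linearised u w a"])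
        show "A i k \<in> S" if "i \<in> I" "k \<in> I" for i k using S(2) that unfolding F_def by auto
        show "1/3 \<in> S" using S(2) unfolding F_def by auto
        show "u i ^ 3 + (\<Sum>k\<in>I. A i k * u k) = gradient u a" if "i \<in> I" for i
          using eq that a_in unfolding osc_eq_0_iff gradient_def by blast
        show "3 * (u i)\<^sup>2 * w i + (\<Sum>k\<in>I. A i k * w k) = linearised u w a" if "i \<in> I" for i
          using w(1) that a_in unfolding osc_eq_0_iff linearised_def by blast
      qed (use a_in w i in auto)
    qed
    then have "restrict u I \<in> PiE I (\<lambda>_. T)" by auto
    moreover have "u = (\<lambda>i. if i \<in> I then restrict u I i else 0)" using sup unfolding supported_def by auto
    ultimately show "u \<in> (\<lambda>f i. if i \<in> I then f i else 0) ` PiE I (\<lambda>_. T)" by blast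
  qed
  then show ?thesis by (rule countable_subset[OF _ countable_image[OF c]])
qed

lemma continuous_on_coordinate: "continuous_on S (\<lambda>x::'i \<Rightarrow> real. x i)"
  by (rule continuous_on_subset[OF continuous_on_product_coordinates]) simp

lemma continuous_on_linearised: "continuous_on S (\<lambda>v. linearised u v i)"
  unfolding linearised_def by (intro continuous_intros continuous_on_coordinate)

lemma continuous_on_gradient: "continuous_on S (\<lambda>v. gradient v i)"
  unfolding gradient_def by (intro continuous_intros continuous_on_coordinate)

lemma continuous_on_energy: "continuous_on S energy"
  unfolding energy_def by (intro continuous_intros continuous_on_coordinate) auto

lemma continuous_on_l1: "continuous_on S (\<lambda>v. l1 (\<lambda>i. v i - u i))"
  unfolding l1_def by (intro continuous_intros continuous_on_coordinate)

lemma osc_cong: "(\<And>i. i \<in> I \<Longrightarrow> v i = w i) \<Longrightarrow> osc v = osc w"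
  unfolding osc_def by (intro sum.cong) auto

section \<open>Gradient bounds near nondegenerate equilibria\<close>

text \<open>Nondegeneracy says that the right-hand side vanishes nowhere on the unit sphere of
  \<open>l1\<close>. Compactness gives a positive minimum there, and homogeneity extends the bound
  to all \<open>v\<close>.\<close>

lemma nondegenerate_lower_bound:
  assumes "u \<in> equilibria" "u \<notin> degenerate"
  shows "\<exists>c>0. \<forall>v. c * l1 v \<le> osc (linearised u v) + \<bar>v a\<bar>"
proof -
  define f where "f v = osc (linearised u v) + \<bar>v a\<bar>" for v
  let ?B = "{x. (\<forall>i\<in>I. \<bar>x i\<bar> \<le> 1) \<and> (\<forall>i. i \<notin> I \<longrightarrow> x i = 0)}"
  define K where "K = ?B \<inter> {x. l1 x = 1}"
  have cl: "continuous_on UNIV l1" using continuous_on_l1[of UNIV "\<lambda>_. 0"] by simp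
  have K: "compact K" unfolding K_def
    by (intro compact_Int_closed compact_box closed_Collect_eq cl continuous_on_const)
  have "(\<lambda>i. if i = a then 1 else 0) \<in> K" unfolding K_def l1_def using a_in finite_I
    by (auto simp: if_distrib cong: if_cong)
  then have ne: "K \<noteq> {}" by blast
  have cf: "continuous_on K f" unfolding f_def osc_def
    by (intro continuous_intros continuous_on_linearised continuous_on_coordinate)
  obtain v0 where v0: "v0 \<in> K" "\<And>v. v \<in> K \<Longrightarrow> f v0 \<le> f v"
    using continuous_attains_inf[OF K ne cf] by blast
  have "f v0 \<noteq> 0"
  proof
    assume "f v0 = 0"
    then have "osc (linearised u v0) = 0" "v0 a = 0" unfolding f_def using osc_nonneg[of "linearised u v0"] by linarith+
    moreover have "\<exists>i\<in>I. v0 i \<noteq> 0" using v0(1) l1_eq_0_iff[of v0] unfolding K_def by auto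
    ultimately show False using assms unfolding degenerate_def by blast
  qed
  then have pos: "f v0 > 0" unfolding f_def using osc_nonneg[of "linearised u v0"] by linarith
  have "f v0 * l1 v \<le> osc (linearised u v) + \<bar>v a\<bar>" for v
  proof (cases "l1 v = 0")
    case True
    then show ?thesis using osc_nonneg[of "linearised u v"] by simp
  next
    case False
    then have lp: "l1 v > 0" using l1_nonneg[of v] by simp
    \<comment> \<open>The values of \<open>v\<close> outside \<open>I\<close> affect neither side;
      cutting them off puts the normalised vector into the compact set \<open>K\<close>.\<close>
    define w where "w i = (if i \<in> I then v i / l1 v else 0)" for i
    have "l1 w = 1"
    proof -
      have "l1 w = (\<Sum>i\<in>I. \<bar>v i\<bar> / l1 v)" unfolding l1_def[of w] w_def using lp by (intro sum.cong) auto
      also have "\<dots> = 1" using lp by (simp flip: sum_divide_distrib add: l1_def[symmetric])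
      finally show ?thesis .
    qed
    then have "w \<in> K" unfolding K_def using abs_le_l1[of _ w] by (auto simp: w_def)
    then have "f v0 \<le> f w" by (rule v0)
    also have "f w = (osc (linearised u v) + \<bar>v a\<bar>) / l1 v"
    proof -
      have "linearised u w i = linearised u v i / l1 v" if "i \<in> I" for i
        using that unfolding linearised_def w_def by (simp add: add_divide_distrib sum_divide_distrib)
      then have "osc (linearised u w) = osc (\<lambda>i. linearised u v i / l1 v)" by (rule osc_cong)
      also have "\<dots> = osc (linearised u v) / l1 v"
        unfolding osc_def using lp by (simp add: diff_divide_distrib[symmetric] sum_divide_distrib)
      finally show ?thesis unfolding f_def using lp a_in by (simp add: w_def add_divide_distrib)
    qed
    finally show ?thesis using lp by (simp add: field_simps)
  qed
  then show ?thesis using pos by blast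
qed

text \<open>The gradient difference deviates from the linearisation at \<open>u\<close> only through
  the factor \<open>x\<^sup>2 + x z + z\<^sup>2 - 3 u\<^sup>2\<close>, which is small near
  \<open>u\<close>; half of \<open>c\<close> absorbs this error.\<close>

lemma nondegenerate_local_bound:
  assumes c: "c > 0" "\<And>v. c * l1 v \<le> osc (linearised u v) + \<bar>v a\<bar>"
  shows "\<exists>r>0. \<forall>x z. l1 (\<lambda>i. x i - u i) < r \<longrightarrow> l1 (\<lambda>i. z i - u i) < r \<longrightarrow>
    c / 2 * l1 (\<lambda>i. x i - z i) \<le> osc (\<lambda>i. gradient x i - gradient z i) + \<bar>x a - z a\<bar>"
proof -
  define M where "M = l1 u"
  have M: "M \<ge> 0" unfolding M_def by (rule l1_nonneg)
  define N where "N = real (card I)"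
  have N: "N > 0" unfolding N_def using finite_I a_in card_gt_0_iff by auto
  \<comment> \<open>The error has entries at most
    \<open>3 * r * (2 * M + 1) * \<bar>d i\<bar>\<close>, and \<open>osc_le_l1\<close> costs a
    factor \<open>2 * N\<close>. The bound \<open>r \<le> 1\<close> makes products of two small
    deviations linear in \<open>r\<close>.\<close>
  define r where "r = min 1 (c / (12 * N * (2 * M + 1)))"
  have r: "r > 0" "r \<le> 1" unfolding r_def using c N M by auto
  have "r \<le> c / (12 * N * (2 * M + 1))" unfolding r_def by simp
  then have rc: "2 * N * (3 * r * (2 * M + 1)) \<le> c / 2"
  proof -
    have "0 < 12 * N * (2 * M + 1)" using N M by simp
    then have "r * (12 * N * (2 * M + 1)) \<le> c"
      using \<open>r \<le> c / (12 * N * (2 * M + 1))\<close> by (simp only: pos_le_divide_eq)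
    then show ?thesis by (simp add: algebra_simps)
  qed
  have "c / 2 * l1 (\<lambda>i. x i - z i) \<le> osc (\<lambda>i. gradient x i - gradient z i) + \<bar>x a - z a\<bar>"
    if xz: "l1 (\<lambda>i. x i - u i) < r" "l1 (\<lambda>i. z i - u i) < r" for x z
  proof -
    define d where "d i = x i - z i" for i
    define p where "p i = d i * ((x i)\<^sup>2 + x i * z i + (z i)\<^sup>2 - 3 * (u i)\<^sup>2)" for i
    have split: "linearised u d i = (gradient x i - gradient z i) - p i" for i
    proof -
      have "x i ^ 3 - z i ^ 3 = d i * ((x i)\<^sup>2 + x i * z i + (z i)\<^sup>2)"
        unfolding d_def by (simp add: power2_eq_square power3_eq_cube algebra_simps)
      then have "gradient x i - gradient z i = d i * ((x i)\<^sup>2 + x i * z i + (z i)\<^sup>2) + (\<Sum>k\<in>I. A i k * d k)"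
        unfolding gradient_def d_def by (simp add: right_diff_distrib sum_subtractf)
      then show ?thesis unfolding linearised_def p_def by (simp add: algebra_simps)
    qed
    have pb: "\<bar>p i\<bar> \<le> 3 * r * (2 * M + 1) * \<bar>d i\<bar>" if i: "i \<in> I" for i
    proof -
      have u: "\<bar>u i\<bar> \<le> M" and x: "\<bar>x i - u i\<bar> \<le> r" and z: "\<bar>z i - u i\<bar> \<le> r"
        using abs_le_l1[OF i, of u] abs_le_l1[OF i, of "\<lambda>i. x i - u i"] abs_le_l1[OF i, of "\<lambda>i. z i - u i"] xz
        unfolding M_def by auto
      have prod: "\<bar>s * t - u i * u i\<bar> \<le> r * (2 * M + 1)" if s: "\<bar>s - u i\<bar> \<le> r" and t: "\<bar>t - u i\<bar> \<le> r" for s t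
      proof -
        have "s * t - u i * u i = (s - u i) * (t - u i) + u i * (t - u i) + u i * (s - u i)"
          by (simp add: algebra_simps)
        also have "\<bar>\<dots>\<bar> \<le> \<bar>s - u i\<bar> * \<bar>t - u i\<bar> + \<bar>u i\<bar> * \<bar>t - u i\<bar> + \<bar>u i\<bar> * \<bar>s - u i\<bar>"
          by (simp add: abs_mult[symmetric] abs_triangle_ineq[THEN order_trans])
        also have "\<dots> \<le> 1 * r + M * r + M * r"
          using s t u r M by (intro add_mono mult_mono) auto
        finally show ?thesis by (simp add: algebra_simps)
      qed
      have "(x i)\<^sup>2 + x i * z i + (z i)\<^sup>2 - 3 * (u i)\<^sup>2
        = (x i * x i - u i * u i) + (x i * z i - u i * u i) + (z i * z i - u i * u i)"
        by (simp add: power2_eq_square)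
      also have "\<bar>\<dots>\<bar> \<le> 3 * r * (2 * M + 1)"
        using prod[OF x x] prod[OF x z] prod[OF z z] by linarith
      finally show ?thesis unfolding p_def abs_mult by (simp add: mult_left_mono mult.commute)
    qed
    have "l1 p \<le> 3 * r * (2 * M + 1) * l1 d"
      unfolding l1_def sum_distrib_left by (intro sum_mono pb)
    then have "2 * N * l1 p \<le> 2 * N * (3 * r * (2 * M + 1) * l1 d)"
      using N by (intro mult_left_mono) auto
    also have "\<dots> = 2 * N * (3 * r * (2 * M + 1)) * l1 d" by simp
    also have "\<dots> \<le> c / 2 * l1 d" using rc l1_nonneg by (intro mult_right_mono)
    finally have op: "osc p \<le> c / 2 * l1 d" using osc_le_l1[of p] unfolding N_def by simp
    have "c * l1 d \<le> osc (linearised u d) + \<bar>d a\<bar>" by (rule c)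
    also have "osc (linearised u d) \<le> osc (\<lambda>i. gradient x i - gradient z i) + osc p"
      unfolding split[abs_def] by (rule osc_diff_le)
    finally show ?thesis using op unfolding d_def by simp
  qed
  then show ?thesis using r by blast
qed

text \<open>Near a nondegenerate point of a connected set of equilibria, that set is a curve parametrised by
  the coordinate \<open>a\<close>; around an interior point of it, every \<open>y\<close> has a partner on the curve with
  the same coordinate \<open>a\<close>.\<close>

lemma equilibrium_arc:
  assumes conn: "connected Q" and sub: "Q \<subseteq> equilibria" and two: "q1 \<in> Q" "q2 \<in> Q" "q1 \<noteq> q2"
  shows "\<exists>p\<in>Q. \<exists>s>0. \<exists>k>0. \<forall>y. l1 (\<lambda>i. y i - p i) < s \<longrightarrow>
    (\<exists>z\<in>Q. k * l1 (\<lambda>i. y i - z i) \<le> osc (gradient y))"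
proof -
  \<comment> \<open>The countability of the degenerate equilibria enters here: a connected set with
    two points cannot consist of them alone.\<close>
  have "uncountable Q" using connected_uncountable[OF conn two] .
  then have "\<not> Q \<subseteq> degenerate" using countable_subset[OF _ countable_degenerate] by metis
  then obtain u where u: "u \<in> Q" "u \<notin> degenerate" by blast
  then obtain c where c: "c > 0" "\<And>v. c * l1 v \<le> osc (linearised u v) + \<bar>v a\<bar>"
    using nondegenerate_lower_bound[of u] sub by auto
  obtain r where r: "r > 0" and loc: "\<And>x z. l1 (\<lambda>i. x i - u i) < r \<Longrightarrow> l1 (\<lambda>i. z i - u i) < r \<Longrightarrow>
    c / 2 * l1 (\<lambda>i. x i - z i) \<le> osc (\<lambda>i. gradient x i - gradient z i) + \<bar>x a - z a\<bar>"
    using nondegenerate_local_bound[OF c] by blast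
  obtain q where q: "q \<in> Q" "q \<noteq> u" using two by metis
  have lq: "l1 (\<lambda>i. q i - u i) > 0"
  proof (rule ccontr)
    assume "\<not> ?thesis"
    then have "\<forall>i\<in>I. q i = u i" using l1_nonneg[of "\<lambda>i. q i - u i"] l1_eq_0_iff[of "\<lambda>i. q i - u i"] by auto
    moreover have "\<forall>i. i \<notin> I \<longrightarrow> q i = u i"
      using subsetD[OF sub q(1)] subsetD[OF sub u(1)] unfolding equilibria_def supported_def by auto
    ultimately have "q = u" by (intro ext) metis
    then show False using q(2) by blast
  qed
  \<comment> \<open>The ball of radius \<open>r'\<close> about \<open>u\<close> stays inside the
    region of the local bound and leaves \<open>q\<close> outside its interior, so \<open>Q\<close>
    has to leave the ball.\<close>
  define r' where "r' = min (r / 2) (l1 (\<lambda>i. q i - u i))"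
  have r': "r' > 0" "r' < r" "r' \<le> l1 (\<lambda>i. q i - u i)"
    unfolding r'_def using r lq by (simp_all add: min_less_iff_disj)
  \<comment> \<open>By the local bound, a point of \<open>Q\<close> at distance \<open>r'\<close>
    from \<open>u\<close> differs from \<open>u\<close> in the coordinate \<open>a\<close> by at
    least \<open>rho\<close>.\<close>
  define rho where "rho = c / 2 * r'"
  have rho: "rho > 0" unfolding rho_def using c r' by simp
  have oscQ: "osc (gradient z) = 0" if "z \<in> Q" for z using subsetD[OF sub that] unfolding equilibria_def by simp
  have QQ: "c / 2 * l1 (\<lambda>i. x i - u i) \<le> \<bar>x a - u a\<bar>" if x: "x \<in> Q" "l1 (\<lambda>i. x i - u i) < r" for x
  proof -
    have "osc (\<lambda>i. gradient x i - gradient u i) = 0"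
      using oscQ[OF x(1)] oscQ[OF u(1)] osc_diff_le[of "gradient x" "gradient u"] osc_nonneg[of "\<lambda>i. gradient x i - gradient u i"] by simp
    moreover have "l1 (\<lambda>i. u i - u i) < r" using r by (simp add: l1_def)
    ultimately show ?thesis using loc[OF x(2), of u] by simp
  qed
  define T where "T t \<longleftrightarrow> (\<exists>w\<in>Q. l1 (\<lambda>i. w i - u i) \<le> r' \<and> w a = u a + t)" for t
  \<comment> \<open>The connected set \<open>Q\<close> meets the frontier of the slab
    \<open>U\<close>. The choice of \<open>rho\<close> excludes the spherical part of the frontier,
    so the point found lies on one of the two faces that fix the coordinate
    \<open>a\<close>.\<close>
  have cross: "T s \<or> T (- s')" if s: "0 < s" "s < rho" "0 < s'" "s' < rho" for s s'
  proof -
    define U where "U = {x. l1 (\<lambda>i. x i - u i) < r'} \<inter> {x. x a < u a + s} \<inter> {x. u a - s' < x a}"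
    define V where "V = {x. l1 (\<lambda>i. x i - u i) \<le> r'} \<inter> {x. x a \<le> u a + s} \<inter> {x. u a - s' \<le> x a}"
    have oU: "open U" unfolding U_def
      by (intro open_Int open_Collect_less continuous_on_l1 continuous_on_coordinate continuous_on_const)
    have cV: "closed V" unfolding V_def
      by (intro closed_Int closed_Collect_le continuous_on_l1 continuous_on_coordinate continuous_on_const)
    have "u \<in> U" unfolding U_def using r' s by (simp add: l1_def)
    moreover have "q \<notin> U" unfolding U_def using r' by simp
    ultimately have "Q \<inter> frontier U \<noteq> {}"
      using u q by (intro connected_Int_frontier[OF conn]) auto
    then obtain w where w: "w \<in> Q" "w \<in> frontier U" by blast
    have "closure U \<subseteq> V" by (rule closure_minimal[OF _ cV]) (auto simp: U_def V_def)
    then have wV: "w \<in> V" "w \<notin> U" using w(2) oU unfolding frontier_def by (auto simp: interior_open)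
    show ?thesis
    proof (cases "l1 (\<lambda>i. w i - u i) = r'")
      case True
      then have "rho \<le> \<bar>w a - u a\<bar>" using QQ[OF w(1)] r' unfolding rho_def by simp
      moreover have "\<bar>w a - u a\<bar> < rho" using wV(1) s unfolding V_def by (auto simp: abs_less_iff)
      ultimately show ?thesis by simp
    next
      case False
      then have "w a = u a + s \<or> w a = u a + (- s')" using wV unfolding U_def V_def by auto
      then show ?thesis unfolding T_def using w wV unfolding V_def by auto
    qed
  qed
  \<comment> \<open>If one positive offset is missed, \<open>cross\<close> with that offset yields
    all negative ones. Hence at least one side of \<open>u\<close> is covered completely, and the
    sign \<open>e\<close> names it.\<close>
  obtain e :: real where e: "\<bar>e\<bar> = 1" "\<And>s. 0 < s \<Longrightarrow> s < rho \<Longrightarrow> T (e * s)"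
  proof (cases "\<forall>s. 0 < s \<longrightarrow> s < rho \<longrightarrow> T s")
    case True
    then show thesis using that[of 1] by auto
  next
    case False
    then show thesis using that[of "-1"] cross by auto
  qed
  \<comment> \<open>The midpoint of the covered side: for \<open>y\<close> close to
    \<open>p\<close>, the offset of \<open>y a\<close> stays within the covered range.\<close>
  obtain p where p: "p \<in> Q" "l1 (\<lambda>i. p i - u i) \<le> r'" "p a = u a + e * (rho / 2)"
    using e(2)[of "rho / 2"] rho unfolding T_def by auto
  define s where "s = min (rho / 2) (r - r')"
  have s: "s > 0" unfolding s_def using rho r' by simp
  have "\<exists>z\<in>Q. c / 2 * l1 (\<lambda>i. y i - z i) \<le> osc (gradient y)" if y: "l1 (\<lambda>i. y i - p i) < s" for y
  proof -
    have "\<bar>y a - p a\<bar> < rho / 2" using abs_le_l1[OF a_in, of "\<lambda>i. y i - p i"] y unfolding s_def by simp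
    moreover have ee: "e * e = 1" using e(1) by (metis abs_mult_self_eq mult_1)
    have "\<bar>e * (y a - p a)\<bar> = \<bar>y a - p a\<bar>" unfolding abs_mult using e by simp
    moreover have "e * (y a - u a) = e * (y a - p a) + e * e * (rho / 2)" using p(3) by (simp add: algebra_simps)
    ultimately have "0 < e * (y a - u a)" "e * (y a - u a) < rho" unfolding ee by linarith+
    then have "T (e * (e * (y a - u a)))" by (rule e(2))
    moreover have "e * (e * (y a - u a)) = y a - u a" using ee by (simp flip: mult.assoc)
    \<comment> \<open>The partner \<open>z\<close> agrees with \<open>y\<close> at \<open>a\<close>,
      which removes the coordinate term from the local bound, and its own gradient has oscillation
      zero.\<close>
    ultimately obtain z where z: "z \<in> Q" "l1 (\<lambda>i. z i - u i) \<le> r'" "z a = y a" unfolding T_def by auto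
    have "l1 (\<lambda>i. y i - u i) < r" using l1_triangle[of y u p] y p(2) unfolding s_def by simp
    moreover have "l1 (\<lambda>i. z i - u i) < r" using z r' by simp
    ultimately have "c / 2 * l1 (\<lambda>i. y i - z i) \<le> osc (\<lambda>i. gradient y i - gradient z i)" using loc[of y z] z(3) by simp
    also have "\<dots> \<le> osc (gradient y)" using osc_diff_le[of "gradient y" "gradient z"] oscQ[OF z(1)] by simp
    finally show ?thesis using z(1) by blast
  qed
  then show ?thesis using p(1) s c(1) by (intro bexI[of _ p] exI[of _ s] conjI exI[of _ "c/2"]) auto
qed

section \<open>Expansions of the energy\<close>

text \<open>The gradient at \<open>z\<close> is constant on \<open>I\<close> and
  \<open>y - z\<close> has sum zero, so the first-order term vanishes and a quadratic remainder is
  left.\<close>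

lemma energy_near_equilibrium:
  assumes z: "osc (gradient z) = 0" and mass: "sum y I = sum z I"
    and bd: "\<And>i. i \<in> I \<Longrightarrow> \<bar>y i\<bar> \<le> R" "\<And>i. i \<in> I \<Longrightarrow> \<bar>z i\<bar> \<le> R"
  shows "\<bar>energy y - energy z\<bar> \<le> (3/2 * R\<^sup>2 + (\<Sum>i\<in>I. \<Sum>k\<in>I. \<bar>A i k\<bar>) / 2) * (l1 (\<lambda>i. y i - z i))\<^sup>2"
proof -
  define d where "d i = y i - z i" for i
  have R: "R \<ge> 0" using bd(1)[OF a_in] by linarith
  have dl: "\<bar>d i\<bar> \<le> l1 d" if "i \<in> I" for i using abs_le_l1[OF that] .
  \<comment> \<open>This is Taylor's formula at \<open>z i\<close> with exact remainder. Its last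
    factor is at most \<open>6 * R\<^sup>2\<close> before division by \<open>4\<close>, whence the
    constant \<open>3/2\<close>.\<close>
  have quartic: "y i ^ 4 / 4 - z i ^ 4 / 4 = z i ^ 3 * d i + (d i)\<^sup>2 * (y i * y i + 2 * y i * z i + 3 * (z i * z i)) / 4" for i
    unfolding d_def by (simp add: field_simps power4_eq_xxxx power3_eq_cube power2_eq_square)
  have quad: "(\<Sum>i\<in>I. \<Sum>k\<in>I. A i k * y i * y k) = (\<Sum>i\<in>I. \<Sum>k\<in>I. A i k * z i * z k)
     + 2 * (\<Sum>i\<in>I. (\<Sum>k\<in>I. A i k * z k) * d i) + (\<Sum>i\<in>I. \<Sum>k\<in>I. A i k * d i * d k)"
  proof -
    have "(\<Sum>i\<in>I. \<Sum>k\<in>I. A i k * y i * y k) = (\<Sum>i\<in>I. \<Sum>k\<in>I. A i k * z i * z k)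
      + (\<Sum>i\<in>I. \<Sum>k\<in>I. A i k * z k * d i) + (\<Sum>i\<in>I. \<Sum>k\<in>I. A i k * z i * d k) + (\<Sum>i\<in>I. \<Sum>k\<in>I. A i k * d i * d k)"
      unfolding sum.distrib[symmetric] by (intro sum.cong refl) (simp add: d_def algebra_simps)
    also have "(\<Sum>i\<in>I. \<Sum>k\<in>I. A i k * z i * d k) = (\<Sum>i\<in>I. \<Sum>k\<in>I. A i k * z k * d i)"
      by (subst sum.swap) (simp add: sym)
    finally show ?thesis by (simp add: sum_distrib_right)
  qed
  have "energy y - energy z = (\<Sum>i\<in>I. gradient z i * d i) + (\<Sum>i\<in>I. (d i)\<^sup>2 * (y i * y i + 2 * y i * z i + 3 * (z i * z i)) / 4)
     + (\<Sum>i\<in>I. \<Sum>k\<in>I. A i k * d i * d k) / 2"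
  proof -
    have "(\<Sum>i\<in>I. y i ^ 4) / 4 - (\<Sum>i\<in>I. z i ^ 4) / 4
      = (\<Sum>i\<in>I. z i ^ 3 * d i) + (\<Sum>i\<in>I. (d i)\<^sup>2 * (y i * y i + 2 * y i * z i + 3 * (z i * z i)) / 4)"
      unfolding sum_divide_distrib sum_subtractf[symmetric] sum.distrib[symmetric] quartic ..
    moreover have "(\<Sum>i\<in>I. gradient z i * d i) = (\<Sum>i\<in>I. z i ^ 3 * d i) + (\<Sum>i\<in>I. (\<Sum>k\<in>I. A i k * z k) * d i)"
      unfolding gradient_def by (simp add: distrib_right sum.distrib)
    moreover have "X + (H + 2 * Y + P) / 2 - (Z + H / 2) = G + S + P / 2"
      if "X - Z = T + S" "G = T + Y" for X Z T S G Y H P :: real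
      using that by (simp add: field_simps)
    ultimately show ?thesis unfolding energy_def quad by blast
  qed
  also have "(\<Sum>i\<in>I. gradient z i * d i) = gradient z a * sum d I"
    unfolding sum_distrib_left
  proof (rule sum.cong)
    fix i assume "i \<in> I"
    then have "gradient z i = gradient z a" using z a_in unfolding osc_eq_0_iff by blast
    then show "gradient z i * d i = gradient z a * d i" by simp
  qed simp
  also have "sum d I = 0" unfolding d_def using mass by (simp add: sum_subtractf)
  finally have "energy y - energy z = gradient z a * 0 + (\<Sum>i\<in>I. (d i)\<^sup>2 * (y i * y i + 2 * y i * z i + 3 * (z i * z i)) / 4)
     + (\<Sum>i\<in>I. \<Sum>k\<in>I. A i k * d i * d k) / 2" .
  then have "\<bar>energy y - energy z\<bar> \<le> \<bar>\<Sum>i\<in>I. (d i)\<^sup>2 * (y i * y i + 2 * y i * z i + 3 * (z i * z i)) / 4\<bar>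
     + \<bar>\<Sum>i\<in>I. \<Sum>k\<in>I. A i k * d i * d k\<bar> / 2"
    using abs_triangle_ineq[of "\<Sum>i\<in>I. (d i)\<^sup>2 * (y i * y i + 2 * y i * z i + 3 * (z i * z i)) / 4"
        "(\<Sum>i\<in>I. \<Sum>k\<in>I. A i k * d i * d k) / 2"] by (simp only: mult_zero_right add_0_left abs_divide abs_numeral)
  also have "\<bar>\<Sum>i\<in>I. (d i)\<^sup>2 * (y i * y i + 2 * y i * z i + 3 * (z i * z i)) / 4\<bar> \<le> (\<Sum>i\<in>I. l1 d * \<bar>d i\<bar> * (3/2 * R\<^sup>2))"
  proof (rule order_trans[OF sum_abs], rule sum_mono)
    fix i assume i: "i \<in> I"
    have yz: "\<bar>s * t\<bar> \<le> R\<^sup>2" if "\<bar>s\<bar> \<le> R" "\<bar>t\<bar> \<le> R" for s t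
      unfolding abs_mult power2_eq_square using that R by (intro mult_mono) auto
    have "\<bar>y i * y i + 2 * y i * z i + 3 * (z i * z i)\<bar> \<le> 6 * R\<^sup>2"
      using yz[OF bd(1)[OF i] bd(1)[OF i]] yz[OF bd(1)[OF i] bd(2)[OF i]] yz[OF bd(2)[OF i] bd(2)[OF i]] by linarith
    moreover have "(d i)\<^sup>2 \<le> l1 d * \<bar>d i\<bar>"
      using mult_right_mono[OF dl[OF i], of "\<bar>d i\<bar>"] by (simp add: power2_eq_square)
    ultimately have "(d i)\<^sup>2 * \<bar>y i * y i + 2 * y i * z i + 3 * (z i * z i)\<bar> \<le> (l1 d * \<bar>d i\<bar>) * (6 * R\<^sup>2)"
      using l1_nonneg by (intro mult_mono) auto
    then show "\<bar>(d i)\<^sup>2 * (y i * y i + 2 * y i * z i + 3 * (z i * z i)) / 4\<bar> \<le> l1 d * \<bar>d i\<bar> * (3/2 * R\<^sup>2)"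
      by (simp add: abs_mult)
  qed
  also have "\<dots> = 3/2 * R\<^sup>2 * (l1 d)\<^sup>2"
    by (simp add: l1_def power2_eq_square sum_distrib_left sum_distrib_right mult_ac)
  also have "\<bar>\<Sum>i\<in>I. \<Sum>k\<in>I. A i k * d i * d k\<bar> \<le> (\<Sum>i\<in>I. \<Sum>k\<in>I. \<bar>A i k\<bar> * (l1 d)\<^sup>2)"
  proof (intro order_trans[OF sum_abs] sum_mono)
    fix i k assume ik: "i \<in> I" "k \<in> I"
    show "\<bar>A i k * d i * d k\<bar> \<le> \<bar>A i k\<bar> * (l1 d)\<^sup>2"
      using mult_mono[OF dl[OF ik(1)] dl[OF ik(2)]] l1_nonneg[of d]
      by (simp add: abs_mult power2_eq_square mult.assoc mult_left_mono)
  qed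
  also have "\<dots> = (\<Sum>i\<in>I. \<Sum>k\<in>I. \<bar>A i k\<bar>) * (l1 d)\<^sup>2" by (simp add: sum_distrib_right)
  finally show ?thesis unfolding d_def[symmetric, abs_def] by (simp add: algebra_simps)
qed

text \<open>Convexity bounds the quartic part from the new point \<open>x\<close>, and the quadratic
  part is expanded exactly. The remaining negative half of the quadratic form compensates the
  nonlocal term in the scheme.\<close>

lemma energy_increment:
  "energy x - energy y \<le> (\<Sum>i\<in>I. gradient x i * (x i - y i)) - (\<Sum>i\<in>I. \<Sum>k\<in>I. A i k * (x i - y i) * (x k - y k)) / 2"
proof -
  define d where "d i = x i - y i" for i
  have quartic: "x i ^ 4 / 4 - y i ^ 4 / 4 \<le> x i ^ 3 * d i" for i
  proof -
    have "x i ^ 3 * d i - (x i ^ 4 / 4 - y i ^ 4 / 4) = (d i)\<^sup>2 * (2 * (x i)\<^sup>2 + (x i + y i)\<^sup>2) / 4"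
      unfolding d_def by (simp add: field_simps power4_eq_xxxx power3_eq_cube power2_eq_square)
    also have "\<dots> \<ge> 0" by simp
    finally show ?thesis by simp
  qed
  have quad: "(\<Sum>i\<in>I. \<Sum>k\<in>I. A i k * y i * y k) = (\<Sum>i\<in>I. \<Sum>k\<in>I. A i k * x i * x k)
     - 2 * (\<Sum>i\<in>I. (\<Sum>k\<in>I. A i k * x k) * d i) + (\<Sum>i\<in>I. \<Sum>k\<in>I. A i k * d i * d k)"
  proof -
    have "(\<Sum>i\<in>I. \<Sum>k\<in>I. A i k * y i * y k) = (\<Sum>i\<in>I. \<Sum>k\<in>I. A i k * x i * x k)
      - (\<Sum>i\<in>I. \<Sum>k\<in>I. A i k * x k * d i) - (\<Sum>i\<in>I. \<Sum>k\<in>I. A i k * x i * d k) + (\<Sum>i\<in>I. \<Sum>k\<in>I. A i k * d i * d k)"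
      unfolding sum.distrib[symmetric] sum_subtractf[symmetric]
      by (intro sum.cong refl) (simp add: d_def algebra_simps)
    also have "(\<Sum>i\<in>I. \<Sum>k\<in>I. A i k * x i * d k) = (\<Sum>i\<in>I. \<Sum>k\<in>I. A i k * x k * d i)"
      by (subst sum.swap) (simp add: sym)
    finally show ?thesis by (simp add: sum_distrib_right)
  qed
  have q4: "(\<Sum>i\<in>I. x i ^ 4) / 4 - (\<Sum>i\<in>I. y i ^ 4) / 4 \<le> (\<Sum>i\<in>I. x i ^ 3 * d i)"
    unfolding sum_divide_distrib sum_subtractf[symmetric] by (intro sum_mono quartic)
  have g: "(\<Sum>i\<in>I. gradient x i * d i) = (\<Sum>i\<in>I. x i ^ 3 * d i) + (\<Sum>i\<in>I. (\<Sum>k\<in>I. A i k * x k) * d i)"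
    unfolding gradient_def by (simp add: distrib_right sum.distrib)
  have key: "X + H / 2 - (Z + (H - 2 * Y + P) / 2) \<le> G - P / 2"
    if "X - Z \<le> T" "G = T + Y" for X Z T G Y H P :: real
    using that by (simp add: field_simps)
  show ?thesis unfolding energy_def d_def[symmetric] quad by (rule key[OF q4 g])
qed

end

section \<open>Convergence of dissipative sequences\<close>

text \<open>The descent argument for a gradient inequality of exponent 1/2: \<open>v0 - v1\<close>
  is at most twice \<open>sqrt v0\<close> times the drop of the square root, and the inequality of
  arithmetic and geometric means isolates \<open>b2\<close>. The weights \<open>1/2\<close> and
  \<open>1/4\<close> make the contribution \<open>(b0 + b1) / 4\<close> telescope.\<close>

lemma telescoping_step:
  fixes b0 b1 b2 v0 v1 D \<kappa> :: real
  assumes nonneg: "b0 \<ge> 0" "b1 \<ge> 0" "b2 \<ge> 0" "0 \<le> v1" "v1 \<le> v0" and "D \<ge> 0" "\<kappa> > 0"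
    and dec: "\<kappa> * b2\<^sup>2 \<le> v0 - v1" and loj: "sqrt v0 \<le> D * (b0 + b1)"
  shows "b2 / 2 \<le> (2 * D / \<kappa> * sqrt v0 + b1 / 2 + b0 / 4) - (2 * D / \<kappa> * sqrt v1 + b2 / 2 + b1 / 4)"
proof -
  define Y where "Y = sqrt v0 - sqrt v1"
  have Y: "Y \<ge> 0" unfolding Y_def using assms by simp
  have "v0 - v1 = Y * (sqrt v0 + sqrt v1)"
    unfolding Y_def using assms by (simp add: algebra_simps)
  also have "\<dots> \<le> Y * (2 * (D * (b0 + b1)))"
  proof (rule mult_left_mono[OF _ Y])
    show "sqrt v0 + sqrt v1 \<le> 2 * (D * (b0 + b1))"
      using loj real_sqrt_le_mono[OF \<open>v1 \<le> v0\<close>] by linarith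
  qed
  finally have "\<kappa> * b2\<^sup>2 \<le> Y * (2 * (D * (b0 + b1)))" using dec by linarith
  then have "b2\<^sup>2 \<le> 4 * ((b0 + b1) / 4 * (2 * D / \<kappa> * Y))"
    using \<open>\<kappa> > 0\<close> by (simp add: field_simps)
  also have "\<dots> \<le> ((b0 + b1) / 4 + 2 * D / \<kappa> * Y)\<^sup>2"
  proof -
    have "4 * (s * t) \<le> (s + t)\<^sup>2" for s t :: real
      using zero_le_power2[of "s - t"] by (simp add: power2_eq_square algebra_simps)
    then show ?thesis .
  qed
  finally have "b2 \<le> (b0 + b1) / 4 + 2 * D / \<kappa> * Y"
    by (rule power2_le_imp_le) (use assms Y in auto)
  then show ?thesis unfolding Y_def right_diff_distrib add_divide_distrib by linarith
qed

context cubic_system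
begin

section \<open>Bounds from coercivity of the energy\<close>

text \<open>With \<open>M\<close> the largest modulus of an entry, the quartic sum is at least
  \<open>M ^ 4\<close>, while the quadratic form is at most a constant times
  \<open>M\<^sup>2\<close>.\<close>

lemma energy_coercive:
  obtains M where "\<And>j. j \<in> I \<Longrightarrow> \<bar>y j\<bar> \<le> M" "M \<ge> 0"
    "M ^ 4 / 4 - (\<Sum>i\<in>I. \<Sum>k\<in>I. \<bar>A i k\<bar>) * M\<^sup>2 / 2 \<le> energy y"
proof -
  define M where "M = Max ((\<lambda>i. \<bar>y i\<bar>) ` I)"
  have "M \<in> (\<lambda>i. \<bar>y i\<bar>) ` I" unfolding M_def using finite_I a_in by (intro Max_in) auto
  then obtain i where i: "i \<in> I" "M = \<bar>y i\<bar>" by blast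
  have M: "\<bar>y j\<bar> \<le> M" if "j \<in> I" for j unfolding M_def using finite_I that by (intro Max_ge) auto
  have "M ^ 4 = y i ^ 4" using i by simp
  also have "\<dots> \<le> (\<Sum>i\<in>I. y i ^ 4)" using finite_I i(1) by (intro member_le_sum) auto
  finally have q: "M ^ 4 \<le> (\<Sum>i\<in>I. y i ^ 4)" .
  have "\<bar>\<Sum>i\<in>I. \<Sum>k\<in>I. A i k * y i * y k\<bar> \<le> (\<Sum>i\<in>I. \<Sum>k\<in>I. \<bar>A i k\<bar> * M\<^sup>2)"
  proof (intro order_trans[OF sum_abs] sum_mono)
    fix i k assume ik: "i \<in> I" "k \<in> I"
    have "\<bar>y i\<bar> * \<bar>y k\<bar> \<le> M * M" using M ik i by (intro mult_mono) auto
    then show "\<bar>A i k * y i * y k\<bar> \<le> \<bar>A i k\<bar> * M\<^sup>2"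
      by (simp add: abs_mult power2_eq_square mult.assoc mult_left_mono)
  qed
  also have "\<dots> = (\<Sum>i\<in>I. \<Sum>k\<in>I. \<bar>A i k\<bar>) * M\<^sup>2" by (simp add: sum_distrib_right)
  finally have "M ^ 4 / 4 - (\<Sum>i\<in>I. \<Sum>k\<in>I. \<bar>A i k\<bar>) * M\<^sup>2 / 2 \<le> energy y" unfolding energy_def using q by linarith
  moreover have "M \<ge> 0" using i by simp
  ultimately show thesis using that[OF M] by blast
qed

lemma energy_bounded_below: "- (\<Sum>i\<in>I. \<Sum>k\<in>I. \<bar>A i k\<bar>)\<^sup>2 / 4 \<le> energy y"
proof -
  obtain M where M: "M ^ 4 / 4 - (\<Sum>i\<in>I. \<Sum>k\<in>I. \<bar>A i k\<bar>) * M\<^sup>2 / 2 \<le> energy y"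
    using energy_coercive[of y] by blast
  \<comment> \<open>Completing the square in \<open>M\<^sup>2\<close> minimises the coercive lower
    bound.\<close>
  have "0 \<le> (M\<^sup>2 - (\<Sum>i\<in>I. \<Sum>k\<in>I. \<bar>A i k\<bar>))\<^sup>2" by simp
  then have "2 * M\<^sup>2 * (\<Sum>i\<in>I. \<Sum>k\<in>I. \<bar>A i k\<bar>) \<le> M ^ 4 + (\<Sum>i\<in>I. \<Sum>k\<in>I. \<bar>A i k\<bar>)\<^sup>2"
    unfolding power2_diff by simp
  then show ?thesis using M by (simp add: field_simps)
qed

lemma energy_sublevel_bounded:
  obtains R where "R \<ge> 0" "\<And>y i. energy y \<le> E0 \<Longrightarrow> i \<in> I \<Longrightarrow> \<bar>y i\<bar> \<le> R"
proof -
  define S where "S = (\<Sum>i\<in>I. \<Sum>k\<in>I. \<bar>A i k\<bar>)"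
  have S: "S \<ge> 0" unfolding S_def by (intro sum_nonneg) auto
  \<comment> \<open>For \<open>M > R \<ge> 1\<close> one has \<open>M ^ 4 > R * M\<^sup>2\<close>,
    and this \<open>R\<close> exceeds the coefficient that the energy bound permits for
    \<open>M\<^sup>2\<close>.\<close>
  define R where "R = 2 * S + 4 * \<bar>E0\<bar> + 1"
  have R: "R \<ge> 1" unfolding R_def using S by simp
  have "\<bar>y i\<bar> \<le> R" if energy: "energy y \<le> E0" and i: "i \<in> I" for y i
  proof -
    obtain M where M: "\<And>j. j \<in> I \<Longrightarrow> \<bar>y j\<bar> \<le> M" "M \<ge> 0" "M ^ 4 / 4 - S * M\<^sup>2 / 2 \<le> energy y"
      using energy_coercive[of y] unfolding S_def by metis
    have "M \<le> R"
    proof (rule ccontr)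
      assume "\<not> M \<le> R"
      then have MR: "M > R" by simp
      then have M1: "1 \<le> M\<^sup>2" using R by (simp add: one_le_power)
      have "M \<le> M\<^sup>2" using MR R by (simp add: power2_eq_square)
      then have "R * M\<^sup>2 < M\<^sup>2 * M\<^sup>2" using MR M1 by (intro mult_strict_right_mono) auto
      also have "\<dots> = M ^ 4" by simp
      also have "\<dots> \<le> 2 * S * M\<^sup>2 + 4 * E0" using M(3) energy by (simp add: field_simps)
      also have "\<dots> \<le> 2 * S * M\<^sup>2 + 4 * \<bar>E0\<bar> * M\<^sup>2"
        using mult_left_mono[OF M1, of "4 * \<bar>E0\<bar>"] by simp
      finally have "(2 * S + 4 * \<bar>E0\<bar> + 1) * M\<^sup>2 < (2 * S + 4 * \<bar>E0\<bar>) * M\<^sup>2"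
        unfolding R_def by (simp add: algebra_simps)
      then show False using M1 by (simp add: mult_less_cancel_right)
    qed
    then show ?thesis using M(1)[OF i] by linarith
  qed
  then show thesis using that R by (meson order_trans zero_le_one)
qed

text \<open>\<open>V\<close> decreases, so \<open>b\<close> tends to zero and every cluster point is
  an equilibrium. A single cluster point gives convergence by compactness; with several, the
  gradient inequality on an arc of equilibria traps the sequence near one of them.\<close>

theorem dissipative_sequence_converges:
  fixes x :: "nat \<Rightarrow> 'i \<Rightarrow> real" and b :: "nat \<Rightarrow> real"
  assumes supp: "\<And>n. x n \<in> supported" and b: "\<And>n. b n \<ge> 0"
    and const: "\<mu> \<ge> 0" "\<kappa> > 0" "C \<ge> 0"
    and dec: "\<And>n. \<kappa> * (b (Suc n))\<^sup>2 \<le> (energy (x n) + \<mu> * (b n)\<^sup>2) - (energy (x (Suc n)) + \<mu> * (b (Suc n))\<^sup>2)"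
    and speed: "\<And>n. l1 (\<lambda>i. x (Suc n) i - x n i) \<le> C * b (Suc n)"
    and grad: "\<And>n. osc (gradient (x (Suc n))) \<le> C * (b n + b (Suc n))"
    and mass: "\<And>n. sum (x n) I = sum (x 0) I"
  shows "\<exists>p\<in>equilibria. sum p I = sum (x 0) I \<and> (\<forall>i\<in>I. (\<lambda>n. x n i) \<longlonglongrightarrow> p i)"
proof -
  \<comment> \<open>The term with \<open>b n\<close> makes the energy monotone along a two-step
    scheme.\<close>
  define V where "V n = energy (x n) + \<mu> * (b n)\<^sup>2" for n
  have decV: "\<kappa> * (b (Suc n))\<^sup>2 \<le> V n - V (Suc n)" for n unfolding V_def by (rule dec)
  have anti: "decseq V"
    unfolding decseq_Suc_iff
  proof
    fix n
    have "0 \<le> \<kappa> * (b (Suc n))\<^sup>2" using const by simp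
    then show "V (Suc n) \<le> V n" using decV[of n] by linarith
  qed
  have enV: "energy (x n) \<le> V n" for n unfolding V_def using const by simp
  have Vlow: "\<forall>n. - (\<Sum>i\<in>I. \<Sum>k\<in>I. \<bar>A i k\<bar>)\<^sup>2 / 4 \<le> V n"
    using energy_bounded_below enV order_trans by blast
  obtain Vinf where Vinf: "V \<longlonglongrightarrow> Vinf" "\<And>n. Vinf \<le> V n"
    using decseq_convergent[OF anti Vlow] by blast
  have b0: "b \<longlonglongrightarrow> 0"
  proof -
    have "(\<lambda>n. (V n - V (Suc n)) / \<kappa>) \<longlonglongrightarrow> (Vinf - Vinf) / \<kappa>"
      using Vinf(1) by (intro tendsto_intros LIMSEQ_Suc) (use const in auto)
    then have lim: "(\<lambda>n. (V n - V (Suc n)) / \<kappa>) \<longlonglongrightarrow> 0" by simp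
    have "(\<lambda>n. (b (Suc n))\<^sup>2) \<longlonglongrightarrow> 0"
    proof (rule tendsto_sandwich[OF _ _ tendsto_const lim])
      show "\<forall>\<^sub>F n in sequentially. (b (Suc n))\<^sup>2 \<le> (V n - V (Suc n)) / \<kappa>"
        using decV const by (intro always_eventually allI) (simp add: pos_le_divide_eq mult.commute)
    qed simp
    then have "(\<lambda>n. sqrt ((b (Suc n))\<^sup>2)) \<longlonglongrightarrow> sqrt 0" by (rule tendsto_real_sqrt)
    then have "(\<lambda>n. b (Suc n)) \<longlonglongrightarrow> 0" using b by simp
    then show ?thesis by (rule LIMSEQ_imp_Suc)
  qed
  obtain R where R: "R \<ge> 0" "\<And>y i. energy y \<le> V 0 \<Longrightarrow> i \<in> I \<Longrightarrow> \<bar>y i\<bar> \<le> R"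
    using energy_sublevel_bounded by blast
  have bd: "\<bar>x n i\<bar> \<le> R" if "i \<in> I" for n i
    using R(2)[OF _ that] enV[of n] decseqD[OF anti, of 0 n] by simp
  define K where "K = {x. (\<forall>i\<in>I. \<bar>x i\<bar> \<le> R) \<and> (\<forall>i. i \<notin> I \<longrightarrow> x i = 0)}"
  have K: "compact K" "\<And>n. x n \<in> K"
    unfolding K_def using compact_box[of I R] bd supp by (auto simp: supported_def)
  define Q where "Q = cluster_set x"
  have conn: "connected Q"
    unfolding Q_def
  proof (rule connected_cluster_set[OF K])
    have lim: "(\<lambda>n. 2 * (C * b (Suc n))) \<longlonglongrightarrow> 0"
      using tendsto_mult_left[OF LIMSEQ_Suc[OF b0], of "2 * C"] by (simp add: mult.assoc)
    show "(\<lambda>n. dist (x (Suc n)) (x n)) \<longlonglongrightarrow> 0"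
    proof (rule tendsto_sandwich[OF _ _ tendsto_const lim])
      have "dist (x (Suc n)) (x n) \<le> 2 * (C * b (Suc n))" for n
      proof -
        have "dist (x (Suc n)) (x n) \<le> 2 * l1 (\<lambda>i. x (Suc n) i - x n i)"
          unfolding l1_def using supp by (intro dist_fun_le_l1 finite_I) (simp add: supported_def)
        then show ?thesis using speed[of n] by linarith
      qed
      then show "\<forall>\<^sub>F n in sequentially. dist (x (Suc n)) (x n) \<le> 2 * (C * b (Suc n))" by simp
    qed simp
  qed
  have QK: "Q \<subseteq> K" unfolding Q_def by (rule cluster_set_subset[OF compact_imp_closed[OF K(1)] K(2)])
  \<comment> \<open>All cluster points share energy and mass, so the energy comparison applies to
    whichever partner \<open>z\<close> in \<open>Q\<close> the arc supplies.\<close>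
  have Qprops: "z \<in> equilibria \<and> energy z = Vinf \<and> sum z I = sum (x 0) I" if z: "z \<in> Q" for z
  proof -
    obtain r where r: "strict_mono r" "(x \<circ> r) \<longlonglongrightarrow> z" using z unfolding Q_def cluster_set_def by blast
    have comp: "(\<lambda>n. f (x (r n))) \<longlonglongrightarrow> f z" if "continuous_on UNIV f" for f :: "_ \<Rightarrow> real"
      using continuous_on_tendsto_compose[OF that r(2)] by (simp add: comp_def)
    have sub: "(\<lambda>n. f (r n)) \<longlonglongrightarrow> c" if "f \<longlonglongrightarrow> c" for f :: "nat \<Rightarrow> real" and c
      using LIMSEQ_subseq_LIMSEQ[OF that r(1)] by (simp add: comp_def)
    have "continuous_on UNIV (\<lambda>y. osc (gradient y))" unfolding osc_def
      by (intro continuous_intros continuous_on_gradient)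
    then have "(\<lambda>n. osc (gradient (x (r n)))) \<longlonglongrightarrow> osc (gradient z)" by (rule comp)
    moreover have "(\<lambda>n. osc (gradient (x n))) \<longlonglongrightarrow> 0"
    proof (rule LIMSEQ_imp_Suc, rule tendsto_sandwich[OF _ _ tendsto_const])
      show "(\<lambda>n. C * (b n + b (Suc n))) \<longlonglongrightarrow> 0"
        using tendsto_mult_left[OF tendsto_add[OF b0 LIMSEQ_Suc[OF b0]], of C] by simp
      show "\<forall>\<^sub>F n in sequentially. osc (gradient (x (Suc n))) \<le> C * (b n + b (Suc n))" using grad by simp
    qed (simp add: osc_nonneg)
    ultimately have "osc (gradient z) = 0" using sub LIMSEQ_unique by blast
    then have "z \<in> equilibria" unfolding equilibria_def supported_def using z QK unfolding K_def by auto
    moreover have "energy z = Vinf"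
    proof -
      have "(\<lambda>n. V n - \<mu> * (b n)\<^sup>2) \<longlonglongrightarrow> Vinf - \<mu> * 0\<^sup>2" using Vinf b0 by (intro tendsto_intros)
      then have "(\<lambda>n. energy (x n)) \<longlonglongrightarrow> Vinf" unfolding V_def by simp
      then show ?thesis using comp[OF continuous_on_energy] sub LIMSEQ_unique by blast
    qed
    moreover have "sum z I = sum (x 0) I"
    proof -
      have "continuous_on UNIV (\<lambda>y::'i \<Rightarrow> real. sum y I)"
        by (intro continuous_intros continuous_on_coordinate)
      from comp[OF this] show ?thesis unfolding mass[of "r _"] by (simp add: LIMSEQ_const_iff)
    qed
    ultimately show ?thesis by blast
  qed
  have "\<exists>p\<in>Q. \<forall>e>0. \<forall>\<^sub>F n in sequentially. l1 (\<lambda>i. x n i - p i) < e"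
  proof (cases "\<exists>q1\<in>Q. \<exists>q2\<in>Q. q1 \<noteq> q2")
    case False
    have "\<exists>l\<in>cluster_set x. l \<in> K"
      by (rule cluster_set_meets[OF K compact_imp_closed[OF K(1)]]) (use K(2) in simp)
    then obtain p where p: "p \<in> Q" unfolding Q_def by blast
    have "\<forall>\<^sub>F n in sequentially. l1 (\<lambda>i. x n i - p i) < e" if e: "e > 0" for e
    proof (rule ccontr)
      assume "\<not> ?thesis"
      then have "\<exists>\<^sub>F n in sequentially. x n \<in> {y. e \<le> l1 (\<lambda>i. y i - p i)}"
        by (simp add: not_eventually not_less)
      moreover have "closed {y. e \<le> l1 (\<lambda>i. y i - p i)}"
        by (intro closed_Collect_le continuous_on_l1 continuous_on_const)
      ultimately have "\<exists>l\<in>cluster_set x. l \<in> {y. e \<le> l1 (\<lambda>i. y i - p i)}"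
        by (rule cluster_set_meets[OF K, rotated])
      then obtain l where l: "l \<in> Q" "e \<le> l1 (\<lambda>i. l i - p i)" unfolding Q_def by auto
      have "l = p" using False p l(1) by metis
      then show False using l(2) e by (simp add: l1_def)
    qed
    then show ?thesis using p by blast
  next
    case True
    then obtain q1 q2 where q: "q1 \<in> Q" "q2 \<in> Q" "q1 \<noteq> q2" by blast
    have "Q \<subseteq> equilibria" using Qprops by blast
    then obtain p s k where p: "p \<in> Q" and s: "s > 0" and k: "k > 0"
      and arc: "\<And>y. l1 (\<lambda>i. y i - p i) < s \<Longrightarrow> \<exists>z\<in>Q. k * l1 (\<lambda>i. y i - z i) \<le> osc (gradient y)"
      using equilibrium_arc[OF conn _ q] by metis
    define H where "H = 3/2 * R\<^sup>2 + (\<Sum>i\<in>I. \<Sum>k\<in>I. \<bar>A i k\<bar>) / 2"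
    have H: "H \<ge> 0" unfolding H_def by (intro add_nonneg_nonneg divide_nonneg_nonneg sum_nonneg) auto
    \<comment> \<open>The two summands come from the quadratic energy gap, with distance at most
      \<open>C / k\<close> times the flux sizes, and from the term
      \<open>\<mu> * (b n)\<^sup>2\<close> of \<open>V\<close>.\<close>
    define D where "D = sqrt (H * (C / k)\<^sup>2 + \<mu>)"
    have D: "D \<ge> 0" unfolding D_def using H const by simp
    have loj: "sqrt (V (Suc n) - Vinf) \<le> D * (b n + b (Suc n))"
      if near: "l1 (\<lambda>i. x (Suc n) i - p i) < s" for n
    proof -
      obtain z where z: "z \<in> Q" "k * l1 (\<lambda>i. x (Suc n) i - z i) \<le> osc (gradient (x (Suc n)))"
        using arc[OF near] by blast
      have "l1 (\<lambda>i. x (Suc n) i - z i) \<le> (C / k) * (b n + b (Suc n))"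
        using z(2) grad[of n] k by (simp add: field_simps)
      then have sq: "(l1 (\<lambda>i. x (Suc n) i - z i))\<^sup>2 \<le> ((C / k) * (b n + b (Suc n)))\<^sup>2"
        using l1_nonneg by (intro power_mono)
      have "\<bar>energy (x (Suc n)) - energy z\<bar> \<le> H * (l1 (\<lambda>i. x (Suc n) i - z i))\<^sup>2"
        unfolding H_def
      proof (rule energy_near_equilibrium)
        show "osc (gradient z) = 0" using Qprops[OF z(1)] unfolding equilibria_def by blast
        show "sum (x (Suc n)) I = sum z I" using Qprops[OF z(1)] mass[of "Suc n"] by simp
        show "\<And>i. i \<in> I \<Longrightarrow> \<bar>z i\<bar> \<le> R" using z(1) QK unfolding K_def by blast
      qed (rule bd)
      also have "\<dots> \<le> H * ((C / k) * (b n + b (Suc n)))\<^sup>2" using sq H by (rule mult_left_mono)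
      finally have "V (Suc n) - Vinf \<le> H * ((C / k) * (b n + b (Suc n)))\<^sup>2 + \<mu> * (b (Suc n))\<^sup>2"
        unfolding V_def using Qprops[OF z(1)] by linarith
      also have "\<dots> \<le> H * ((C / k) * (b n + b (Suc n)))\<^sup>2 + \<mu> * (b n + b (Suc n))\<^sup>2"
        using const b by (intro add_left_mono mult_left_mono power_mono) auto
      also have "\<dots> = (H * (C / k)\<^sup>2 + \<mu>) * (b n + b (Suc n))\<^sup>2"
        by (simp only: power_mult_distrib distrib_right mult.assoc)
      finally have "sqrt (V (Suc n) - Vinf) \<le> sqrt ((H * (C / k)\<^sup>2 + \<mu>) * (b n + b (Suc n))\<^sup>2)"
        by (rule real_sqrt_le_mono)
      then show ?thesis unfolding D_def real_sqrt_mult using b by simp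
    qed
    \<comment> \<open>\<open>P\<close> bounds the remaining path: it tends to zero, and its decrease
      pays for each later increment while the sequence stays near \<open>p\<close>.\<close>
    define P where "P n = 2 * D / \<kappa> * sqrt (V (Suc n) - Vinf) + b (Suc n) / 2 + b n / 4" for n
    have Pnn: "P n \<ge> 0" for n unfolding P_def using D const b Vinf(2) by simp
    have "P \<longlonglongrightarrow> 2 * D / \<kappa> * sqrt (Vinf - Vinf) + 0 / 2 + 0 / 4"
      unfolding P_def using Vinf(1) b0 by (intro tendsto_intros LIMSEQ_Suc) auto
    then have P0: "P \<longlonglongrightarrow> 0" by simp
    have Pstep: "b (Suc (Suc n)) / 2 \<le> P n - P (Suc n)" if "l1 (\<lambda>i. x (Suc n) i - p i) < s" for n
      unfolding P_def
      by (rule telescoping_step) (use b D const Vinf(2) decV[of "Suc n"] decseqD[OF anti, of "Suc n" "Suc (Suc n)"]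
          loj[OF that] in auto)
    have "\<forall>\<^sub>F n in sequentially. l1 (\<lambda>i. x n i - p i) < e" if e: "e > 0" for e
    proof -
      define d where "d = min e s"
      have d: "d > 0" "d \<le> e" "d \<le> s" unfolding d_def using e s by auto
      have "(\<lambda>n. 2 * C * P n) \<longlonglongrightarrow> 0" using tendsto_mult_left[OF P0, of "2 * C"] by simp
      then obtain n1 where n1: "\<And>n. n \<ge> n1 \<Longrightarrow> 2 * C * P n < d / 2"
        using d(1) order_tendstoD(2)[of "\<lambda>n. 2 * C * P n" 0 sequentially "d / 2"]
        unfolding eventually_sequentially by auto
      have "open {y. l1 (\<lambda>i. y i - p i) < d / 2}"
        by (intro open_Collect_less continuous_on_l1 continuous_on_const)
      then have "\<exists>\<^sub>F n in sequentially. x n \<in> {y. l1 (\<lambda>i. y i - p i) < d / 2}"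
        using p d unfolding Q_def by (intro cluster_set_frequently[of p]) (auto simp: l1_def)
      \<comment> \<open>The entry index is taken positive so that it has the form
        \<open>Suc m0\<close>, the form in which the gradient bound is available.\<close>
      then obtain n0 where "n0 \<ge> Suc n1" "l1 (\<lambda>i. x n0 i - p i) < d / 2"
        unfolding frequently_sequentially by blast
      then obtain m0 where m0: "m0 \<ge> n1" "l1 (\<lambda>i. x (Suc m0) i - p i) < d / 2" by (cases n0) auto
      \<comment> \<open>Distance to \<open>p\<close> plus remaining budget never grows: a step costs
        at most \<open>C * b (Suc (Suc m))\<close>, which \<open>Pstep\<close> takes from the
        budget. As \<open>d \<le> s\<close>, the sequence never leaves the region where
        \<open>Pstep\<close> holds.\<close>
      have ind: "l1 (\<lambda>i. x (Suc m) i - p i) + 2 * C * P m < d" if "m \<ge> m0" for m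
        using that
      proof (induction m rule: dec_induct)
        case base
        then show ?case using m0 n1[of m0] by simp
      next
        case (step m)
        have "0 \<le> 2 * C * P m" using const Pnn[of m] by simp
        then have "l1 (\<lambda>i. x (Suc m) i - p i) < s" using step.IH d by linarith
        then have "2 * C * (b (Suc (Suc m)) / 2) \<le> 2 * C * (P m - P (Suc m))"
          using const by (intro mult_left_mono Pstep) auto
        then have "C * b (Suc (Suc m)) \<le> 2 * C * P m - 2 * C * P (Suc m)" by (simp add: algebra_simps)
        then show ?case
          using l1_triangle[of "x (Suc (Suc m))" p "x (Suc m)"] speed[of "Suc m"] step.IH by linarith
      qed
      have "l1 (\<lambda>i. x n i - p i) < e" if n: "n \<ge> Suc m0" for n
      proof -
        obtain m where m: "n = Suc m" "m \<ge> m0" using n by (cases n) auto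
        have "0 \<le> 2 * C * P m" using const Pnn[of m] by simp
        then show ?thesis unfolding m(1) using ind[OF m(2)] d by linarith
      qed
      then show ?thesis unfolding eventually_sequentially by blast
    qed
    then show ?thesis using p by blast
  qed
  then obtain p where p: "p \<in> Q" "\<And>e. e > 0 \<Longrightarrow> \<forall>\<^sub>F n in sequentially. l1 (\<lambda>i. x n i - p i) < e" by blast
  have "(\<lambda>n. x n i) \<longlonglongrightarrow> p i" if i: "i \<in> I" for i
  proof (rule tendstoI)
    fix e :: real assume "e > 0"
    from p(2)[OF this] show "\<forall>\<^sub>F n in sequentially. dist (x n i) (p i) < e"
    proof eventually_elim
      case (elim n)
      then show ?case using abs_le_l1[OF i, of "\<lambda>i. x n i - p i"] by (simp add: dist_real_def)
    qed
  qed
  then show ?thesis using Qprops[OF p(1)] by blast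
qed

end

section \<open>Calculus of periodic grid functions\<close>

definition gsum :: "nat \<Rightarrow> grid \<Rightarrow> real" where
  "gsum N f = (\<Sum>i=1..int N. \<Sum>j=1..int N. f i j)"

lemma periodic_int_multiple:
  fixes f :: "int \<Rightarrow> 'a"
  assumes "\<And>i. f (i + N) = f i"
  shows "f (i + m * N) = f i"
proof (induction m rule: int_induct[where k = 0])
  case (step1 m)
  then show ?case using assms[of "i + m * N"] by (simp add: algebra_simps)
next
  case (step2 m)
  then show ?case using assms[of "i + (m - 1) * N"] by (simp add: algebra_simps)
qed simp

lemma periodic_cong_mod:
  fixes f :: "int \<Rightarrow> 'a"
  assumes "\<And>i. f (i + N) = f i" and "i mod N = j mod N"
  shows "f i = f j"
proof -
  have "i = j + (i div N - j div N) * N"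
    using assms(2) div_mult_mod_eq[of i N] div_mult_mod_eq[of j N] unfolding left_diff_distrib by linarith
  then show ?thesis using periodic_int_multiple[of f N, OF assms(1)] by metis
qed

lemma sum_periodic_shift:
  fixes f :: "int \<Rightarrow> real"
  assumes per: "\<And>i. f (i + int N) = f i"
  shows "(\<Sum>i=1..int N. f (i + k)) = (\<Sum>i=1..int N. f i)"
proof -
  have one: "(\<Sum>i=1..int N. g (i + 1)) = (\<Sum>i=1..int N. g i)"
    if "\<And>i. g (i + int N) = g i" for g :: "int \<Rightarrow> real"
  proof (cases "N = 0")
    case False
    have "(\<Sum>i=1..int N. g (i + 1)) = (\<Sum>i=2..int N + 1. g i)"
      by (rule sum.reindex_bij_witness[of _ "\<lambda>i. i - 1" "\<lambda>i. i + 1"]) auto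
    also have "{2..int N + 1} = insert (int N + 1) {2..int N}" using False by auto
    also have "(\<Sum>i\<in>insert (int N + 1) {2..int N}. g i) = g (1 + int N) + (\<Sum>i=2..int N. g i)"
      by (simp add: add.commute)
    also have "\<dots> = (\<Sum>i\<in>insert 1 {2..int N}. g i)" unfolding that by simp
    also have "insert 1 {2..int N} = {1..int N}" using False by auto
    finally show ?thesis .
  qed simp
  have step: "(\<Sum>i=1..int N. f (i + (k + 1))) = (\<Sum>i=1..int N. f (i + k))" for k
  proof -
    have "f (i + int N + k) = f (i + k)" for i using per[of "i + k"] by (simp add: ac_simps)
    from one[of "\<lambda>i. f (i + k)", OF this] show ?thesis by (simp add: ac_simps)
  qed
  show ?thesis
  proof (induction k rule: int_induct[where k = 0])
    case (step1 k)
    then show ?case using step[of k] by simp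
  next
    case (step2 k)
    then show ?case using step[of "k - 1"] by simp
  qed simp
qed

lemma sum_periodic_reflect:
  fixes f :: "int \<Rightarrow> real"
  assumes per: "\<And>i. f (i + int N) = f i"
  shows "(\<Sum>i=1..int N. f (k - i)) = (\<Sum>i=1..int N. f i)"
proof -
  have "(\<Sum>i=1..int N. f (k - i)) = (\<Sum>i=1..int N. f (i + (k - int N - 1)))"
    by (rule sum.reindex_bij_witness[of _ "\<lambda>i. int N + 1 - i" "\<lambda>i. int N + 1 - i"]) (auto simp: algebra_simps)
  then show ?thesis using sum_periodic_shift[of f N, OF per] by simp
qed

lemma C_perD:
  assumes "\<phi> \<in> C_per N"
  shows "\<phi> (i + int N) j = \<phi> i j" "\<phi> i (j + int N) = \<phi> i j"
  using assms unfolding C_per_def by auto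

lemma C_perI:
  assumes "\<And>i j. \<phi> (i + int N) j = \<phi> i j" "\<And>i j. \<phi> i (j + int N) = \<phi> i j"
  shows "\<phi> \<in> C_per N"
  using assms unfolding C_per_def by auto

lemma C_per_shift:
  assumes "\<phi> \<in> C_per N"
  shows "(\<lambda>i j. \<phi> (i + a) (j + b)) \<in> C_per N"
  by (rule C_perI) (use C_perD[OF assms] in \<open>metis add.assoc add.commute\<close>)+

lemma C_per_compose:
  assumes "\<phi> \<in> C_per N" "\<psi> \<in> C_per N"
  shows "(\<lambda>i j. g (\<phi> i j) (\<psi> i j)) \<in> C_per N"
  using assms unfolding C_per_def by auto

lemma gsum_add: "gsum N (\<lambda>i j. f i j + g i j) = gsum N f + gsum N g"
  unfolding gsum_def by (simp add: sum.distrib)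

lemma gsum_diff: "gsum N (\<lambda>i j. f i j - g i j) = gsum N f - gsum N g"
  unfolding gsum_def by (simp add: sum_subtractf)

lemma gsum_cmult: "gsum N (\<lambda>i j. c * f i j) = c * gsum N f"
  unfolding gsum_def by (simp add: sum_distrib_left)

lemma gsum_mono:
  assumes "\<And>i j. i \<in> {1..int N} \<Longrightarrow> j \<in> {1..int N} \<Longrightarrow> f i j \<le> g i j"
  shows "gsum N f \<le> gsum N g"
  unfolding gsum_def by (intro sum_mono assms)

lemma gsum_cong:
  assumes "\<And>i j. i \<in> {1..int N} \<Longrightarrow> j \<in> {1..int N} \<Longrightarrow> f i j = g i j"
  shows "gsum N f = gsum N g"
  unfolding gsum_def by (intro sum.cong refl assms)

lemma gsum_nonneg: "(\<And>i j. 0 \<le> f i j) \<Longrightarrow> 0 \<le> gsum N f"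
  unfolding gsum_def by (intro sum_nonneg)

lemma abs_gsum: "\<bar>gsum N f\<bar> \<le> gsum N (\<lambda>i j. \<bar>f i j\<bar>)"
  unfolding gsum_def by (intro order_trans[OF sum_abs] sum_mono sum_abs)

lemma gsum_cartesian: "gsum N f = (\<Sum>p\<in>{1..int N} \<times> {1..int N}. f (fst p) (snd p))"
  unfolding gsum_def by (simp add: sum.cartesian_product case_prod_unfold)

lemma gsum_shift:
  assumes "f \<in> C_per N"
  shows "gsum N (\<lambda>i j. f (i + a) (j + b)) = gsum N f"
proof -
  have "gsum N (\<lambda>i j. f (i + a) (j + b)) = (\<Sum>i=1..int N. \<Sum>j=1..int N. f (i + a) j)"
    unfolding gsum_def by (intro sum.cong refl sum_periodic_shift C_perD[OF assms])
  also have "\<dots> = gsum N f"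
    unfolding gsum_def
    by (rule sum_periodic_shift[of "\<lambda>i. \<Sum>j=1..int N. f i j"]) (simp add: C_perD[OF assms])
  finally show ?thesis .
qed

lemma gsum_reflect:
  assumes "f \<in> C_per N"
  shows "gsum N (\<lambda>k l. f (i - k) (j - l)) = gsum N f"
proof -
  have "gsum N (\<lambda>k l. f (i - k) (j - l)) = (\<Sum>k=1..int N. \<Sum>l=1..int N. f (i - k) l)"
    unfolding gsum_def by (intro sum.cong refl sum_periodic_reflect C_perD[OF assms])
  also have "\<dots> = gsum N f"
    unfolding gsum_def
    by (rule sum_periodic_reflect[of "\<lambda>i. \<Sum>j=1..int N. f i j"]) (simp add: C_perD[OF assms])
  finally show ?thesis .
qed

text \<open>Periodicity removes the boundary terms: shifting the summed product turns a backward
  difference of \<open>q\<close> into a forward difference of \<open>\<phi>\<close>.\<close>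

lemma gsum_by_parts:
  assumes "\<phi> \<in> C_per N" "q \<in> C_per N"
  shows "gsum N (\<lambda>i j. \<phi> i j * (q i j - q (i - 1) j)) = - gsum N (\<lambda>i j. (\<phi> (i + 1) j - \<phi> i j) * q i j)"
    and "gsum N (\<lambda>i j. \<phi> i j * (q i j - q i (j - 1))) = - gsum N (\<lambda>i j. (\<phi> i (j + 1) - \<phi> i j) * q i j)"
proof -
  have "(\<lambda>i j. \<phi> (i + 1) j * q i j) \<in> C_per N"
    using C_per_compose[OF C_per_shift[OF assms(1), of 1 0] assms(2)] by simp
  from gsum_shift[OF this, of "-1" 0]
  have "gsum N (\<lambda>i j. \<phi> i j * q (i - 1) j) = gsum N (\<lambda>i j. \<phi> (i + 1) j * q i j)" by simp
  then show "gsum N (\<lambda>i j. \<phi> i j * (q i j - q (i - 1) j)) = - gsum N (\<lambda>i j. (\<phi> (i + 1) j - \<phi> i j) * q i j)"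
    by (simp add: right_diff_distrib left_diff_distrib gsum_diff)
  have "(\<lambda>i j. \<phi> i (j + 1) * q i j) \<in> C_per N"
    using C_per_compose[OF C_per_shift[OF assms(1), of 0 1] assms(2)] by simp
  from gsum_shift[OF this, of 0 "-1"]
  have "gsum N (\<lambda>i j. \<phi> i j * q i (j - 1)) = gsum N (\<lambda>i j. \<phi> i (j + 1) * q i j)" by simp
  then show "gsum N (\<lambda>i j. \<phi> i j * (q i j - q i (j - 1))) = - gsum N (\<lambda>i j. (\<phi> i (j + 1) - \<phi> i j) * q i j)"
    by (simp add: right_diff_distrib left_diff_distrib gsum_diff)
qed

text \<open>The Cauchy-Schwarz inequality on \<open>N * N\<close> cells.\<close>

lemma gsum_abs_le_sqrt: "gsum N (\<lambda>i j. \<bar>f i j\<bar>) \<le> real N * sqrt (gsum N (\<lambda>i j. (f i j)\<^sup>2))"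
proof -
  have "(gsum N (\<lambda>i j. \<bar>f i j\<bar>))\<^sup>2 \<le> gsum N (\<lambda>i j. (f i j)\<^sup>2) * (real N)\<^sup>2"
    using sum_squared_le_sum_of_squares[of "\<lambda>p. \<bar>f (fst p) (snd p)\<bar>" "{1..int N} \<times> {1..int N}"]
    unfolding gsum_cartesian by (simp add: power2_eq_square)
  also have "\<dots> = (real N * sqrt (gsum N (\<lambda>i j. (f i j)\<^sup>2)))\<^sup>2"
    by (simp add: power_mult_distrib gsum_nonneg)
  finally show ?thesis by (rule power2_le_imp_le) (simp add: gsum_nonneg)
qed

section \<open>Discrete primitives and fluxes\<close>

text \<open>Reducing the upper limit modulo \<open>N\<close> makes the primitive periodic by
  construction; at multiples of \<open>N\<close> it is an empty sum, which is consistent when the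
  total of \<open>f\<close> vanishes.\<close>

definition antidiff :: "nat \<Rightarrow> (int \<Rightarrow> real) \<Rightarrow> int \<Rightarrow> real" where
  "antidiff N f i = (\<Sum>k=1..i mod int N. f k)"

lemma antidiff_periodic: "antidiff N f (i + int N) = antidiff N f i"
  unfolding antidiff_def by simp

lemma antidiff_diff:
  assumes N: "N \<ge> 1" and per: "\<And>i. f (i + int N) = f i" and zero: "(\<Sum>i=1..int N. f i) = 0"
  shows "antidiff N f i - antidiff N f (i - 1) = f i"
proof (cases "i mod int N = 0")
  case True
  have "(i - 1) mod int N = int N - 1"
    by (rule int_mod_pos_eq[where q = "i div int N - 1"])
      (use True N div_mult_mod_eq[of i "int N"] in \<open>auto simp: right_diff_distrib mult.commute\<close>)
  then have "antidiff N f i - antidiff N f (i - 1) = - (\<Sum>k=1..int N - 1. f k)"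
    unfolding antidiff_def using True by simp
  moreover have "{1..int N} = insert (int N) {1..int N - 1}" using N by auto
  then have "(\<Sum>k=1..int N. f k) = f (int N) + (\<Sum>k=1..int N - 1. f k)" by simp
  moreover have "f i = f (int N)" by (rule periodic_cong_mod[of f "int N"]) (use per True in auto)
  ultimately show ?thesis using zero by simp
next
  case False
  then have pos: "i mod int N \<ge> 1" using N pos_mod_sign[of "int N" i] by linarith
  have "(i - 1) mod int N = i mod int N - 1"
  proof (rule int_mod_pos_eq)
    show "i - 1 = int N * (i div int N) + (i mod int N - 1)" by simp
    show "i mod int N - 1 < int N" using pos_mod_bound[of "int N" i] N by linarith
  qed (use pos in simp)
  moreover have "{1..i mod int N} = insert (i mod int N) {1..i mod int N - 1}" using pos by auto
  then have "(\<Sum>k=1..i mod int N. f k) = f (i mod int N) + (\<Sum>k=1..i mod int N - 1. f k)" by simp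
  moreover have "f (i mod int N) = f i" by (rule periodic_cong_mod[of f "int N"]) (use per in auto)
  ultimately show ?thesis unfolding antidiff_def by simp
qed

text \<open>Unlike an inverse discrete Laplacian, such a flux is explicit, and the energy estimate does not
  need it to be a gradient.\<close>

lemma exists_flux:
  assumes N: "N \<ge> 1" and h: "h \<noteq> 0" and f: "f \<in> C_per N" and zero: "gsum N f = 0"
  obtains q r where "q \<in> C_per N" "r \<in> C_per N"
    "\<And>i j. f i j = - ((q i j - q (i - 1) j) + (r i j - r i (j - 1))) / h"
proof -
  \<comment> \<open>The mean over \<open>j\<close> splits the problem: the means have total zero and
    are integrated in the first index, while \<open>f - m\<close> sums to zero over \<open>j\<close>
    and is integrated in the second.\<close>
  define m where "m i = (\<Sum>j=1..int N. f i j) / real N" for i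
  have mper: "m (i + int N) = m i" for i unfolding m_def by (simp add: C_perD[OF f])
  have "(\<Sum>i=1..int N. m i) = 0"
    unfolding m_def sum_divide_distrib[symmetric] using zero unfolding gsum_def by simp
  then have a1: "antidiff N m i - antidiff N m (i - 1) = m i" for i
    by (rule antidiff_diff[where f = m, OF N mper])
  have a2: "antidiff N (\<lambda>j. f i j - m i) j - antidiff N (\<lambda>j. f i j - m i) (j - 1) = f i j - m i" for i j
  proof (rule antidiff_diff[OF N])
    show "(\<Sum>j=1..int N. f i j - m i) = 0" using N by (simp add: sum_subtractf m_def)
  qed (simp add: C_perD[OF f])
  define q :: grid where "q = (\<lambda>i j. - h * antidiff N m i)"
  define r :: grid where "r = (\<lambda>i j. - h * antidiff N (\<lambda>j. f i j - m i) j)"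
  have "q \<in> C_per N" unfolding q_def by (rule C_perI) (simp_all add: antidiff_periodic)
  moreover have "r \<in> C_per N" unfolding r_def
    by (rule C_perI) (simp_all add: antidiff_periodic C_perD[OF f] mper)
  moreover have "f i j = - ((q i j - q (i - 1) j) + (r i j - r i (j - 1))) / h" for i j
  proof -
    have "q i j - q (i - 1) j = - h * m i"
      unfolding q_def using a1[of i] by (metis right_diff_distrib)
    moreover have "r i j - r i (j - 1) = - h * (f i j - m i)"
      unfolding r_def using a2[of i j] by (metis right_diff_distrib)
    ultimately show ?thesis using h by (simp add: field_simps)
  qed
  ultimately show thesis using that by blast
qed

section \<open>Oscillation of grid functions and Lipschitz bounds for the kernel\<close>

lemma chain_abs_diff_le:
  fixes f :: "int \<Rightarrow> real"
  assumes "i \<in> {1..n}" "k \<in> {1..n}"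
  shows "\<bar>f i - f k\<bar> \<le> (\<Sum>m=1..n. \<bar>f (m + 1) - f m\<bar>)"
proof -
  have main: "\<bar>f k - f i\<bar> \<le> (\<Sum>m=1..n. \<bar>f (m + 1) - f m\<bar>)" if ik: "1 \<le> i" "i \<le> k" "k \<le> n" for i k
  proof -
    have "\<bar>f k - f i\<bar> \<le> (\<Sum>m=i..k - 1. \<bar>f (m + 1) - f m\<bar>)" using ik(2)
    proof (induction k rule: int_ge_induct)
      case (step k)
      have "{i..k + 1 - 1} = insert k {i..k - 1}" using step by auto
      then show ?case using step by simp
    qed simp
    also have "\<dots> \<le> (\<Sum>m=1..n. \<bar>f (m + 1) - f m\<bar>)" by (rule sum_mono2) (use ik in auto)
    finally show ?thesis .
  qed
  show ?thesis using main[of i k] main[of k i] assms by (cases "i \<le> k") (auto simp: abs_minus_commute)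
qed

text \<open>Two cells are joined by a path along the first index and then along the second. This
  turns control of the discrete gradient of \<open>\<omega>\<close> into control of its
  oscillation.\<close>

lemma grid_abs_diff_le:
  assumes "i \<in> {1..int N}" "j \<in> {1..int N}" "k \<in> {1..int N}" "l \<in> {1..int N}"
  shows "\<bar>\<phi> i j - \<phi> k l\<bar> \<le> gsum N (\<lambda>i j. \<bar>\<phi> (i + 1) j - \<phi> i j\<bar>) + gsum N (\<lambda>i j. \<bar>\<phi> i (j + 1) - \<phi> i j\<bar>)"
proof -
  have "\<bar>\<phi> i j - \<phi> k j\<bar> \<le> (\<Sum>m=1..int N. \<bar>\<phi> (m + 1) j - \<phi> m j\<bar>)"
    using chain_abs_diff_le[OF assms(1,3), of "\<lambda>i. \<phi> i j"] .
  also have "\<dots> \<le> gsum N (\<lambda>i j. \<bar>\<phi> (i + 1) j - \<phi> i j\<bar>)"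
    unfolding gsum_def by (intro sum_mono member_le_sum[of j]) (use assms in auto)
  finally have 1: "\<bar>\<phi> i j - \<phi> k j\<bar> \<le> gsum N (\<lambda>i j. \<bar>\<phi> (i + 1) j - \<phi> i j\<bar>)" .
  have "\<bar>\<phi> k j - \<phi> k l\<bar> \<le> (\<Sum>m=1..int N. \<bar>\<phi> k (m + 1) - \<phi> k m\<bar>)"
    using chain_abs_diff_le[OF assms(2,4), of "\<phi> k"] .
  also have "\<dots> \<le> gsum N (\<lambda>i j. \<bar>\<phi> i (j + 1) - \<phi> i j\<bar>)"
    unfolding gsum_def by (rule member_le_sum) (use assms in \<open>auto intro!: sum_nonneg\<close>)
  finally show ?thesis using 1 by linarith
qed

text \<open>The partial derivatives are bounded on a compact square, and the mean value theorem is
  applied along each axis.\<close>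

lemma kernel_lipschitz:
  fixes J :: "real \<times> real \<Rightarrow> real"
  assumes "C_k 1 J"
  obtains K where "K > 0"
    "\<And>x x' y. \<bar>x\<bar> \<le> R \<Longrightarrow> \<bar>x'\<bar> \<le> R \<Longrightarrow> \<bar>y\<bar> \<le> R \<Longrightarrow> \<bar>J (x, y) - J (x', y)\<bar> \<le> K * \<bar>x - x'\<bar>"
    "\<And>x y y'. \<bar>x\<bar> \<le> R \<Longrightarrow> \<bar>y\<bar> \<le> R \<Longrightarrow> \<bar>y'\<bar> \<le> R \<Longrightarrow> \<bar>J (x, y) - J (x, y')\<bar> \<le> K * \<bar>y - y'\<bar>"
proof -
  have diff: "(J has_derivative frechet_derivative J (at p)) (at p)" for p
  proof -
    have "J differentiable (at p)" using assms by (cases p) simp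
    then show ?thesis unfolding frechet_derivative_works .
  qed
  have cont: "continuous_on UNIV (\<lambda>p. frechet_derivative J (at p) v)" for v
    using assms by (cases v) simp
  define B where "B = {-R..R} \<times> {-R..R}"
  have B: "compact B" unfolding B_def by (intro compact_Times) auto
  have ex: "\<exists>M>0. \<forall>p\<in>B. \<bar>frechet_derivative J (at p) v\<bar> \<le> M" for v
  proof -
    have "bounded ((\<lambda>p. frechet_derivative J (at p) v) ` B)"
      using B cont continuous_on_subset by (intro compact_imp_bounded compact_continuous_image) blast+
    then show ?thesis unfolding bounded_pos by (auto simp: real_norm_def)
  qed
  obtain M1 where M1: "M1 > 0" "\<And>p. p \<in> B \<Longrightarrow> \<bar>frechet_derivative J (at p) (1, 0)\<bar> \<le> M1" using ex by blast
  obtain M2 where M2: "M2 > 0" "\<And>p. p \<in> B \<Longrightarrow> \<bar>frechet_derivative J (at p) (0, 1)\<bar> \<le> M2" using ex by blast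
  define K where "K = max M1 M2"
  have scale: "frechet_derivative J (at p) (c *\<^sub>R v) = frechet_derivative J (at p) v * c" for p c v
    using linear_scale[OF has_derivative_linear[OF diff[of p]], of c v] by (simp add: mult.commute)
  have d1: "((\<lambda>t. J (t, y)) has_field_derivative frechet_derivative J (at (t, y)) (1, 0)) (at t within S)" for t y S
  proof -
    have g: "((\<lambda>t. (t, y)) has_derivative (\<lambda>s. (s, 0))) (at t within S)" by (auto intro!: derivative_eq_intros)
    have "((\<lambda>t. J (t, y)) has_derivative (\<lambda>s. frechet_derivative J (at (t, y)) (s, 0))) (at t within S)"
      using has_derivative_compose[OF g diff] by simp
    moreover have "(\<lambda>s. frechet_derivative J (at (t, y)) (s, 0)) = (*) (frechet_derivative J (at (t, y)) (1, 0))"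
    proof
      fix s :: real
      have "s *\<^sub>R (1, 0) = (s, 0::real)" by simp
      then show "frechet_derivative J (at (t, y)) (s, 0) = frechet_derivative J (at (t, y)) (1, 0) * s"
        using scale[of "(t, y)" s "(1, 0)"] by (simp only:)
    qed
    ultimately show ?thesis unfolding has_field_derivative_def by (simp only:)
  qed
  have d2: "((\<lambda>t. J (x, t)) has_field_derivative frechet_derivative J (at (x, t)) (0, 1)) (at t within S)" for t x S
  proof -
    have g: "((\<lambda>t. (x, t)) has_derivative (\<lambda>s. (0, s))) (at t within S)" by (auto intro!: derivative_eq_intros)
    have "((\<lambda>t. J (x, t)) has_derivative (\<lambda>s. frechet_derivative J (at (x, t)) (0, s))) (at t within S)"
      using has_derivative_compose[OF g diff] by simp
    moreover have "(\<lambda>s. frechet_derivative J (at (x, t)) (0, s)) = (*) (frechet_derivative J (at (x, t)) (0, 1))"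
    proof
      fix s :: real
      have "s *\<^sub>R (0, 1) = (0::real, s)" by simp
      then show "frechet_derivative J (at (x, t)) (0, s) = frechet_derivative J (at (x, t)) (0, 1) * s"
        using scale[of "(x, t)" s "(0, 1)"] by (simp only:)
    qed
    ultimately show ?thesis unfolding has_field_derivative_def by (simp only:)
  qed
  have "\<bar>J (x, y) - J (x', y)\<bar> \<le> K * \<bar>x - x'\<bar>" if "\<bar>x\<bar> \<le> R" "\<bar>x'\<bar> \<le> R" "\<bar>y\<bar> \<le> R" for x x' y
  proof -
    have "norm (J (x, y) - J (x', y)) \<le> K * norm (x - x')"
    proof (rule field_differentiable_bound[of "{-R..R}", OF _ d1])
      show "norm (frechet_derivative J (at (z, y)) (1, 0)) \<le> K" if "z \<in> {-R..R}" for z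
      proof -
        have "(z, y) \<in> B" using that \<open>\<bar>y\<bar> \<le> R\<close> unfolding B_def by (auto simp: abs_le_iff)
        from M1(2)[OF this] show ?thesis unfolding K_def real_norm_def by (rule max.coboundedI1)
      qed
    qed (use that in auto)
    then show ?thesis by simp
  qed
  moreover have "\<bar>J (x, y) - J (x, y')\<bar> \<le> K * \<bar>y - y'\<bar>" if "\<bar>x\<bar> \<le> R" "\<bar>y\<bar> \<le> R" "\<bar>y'\<bar> \<le> R" for x y y'
  proof -
    have "norm (J (x, y) - J (x, y')) \<le> K * norm (y - y')"
    proof (rule field_differentiable_bound[of "{-R..R}", OF _ d2])
      show "norm (frechet_derivative J (at (x, z)) (0, 1)) \<le> K" if "z \<in> {-R..R}" for z
      proof -
        have "(x, z) \<in> B" using that \<open>\<bar>x\<bar> \<le> R\<close> unfolding B_def by (auto simp: abs_le_iff)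
        from M2(2)[OF this] show ?thesis unfolding K_def real_norm_def by (rule max.coboundedI2)
      qed
    qed (use that in auto)
    then show ?thesis by simp
  qed
  moreover have "K > 0" unfolding K_def using M1 by simp
  ultimately show thesis using that by blast
qed

section \<open>The BDF2 scheme\<close>

text \<open>The linear part of the chemical potential. With
  \<open>w = \<epsilon>\<^sup>2 * h\<^sup>2\<close>, the diagonal entry \<open>\<gamma>\<close>
  collects the convolution of \<open>1\<close> and the \<open>- r\<close> of the derivative of the
  potential.\<close>

definition grid_matrix :: "real \<Rightarrow> real \<Rightarrow> real \<Rightarrow> (real \<times> real \<Rightarrow> real) \<Rightarrow> int \<times> int \<Rightarrow> int \<times> int \<Rightarrow> real" where
  "grid_matrix \<gamma> w h J p q = (if p = q then \<gamma> else 0)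
     - w * J (of_int (fst p - fst q) * h, of_int (snd p - snd q) * h)"

definition wrap :: "nat \<Rightarrow> int \<Rightarrow> int" where
  "wrap N i = (i - 1) mod int N + 1"

lemma wrap_in:
  assumes "N \<ge> 1"
  shows "wrap N i \<in> {1..int N}"
proof -
  have "0 < int N" using assms by simp
  from pos_mod_bound[OF this, of "i - 1"] pos_mod_sign[OF this, of "i - 1"]
  show ?thesis unfolding wrap_def by simp
qed

lemma wrap_id: "i \<in> {1..int N} \<Longrightarrow> wrap N i = i"
  unfolding wrap_def by (simp add: mod_pos_pos_trivial)

lemma wrap_periodic: "wrap N (i + int N) = wrap N i"
proof -
  have "i + int N - 1 = (i - 1) + int N" by simp
  then show ?thesis unfolding wrap_def by (metis mod_add_self2)
qed

lemma C_per_wrap: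
  assumes "\<phi> \<in> C_per N"
  shows "\<phi> i j = \<phi> (wrap N i) (wrap N j)"
proof -
  have m: "wrap N i mod int N = i mod int N" for i unfolding wrap_def by (simp add: mod_add_left_eq)
  have "\<phi> i j = \<phi> (wrap N i) j"
    by (rule periodic_cong_mod[of "\<lambda>i. \<phi> i j" "int N"]) (simp_all add: C_perD[OF assms] m)
  also have "\<dots> = \<phi> (wrap N i) (wrap N j)"
    by (rule periodic_cong_mod[of "\<phi> (wrap N i)" "int N"]) (simp_all add: C_perD[OF assms] m)
  finally show ?thesis .
qed

text \<open>The role of the constant in the time step condition is played by
  \<open>(2 * K * L\<^sup>2)\<^sup>2\<close>, where \<open>K\<close> is a Lipschitz constant of the
  kernel on a square large enough for all offsets between cells and their neighbours.\<close>

locale bdf2_trajectory =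
  fixes L :: real and J :: "real \<times> real \<Rightarrow> real" and N :: nat and h \<epsilon> \<tau> K :: real
    and u \<omega> :: "nat \<Rightarrow> grid"
  assumes L: "L > 0" and N: "N \<ge> 1" and h: "h = mesh L N"
    and J_per: "Omega_periodic L J" and J_even: "\<And>p. J (- p) = J p"
    and gamma: "gamma_disc h N \<epsilon> J > 0" and tau: "\<tau> > 0" and K: "K > 0"
    and lip1: "\<And>x x' y. \<bar>x\<bar> \<le> 2 * L \<Longrightarrow> \<bar>x'\<bar> \<le> 2 * L \<Longrightarrow> \<bar>y\<bar> \<le> 2 * L \<Longrightarrow> \<bar>J (x, y) - J (x', y)\<bar> \<le> K * \<bar>x - x'\<bar>"
    and lip2: "\<And>x y y'. \<bar>x\<bar> \<le> 2 * L \<Longrightarrow> \<bar>y\<bar> \<le> 2 * L \<Longrightarrow> \<bar>y'\<bar> \<le> 2 * L \<Longrightarrow> \<bar>J (x, y) - J (x, y')\<bar> \<le> K * \<bar>y - y'\<bar>"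
    and tau_small: "\<tau> < 2 * gamma_disc h N \<epsilon> J / ((2 * K * L\<^sup>2)\<^sup>2 * \<epsilon> ^ 4)"
    and u_per: "\<And>n. u n \<in> C_per N" and w_per: "\<And>n. \<omega> n \<in> C_per N"
    and mass01: "gsum N (u 1) = gsum N (u 0)"
    and scheme: "BDF2_scheme h N \<epsilon> J \<tau> u \<omega>"
begin

abbreviation "\<gamma> \<equiv> gamma_disc h N \<epsilon> J"

sublocale sys: cubic_system "{1..int N} \<times> {1..int N}" "grid_matrix \<gamma> (\<epsilon>\<^sup>2 * h\<^sup>2) h J" "(1, 1)"
proof
  fix p q :: "int \<times> int"
  have "(of_int (fst q - fst p) * h, of_int (snd q - snd p) * h)
      = - (of_int (fst p - fst q) * h, of_int (snd p - snd q) * h)" by (simp add: algebra_simps)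
  then have "J (of_int (fst q - fst p) * h, of_int (snd q - snd p) * h)
      = J (of_int (fst p - fst q) * h, of_int (snd p - snd q) * h)" by (simp only: J_even)
  then show "grid_matrix \<gamma> (\<epsilon>\<^sup>2 * h\<^sup>2) h J p q = grid_matrix \<gamma> (\<epsilon>\<^sup>2 * h\<^sup>2) h J q p"
    unfolding grid_matrix_def by simp
qed (use N in auto)

abbreviation "I \<equiv> {1..int N} \<times> {1..int N}"

lemma h_pos: "h > 0" and Nh: "of_int (int N) * h = L"
  using L N unfolding h mesh_def by auto

text \<open>Periodic reflection moves the dependence on \<open>i\<close> and \<open>j\<close> into
  the kernel, so that differences of the convolution fall on \<open>J\<close>.\<close>

lemma disc_conv_eq:
  assumes "\<phi> \<in> C_per N"
  shows "disc_conv h N J \<phi> i j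
    = h\<^sup>2 * gsum N (\<lambda>k l. J (of_int (i - k) * h, of_int (j - l) * h) * \<phi> k l)"
proof -
  define G :: grid where "G = (\<lambda>k l. J (of_int (i - k) * h, of_int (j - l) * h) * \<phi> k l)"
  have sh: "of_int (m - (k + int N)) * h + L = of_int (m - k) * h" for m k
    using Nh by (simp add: algebra_simps)
  have "G \<in> C_per N"
  proof (rule C_perI)
    fix k l
    have "J (of_int (i - (k + int N)) * h, y) = J (of_int (i - k) * h, y)" for y
      using J_per sh[of i k] unfolding Omega_periodic_def by metis
    then show "G (k + int N) l = G k l" unfolding G_def by (simp add: C_perD[OF assms])
    have "J (x, of_int (j - (l + int N)) * h) = J (x, of_int (j - l) * h)" for x
      using J_per sh[of j l] unfolding Omega_periodic_def by metis
    then show "G k (l + int N) = G k l" unfolding G_def by (simp add: C_perD[OF assms])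
  qed
  from gsum_reflect[OF this, of i j] show ?thesis
    unfolding disc_conv_def G_def gsum_def by simp
qed

lemma grid_matrix_apply:
  assumes "\<phi> \<in> C_per N" "p \<in> I" and x: "\<And>q. q \<in> I \<Longrightarrow> x q = \<phi> (fst q) (snd q)"
  shows "(\<Sum>q\<in>I. grid_matrix \<gamma> (\<epsilon>\<^sup>2 * h\<^sup>2) h J p q * x q)
    = \<gamma> * x p - \<epsilon>\<^sup>2 * disc_conv h N J \<phi> (fst p) (snd p)"
proof -
  have "(\<Sum>q\<in>I. grid_matrix \<gamma> (\<epsilon>\<^sup>2 * h\<^sup>2) h J p q * x q)
      = (\<Sum>q\<in>I. (if p = q then \<gamma> * x q else 0)
          - \<epsilon>\<^sup>2 * h\<^sup>2 * (J (of_int (fst p - fst q) * h, of_int (snd p - snd q) * h) * \<phi> (fst q) (snd q)))"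
    by (intro sum.cong refl) (simp add: grid_matrix_def x left_diff_distrib)
  also have "\<dots> = \<gamma> * x p - \<epsilon>\<^sup>2 * disc_conv h N J \<phi> (fst p) (snd p)"
    unfolding disc_conv_eq[OF assms(1)] gsum_cartesian
    using assms(2) by (simp add: sum_subtractf sum_distrib_left mult.assoc)
  finally show ?thesis .
qed

lemma chem_potential_eq:
  assumes "\<phi> \<in> C_per N" "p \<in> I" and x: "\<And>q. q \<in> I \<Longrightarrow> x q = \<phi> (fst q) (snd q)"
  shows "chem_potential h N \<epsilon> J \<phi> (fst p) (snd p) = sys.gradient x p"
proof -
  have "chem_potential h N \<epsilon> J \<phi> (fst p) (snd p)
      = x p ^ 3 + (\<gamma> * x p - \<epsilon>\<^sup>2 * disc_conv h N J \<phi> (fst p) (snd p))"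
    unfolding chem_potential_def deriv_potential gamma_disc_def x[OF assms(2)] by (simp add: algebra_simps)
  moreover have "(\<Sum>q\<in>I. grid_matrix \<gamma> (\<epsilon>\<^sup>2 * h\<^sup>2) h J p q * x q)
      = \<gamma> * x p - \<epsilon>\<^sup>2 * disc_conv h N J \<phi> (fst p) (snd p)"
    by (rule grid_matrix_apply[OF assms(1,2) x])
  ultimately show ?thesis unfolding sys.gradient_def by (simp only:)
qed

lemma chem_potential_per:
  assumes "\<phi> \<in> C_per N"
  shows "chem_potential h N \<epsilon> J \<phi> \<in> C_per N"
proof -
  have "\<phi> (i + int N - k) j = \<phi> (i - k) j" "\<phi> i (j + int N - k) = \<phi> i (j - k)" for i j k
    using C_perD(1)[OF assms, of "i - k" j] C_perD(2)[OF assms, of i "j - k"] by (simp_all add: algebra_simps)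
  then show ?thesis
    by (intro C_perI) (simp_all add: chem_potential_def disc_conv_def C_perD[OF assms])
qed

text \<open>The shift by one makes the step from \<open>state n\<close> to
  \<open>state (Suc n)\<close> equal to \<open>incr (Suc n)\<close>, and the first chemical
  potential given by the scheme is the gradient at \<open>state 1\<close>.\<close>

definition state :: "nat \<Rightarrow> int \<times> int \<Rightarrow> real" where
  "state n p = (if p \<in> I then u (Suc n) (fst p) (snd p) else 0)"

definition incr :: "nat \<Rightarrow> grid" where
  "incr n = (\<lambda>i j. u (Suc n) i j - u n i j)"

lemma omega_eq: "p \<in> I \<Longrightarrow> \<omega> (Suc (Suc n)) (fst p) (snd p) = sys.gradient (state (Suc n)) p"
  using scheme chem_potential_eq[OF u_per, of p "state (Suc n)" "Suc (Suc n)"]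
  unfolding BDF2_scheme_def by (auto simp: state_def)

lemma incr_per: "incr n \<in> C_per N"
  unfolding incr_def by (rule C_per_compose[OF u_per u_per])

text \<open>The BDF2 stencil is three times the newest increment minus the previous one.\<close>

lemma scheme_incr:
  "(3 * incr (Suc n) i j - incr n i j) / (2 * \<tau>) = disc_laplacian h (\<omega> (Suc (Suc n))) i j"
proof -
  have "(3 * u (Suc n + 1) i j - 4 * u (Suc n) i j + u (Suc n - 1) i j) / (2 * \<tau>)
      = disc_laplacian h (\<omega> (Suc n + 1)) i j"
    using scheme[unfolded BDF2_scheme_def, THEN spec, of "Suc n"] le_add1[of 1 n, folded Suc_eq_plus1_left] by blast
  then show ?thesis unfolding incr_def by (simp add: algebra_simps)
qed

text \<open>Equality of the first two masses provides a flux for \<open>incr 0\<close>. Later fluxes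
  are defined by solving \<open>3 q (Suc n) - q n = - 2 \<tau> \<nabla> \<omega>\<close>; the
  divergence of this recursion is the scheme, so the flux representation propagates.\<close>

lemma flux_sequence:
  obtains q r :: "nat \<Rightarrow> grid" where
    "\<And>n. q n \<in> C_per N" "\<And>n. r n \<in> C_per N"
    "\<And>n i j. incr n i j = - ((q n i j - q n (i - 1) j) + (r n i j - r n i (j - 1))) / h"
    "\<And>n i j. (\<omega> (Suc (Suc n)) (i + 1) j - \<omega> (Suc (Suc n)) i j) / h = - (3 * q (Suc n) i j - q n i j) / (2 * \<tau>)"
    "\<And>n i j. (\<omega> (Suc (Suc n)) i (j + 1) - \<omega> (Suc (Suc n)) i j) / h = - (3 * r (Suc n) i j - r n i j) / (2 * \<tau>)"
proof -
  have "gsum N (incr 0) = 0" using mass01 unfolding incr_def by (simp add: gsum_diff)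
  then obtain q0 r0 where q0: "q0 \<in> C_per N" "r0 \<in> C_per N"
    "\<And>i j. incr 0 i j = - ((q0 i j - q0 (i - 1) j) + (r0 i j - r0 i (j - 1))) / h"
    using exists_flux[OF N _ incr_per] h_pos by (metis less_irrefl)
  define q where "q = rec_nat q0 (\<lambda>n f i j. f i j / 3
      - 2 * \<tau> / 3 * ((\<omega> (Suc (Suc n)) (i + 1) j - \<omega> (Suc (Suc n)) i j) / h))"
  define r where "r = rec_nat r0 (\<lambda>n f i j. f i j / 3
      - 2 * \<tau> / 3 * ((\<omega> (Suc (Suc n)) i (j + 1) - \<omega> (Suc (Suc n)) i j) / h))"
  have qS: "q 0 = q0" "\<And>n i j. q (Suc n) i j = q n i j / 3
      - 2 * \<tau> / 3 * ((\<omega> (Suc (Suc n)) (i + 1) j - \<omega> (Suc (Suc n)) i j) / h)"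
    unfolding q_def by simp_all
  have rS: "r 0 = r0" "\<And>n i j. r (Suc n) i j = r n i j / 3
      - 2 * \<tau> / 3 * ((\<omega> (Suc (Suc n)) i (j + 1) - \<omega> (Suc (Suc n)) i j) / h)"
    unfolding r_def by simp_all
  have per: "\<omega> n (i + int N + 1) j = \<omega> n (i + 1) j" "\<omega> n i (j + int N + 1) = \<omega> n i (j + 1)" for n i j
    using C_perD(1)[OF w_per, of n "i + 1" j] C_perD(2)[OF w_per, of n i "j + 1"] by (simp_all add: algebra_simps)
  have qper: "q n \<in> C_per N" for n
  proof (induction n)
    case (Suc n)
    show ?case by (rule C_perI) (simp_all add: qS C_perD[OF Suc] C_perD[OF w_per] per)
  qed (simp add: qS q0)
  have rper: "r n \<in> C_per N" for n
  proof (induction n)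
    case (Suc n)
    show ?case by (rule C_perI) (simp_all add: rS C_perD[OF Suc] C_perD[OF w_per] per)
  qed (simp add: rS q0)
  have flux: "incr n i j = - ((q n i j - q n (i - 1) j) + (r n i j - r n i (j - 1))) / h" for n i j
  proof (induction n arbitrary: i j)
    case (Suc n)
    define w where "w = \<omega> (Suc (Suc n))"
    have "3 * incr (Suc n) i j = incr n i j + 2 * \<tau> * disc_laplacian h w i j"
      using scheme_incr[of n i j] tau unfolding w_def by (simp add: field_simps)
    also have "disc_laplacian h w i j = (((w (i + 1) j - w i j) / h - (w i j - w (i - 1) j) / h)
        + ((w i (j + 1) - w i j) / h - (w i j - w i (j - 1)) / h)) / h"
      unfolding disc_laplacian_def using h_pos by (simp add: field_simps power2_eq_square)
    finally have "3 * incr (Suc n) i j = - ((q n i j - q n (i - 1) j) + (r n i j - r n i (j - 1))) / h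
        + 2 * \<tau> * ((((w (i + 1) j - w i j) / h - (w i j - w (i - 1) j) / h)
        + ((w i (j + 1) - w i j) / h - (w i j - w i (j - 1)) / h)) / h)" unfolding Suc .
    moreover have "X = - ((q / 3 - 2 * \<tau> / 3 * a - (q' / 3 - 2 * \<tau> / 3 * a'))
        + (r / 3 - 2 * \<tau> / 3 * c - (r' / 3 - 2 * \<tau> / 3 * c'))) / h"
      if "3 * X = - ((q - q') + (r - r')) / h + 2 * \<tau> * (((a - a') + (c - c')) / h)"
      for X q q' r r' a a' c c' :: real
    proof (rule eq_divide_imp)
      have "3 * X * h = - ((q - q') + (r - r')) / h * h + 2 * \<tau> * (((a - a') + (c - c')) / h * h)"
        unfolding that by (simp only: distrib_right mult.assoc)
      also have "\<dots> = - ((q - q') + (r - r')) + 2 * \<tau> * ((a - a') + (c - c'))" using h_pos by simp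
      finally show "X * h = - ((q / 3 - 2 * \<tau> / 3 * a - (q' / 3 - 2 * \<tau> / 3 * a'))
        + (r / 3 - 2 * \<tau> / 3 * c - (r' / 3 - 2 * \<tau> / 3 * c')))" by (simp add: field_simps)
    qed (use h_pos in simp)
    ultimately show ?case unfolding qS rS w_def[symmetric] diff_add_cancel by blast
  qed (simp add: qS rS q0)
  show thesis
    by (rule that[of q r, OF qper rper flux]) (use tau in \<open>simp_all add: qS rS\<close>)
qed

lemma gsum_flux_by_parts:
  assumes per: "\<phi> \<in> C_per N" "q \<in> C_per N" "r \<in> C_per N"
    and f: "\<And>i j. f i j = - ((q i j - q (i - 1) j) + (r i j - r i (j - 1))) / h"
  shows "gsum N (\<lambda>i j. \<phi> i j * f i j)
    = gsum N (\<lambda>i j. (\<phi> (i + 1) j - \<phi> i j) / h * q i j + (\<phi> i (j + 1) - \<phi> i j) / h * r i j)"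
proof -
  have "gsum N (\<lambda>i j. \<phi> i j * f i j)
      = gsum N (\<lambda>i j. (-1 / h) * (\<phi> i j * (q i j - q (i - 1) j) + \<phi> i j * (r i j - r i (j - 1))))"
    by (rule gsum_cong) (use h_pos in \<open>simp add: f field_simps\<close>)
  also have "\<dots> = (1 / h) * (gsum N (\<lambda>i j. (\<phi> (i + 1) j - \<phi> i j) * q i j)
      + gsum N (\<lambda>i j. (\<phi> i (j + 1) - \<phi> i j) * r i j))"
    unfolding gsum_cmult gsum_add gsum_by_parts[OF per(1,2)] gsum_by_parts[OF per(1,3)]
    by (simp add: algebra_simps)
  also have "\<dots> = gsum N (\<lambda>i j. (1 / h) * ((\<phi> (i + 1) j - \<phi> i j) * q i j + (\<phi> i (j + 1) - \<phi> i j) * r i j))"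
    unfolding gsum_cmult gsum_add ..
  finally show ?thesis by (simp add: distrib_left)
qed

lemma abs_mult_h_le:
  assumes "\<bar>m\<bar> \<le> 2 * int N"
  shows "\<bar>of_int m * h\<bar> \<le> 2 * L"
proof -
  have "\<bar>of_int m * h\<bar> = of_int \<bar>m\<bar> * h" using h_pos by (simp add: abs_mult)
  also have "\<dots> \<le> of_int (2 * int N) * h" using assms h_pos by (intro mult_right_mono) (simp_all only: of_int_le_iff less_imp_le)
  finally show ?thesis using Nh by simp
qed

text \<open>Each kernel difference between neighbouring cells is at most \<open>K * h\<close>, which
  cancels the division by \<open>h\<close> and leaves the quadrature weight
  \<open>h\<^sup>2\<close>.\<close>

lemma disc_conv_diff_le:
  assumes d: "d \<in> C_per N" and ij: "i \<in> {1..int N}" "j \<in> {1..int N}"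
  shows "\<bar>(disc_conv h N J d (i + 1) j - disc_conv h N J d i j) / h\<bar> \<le> K * h\<^sup>2 * gsum N (\<lambda>i j. \<bar>d i j\<bar>)"
    and "\<bar>(disc_conv h N J d i (j + 1) - disc_conv h N J d i j) / h\<bar> \<le> K * h\<^sup>2 * gsum N (\<lambda>i j. \<bar>d i j\<bar>)"
proof -
  have *: "\<bar>(h\<^sup>2 * gsum N (\<lambda>k l. F k l * d k l) - h\<^sup>2 * gsum N (\<lambda>k l. G k l * d k l)) / h\<bar>
      \<le> K * h\<^sup>2 * gsum N (\<lambda>i j. \<bar>d i j\<bar>)"
    if FG: "\<And>k l. k \<in> {1..int N} \<Longrightarrow> l \<in> {1..int N} \<Longrightarrow> \<bar>F k l - G k l\<bar> \<le> K * h" for F G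
  proof -
    have "(h\<^sup>2 * gsum N (\<lambda>k l. F k l * d k l) - h\<^sup>2 * gsum N (\<lambda>k l. G k l * d k l)) / h
        = h * gsum N (\<lambda>k l. (F k l - G k l) * d k l)"
      using h_pos by (simp add: gsum_diff left_diff_distrib power2_eq_square field_simps)
    also have "\<bar>\<dots>\<bar> \<le> h * gsum N (\<lambda>k l. \<bar>(F k l - G k l) * d k l\<bar>)"
      using mult_left_mono[OF abs_gsum[of N "\<lambda>k l. (F k l - G k l) * d k l"], of h] h_pos
      by (simp add: abs_mult[of h])
    also have "\<dots> \<le> h * gsum N (\<lambda>k l. K * h * \<bar>d k l\<bar>)"
      using h_pos FG by (intro mult_left_mono gsum_mono) (auto simp: abs_mult intro!: mult_right_mono)
    also have "\<dots> = K * h\<^sup>2 * gsum N (\<lambda>i j. \<bar>d i j\<bar>)" unfolding gsum_cmult by (simp add: power2_eq_square)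
    finally show ?thesis .
  qed
  have dist_h: "\<bar>of_int (m + 1 - k) * h - of_int (m - k) * h\<bar> = h" for m k
    using h_pos by (simp add: algebra_simps)
  have in2L: "\<bar>of_int (m - k) * h\<bar> \<le> 2 * L" "\<bar>of_int (m + 1 - k) * h\<bar> \<le> 2 * L"
    if "m \<in> {1..int N}" "k \<in> {1..int N}" for m k
  proof -
    have "\<bar>m - k\<bar> \<le> 2 * int N" "\<bar>m + 1 - k\<bar> \<le> 2 * int N" using that by auto
    then show "\<bar>of_int (m - k) * h\<bar> \<le> 2 * L" "\<bar>of_int (m + 1 - k) * h\<bar> \<le> 2 * L"
      by (blast intro: abs_mult_h_le)+
  qed
  show "\<bar>(disc_conv h N J d (i + 1) j - disc_conv h N J d i j) / h\<bar> \<le> K * h\<^sup>2 * gsum N (\<lambda>i j. \<bar>d i j\<bar>)"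
    unfolding disc_conv_eq[OF d]
  proof (rule *)
    fix k l assume kl: "k \<in> {1..int N}" "l \<in> {1..int N}"
    show "\<bar>J (of_int (i + 1 - k) * h, of_int (j - l) * h) - J (of_int (i - k) * h, of_int (j - l) * h)\<bar> \<le> K * h"
      using lip1[OF in2L(2)[OF ij(1) kl(1)] in2L(1)[OF ij(1) kl(1)] in2L(1)[OF ij(2) kl(2)]]
      unfolding dist_h .
  qed
  show "\<bar>(disc_conv h N J d i (j + 1) - disc_conv h N J d i j) / h\<bar> \<le> K * h\<^sup>2 * gsum N (\<lambda>i j. \<bar>d i j\<bar>)"
    unfolding disc_conv_eq[OF d]
  proof (rule *)
    fix k l assume kl: "k \<in> {1..int N}" "l \<in> {1..int N}"
    show "\<bar>J (of_int (i - k) * h, of_int (j + 1 - l) * h) - J (of_int (i - k) * h, of_int (j - l) * h)\<bar> \<le> K * h"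
      using lip2[OF in2L(1)[OF ij(1) kl(1)] in2L(2)[OF ij(2) kl(2)] in2L(1)[OF ij(2) kl(2)]]
      unfolding dist_h .
  qed
qed

lemma disc_conv_per:
  assumes "\<phi> \<in> C_per N"
  shows "disc_conv h N J \<phi> \<in> C_per N"
proof -
  have "\<phi> (i + int N - k) j = \<phi> (i - k) j" "\<phi> i (j + int N - k) = \<phi> i (j - k)" for i j k
    using C_perD(1)[OF assms, of "i - k" j] C_perD(2)[OF assms, of i "j - k"] by (simp_all add: algebra_simps)
  then show ?thesis by (intro C_perI) (simp_all add: disc_conv_def)
qed

text \<open>Summation by parts moves the divergence in \<open>d\<close> onto the smooth convolution,
  so one factor of \<open>d\<close> is replaced by the flux. This provides the term that a small
  time step can absorb.\<close>

lemma disc_conv_form_le: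
  assumes per: "d \<in> C_per N" "q \<in> C_per N" "r \<in> C_per N"
    and d: "\<And>i j. d i j = - ((q i j - q (i - 1) j) + (r i j - r i (j - 1))) / h"
  shows "gsum N (\<lambda>i j. disc_conv h N J d i j * d i j)
    \<le> 2 * K * L\<^sup>2 * sqrt (gsum N (\<lambda>i j. (d i j)\<^sup>2)) * sqrt (gsum N (\<lambda>i j. (q i j)\<^sup>2 + (r i j)\<^sup>2))"
proof -
  define M where "M = K * h\<^sup>2 * gsum N (\<lambda>i j. \<bar>d i j\<bar>)"
  define e where "e = sqrt (gsum N (\<lambda>i j. (d i j)\<^sup>2))"
  define b where "b = sqrt (gsum N (\<lambda>i j. (q i j)\<^sup>2 + (r i j)\<^sup>2))"
  have M: "M \<ge> 0" unfolding M_def using K by (simp add: gsum_nonneg)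
  have e: "e \<ge> 0" unfolding e_def by (simp add: gsum_nonneg)
  have qb: "gsum N (\<lambda>i j. \<bar>q i j\<bar>) \<le> real N * b" "gsum N (\<lambda>i j. \<bar>r i j\<bar>) \<le> real N * b"
    unfolding b_def
    by (rule order_trans[OF gsum_abs_le_sqrt mult_left_mono[OF real_sqrt_le_mono[OF gsum_mono]]], simp_all)+
  have "gsum N (\<lambda>i j. disc_conv h N J d i j * d i j)
      = gsum N (\<lambda>i j. (disc_conv h N J d (i + 1) j - disc_conv h N J d i j) / h * q i j
          + (disc_conv h N J d i (j + 1) - disc_conv h N J d i j) / h * r i j)"
    by (rule gsum_flux_by_parts[where f = d, OF disc_conv_per[OF per(1)] per(2,3) d])
  also have "\<dots> \<le> gsum N (\<lambda>i j. M * \<bar>q i j\<bar> + M * \<bar>r i j\<bar>)"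
  proof (intro gsum_mono add_mono)
    fix i j assume ij: "i \<in> {1..int N}" "j \<in> {1..int N}"
    have le: "s * t \<le> M * \<bar>t\<bar>" if "\<bar>s\<bar> \<le> M" for s t :: real
      using mult_right_mono[OF that, of "\<bar>t\<bar>"] abs_ge_self[of "s * t"] by (simp add: abs_mult)
    show "(disc_conv h N J d (i + 1) j - disc_conv h N J d i j) / h * q i j \<le> M * \<bar>q i j\<bar>"
      unfolding M_def by (rule le[unfolded M_def], rule disc_conv_diff_le[OF per(1) ij])
    show "(disc_conv h N J d i (j + 1) - disc_conv h N J d i j) / h * r i j \<le> M * \<bar>r i j\<bar>"
      unfolding M_def by (rule le[unfolded M_def], rule disc_conv_diff_le[OF per(1) ij])
  qed
  also have "\<dots> = M * (gsum N (\<lambda>i j. \<bar>q i j\<bar>) + gsum N (\<lambda>i j. \<bar>r i j\<bar>))"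
    unfolding gsum_add gsum_cmult by (simp add: distrib_left)
  also have "\<dots> \<le> M * (2 * (real N * b))" using qb M by (intro mult_left_mono) auto
  also have "\<dots> \<le> (K * h\<^sup>2 * (real N * e)) * (2 * (real N * b))"
    unfolding M_def e_def using K gsum_abs_le_sqrt[of N d] by (intro mult_right_mono mult_left_mono) (auto simp: b_def gsum_nonneg)
  \<comment> \<open>The powers of \<open>N\<close> and \<open>h\<close> combine to
    \<open>(real N * h)\<^sup>2 = L\<^sup>2\<close>, which makes the constant independent of the
    mesh.\<close>
  also have "\<dots> = 2 * K * (real N * h)\<^sup>2 * e * b" by (simp add: power2_eq_square)
  also have "real N * h = L" using Nh by simp
  finally show ?thesis unfolding e_def b_def .
qed

section \<open>Dissipation and convergence of the scheme\<close>

theorem converges_to_steady_state: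
  "\<exists>us\<in>C_per N. \<exists>\<omega>s\<in>C_per N. steady_state h N \<epsilon> J (u 0) us \<omega>s \<and>
    grid_converges N u us \<and> grid_converges N \<omega> \<omega>s"
proof -
  obtain q r :: "nat \<Rightarrow> grid" where qr: "\<And>n. q n \<in> C_per N" "\<And>n. r n \<in> C_per N"
    and flux: "\<And>n i j. incr n i j = - ((q n i j - q n (i - 1) j) + (r n i j - r n i (j - 1))) / h"
    and wq: "\<And>n i j. (\<omega> (Suc (Suc n)) (i + 1) j - \<omega> (Suc (Suc n)) i j) / h = - (3 * q (Suc n) i j - q n i j) / (2 * \<tau>)"
    and wr: "\<And>n i j. (\<omega> (Suc (Suc n)) i (j + 1) - \<omega> (Suc (Suc n)) i j) / h = - (3 * r (Suc n) i j - r n i j) / (2 * \<tau>)"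
    using flux_sequence by blast
  define b where "b n = sqrt (gsum N (\<lambda>i j. (q n i j)\<^sup>2 + (r n i j)\<^sup>2))" for n
  have b: "b n \<ge> 0" for n unfolding b_def by (simp add: gsum_nonneg)
  have b2: "(b n)\<^sup>2 = gsum N (\<lambda>i j. (q n i j)\<^sup>2 + (r n i j)\<^sup>2)" for n
    unfolding b_def by (simp add: gsum_nonneg)
  have qb: "gsum N (\<lambda>i j. \<bar>q n i j\<bar>) \<le> real N * b n" "gsum N (\<lambda>i j. \<bar>r n i j\<bar>) \<le> real N * b n" for n
    unfolding b_def
    by (rule order_trans[OF gsum_abs_le_sqrt mult_left_mono[OF real_sqrt_le_mono[OF gsum_mono]]], simp_all)+
  have diff: "state (Suc n) p - state n p = incr (Suc n) (fst p) (snd p)" if "p \<in> I" for n p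
    using that unfolding state_def incr_def by simp
  \<comment> \<open>The first entry serves the speed bound, the second the gradient bound.\<close>
  define C where "C = max (4 * real N / h) (real N ^ 4 * (3 * h * real N / \<tau>))"
  \<comment> \<open>In units of \<open>1 / (4 * \<tau>)\<close>, the flux relation contributes
    \<open>-5\<close> for the new flux and \<open>+1\<close> for the old one, and half of the
    nonlocal term contributes \<open>+1\<close> for the new one. Adding the correction with weight
    \<open>1\<close> leaves \<open>3\<close>.\<close>
  have dec: "3 / (4 * \<tau>) * (b (Suc n))\<^sup>2 \<le> (sys.energy (state n) + 1 / (4 * \<tau>) * (b n)\<^sup>2)
      - (sys.energy (state (Suc n)) + 1 / (4 * \<tau>) * (b (Suc n))\<^sup>2)" for n
  proof -
    define d where "d = incr (Suc n)"
    define e where "e = sqrt (gsum N (\<lambda>i j. (d i j)\<^sup>2))"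
    define M where "M = 2 * K * L\<^sup>2"
    define Q where "Q = gsum N (\<lambda>i j. disc_conv h N J d i j * d i j)"
    define W where "W = gsum N (\<lambda>i j. \<omega> (Suc (Suc n)) i j * d i j)"
    have e2: "e\<^sup>2 = gsum N (\<lambda>i j. (d i j)\<^sup>2)" unfolding e_def by (simp add: gsum_nonneg)
    have dper: "d \<in> C_per N" unfolding d_def by (rule incr_per)
    have "sys.energy (state (Suc n)) - sys.energy (state n)
        \<le> (\<Sum>p\<in>I. sys.gradient (state (Suc n)) p * (state (Suc n) p - state n p))
          - (\<Sum>p\<in>I. \<Sum>p'\<in>I. grid_matrix \<gamma> (\<epsilon>\<^sup>2 * h\<^sup>2) h J p p' * (state (Suc n) p - state n p)
              * (state (Suc n) p' - state n p')) / 2"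
      by (rule sys.energy_increment)
    also have "(\<Sum>p\<in>I. sys.gradient (state (Suc n)) p * (state (Suc n) p - state n p)) = W"
      unfolding W_def gsum_cartesian d_def by (intro sum.cong refl) (simp only: diff omega_eq)
    also have "(\<Sum>p\<in>I. \<Sum>p'\<in>I. grid_matrix \<gamma> (\<epsilon>\<^sup>2 * h\<^sup>2) h J p p' * (state (Suc n) p - state n p)
              * (state (Suc n) p' - state n p')) = \<gamma> * e\<^sup>2 - \<epsilon>\<^sup>2 * Q"
    proof -
      have "(\<Sum>p'\<in>I. grid_matrix \<gamma> (\<epsilon>\<^sup>2 * h\<^sup>2) h J p p' * (state (Suc n) p - state n p)
              * (state (Suc n) p' - state n p'))
          = \<gamma> * (d (fst p) (snd p))\<^sup>2 - \<epsilon>\<^sup>2 * (disc_conv h N J d (fst p) (snd p) * d (fst p) (snd p))"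
        if p: "p \<in> I" for p
      proof -
        have "(\<Sum>p'\<in>I. grid_matrix \<gamma> (\<epsilon>\<^sup>2 * h\<^sup>2) h J p p' * (state (Suc n) p - state n p)
              * (state (Suc n) p' - state n p'))
            = d (fst p) (snd p) * (\<Sum>p'\<in>I. grid_matrix \<gamma> (\<epsilon>\<^sup>2 * h\<^sup>2) h J p p' * d (fst p') (snd p'))"
          unfolding sum_distrib_left d_def by (intro sum.cong refl) (simp only: diff p mult_ac)
        also have "(\<Sum>p'\<in>I. grid_matrix \<gamma> (\<epsilon>\<^sup>2 * h\<^sup>2) h J p p' * d (fst p') (snd p'))
            = \<gamma> * d (fst p) (snd p) - \<epsilon>\<^sup>2 * disc_conv h N J d (fst p) (snd p)"
          by (rule grid_matrix_apply[OF dper p refl])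
        finally show ?thesis by (simp add: right_diff_distrib power2_eq_square mult_ac)
      qed
      then have "(\<Sum>p\<in>I. \<Sum>p'\<in>I. grid_matrix \<gamma> (\<epsilon>\<^sup>2 * h\<^sup>2) h J p p' * (state (Suc n) p - state n p)
              * (state (Suc n) p' - state n p'))
          = (\<Sum>p\<in>I. \<gamma> * (d (fst p) (snd p))\<^sup>2
              - \<epsilon>\<^sup>2 * (disc_conv h N J d (fst p) (snd p) * d (fst p) (snd p)))"
        by (rule sum.cong[OF refl])
      also have "\<dots> = \<gamma> * e\<^sup>2 - \<epsilon>\<^sup>2 * Q"
        unfolding e2 Q_def gsum_cartesian by (simp only: sum_subtractf sum_distrib_left)
      finally show ?thesis .
    qed
    finally have energy: "sys.energy (state (Suc n)) - sys.energy (state n) \<le> W - (\<gamma> * e\<^sup>2 - \<epsilon>\<^sup>2 * Q) / 2" .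
    have "W = gsum N (\<lambda>i j. (\<omega> (Suc (Suc n)) (i + 1) j - \<omega> (Suc (Suc n)) i j) / h * q (Suc n) i j
        + (\<omega> (Suc (Suc n)) i (j + 1) - \<omega> (Suc (Suc n)) i j) / h * r (Suc n) i j)"
      unfolding W_def d_def by (rule gsum_flux_by_parts[where f = "incr (Suc n)" and q = "q (Suc n)" and r = "r (Suc n)", OF w_per qr flux])
    also have "\<dots> \<le> gsum N (\<lambda>i j. (- 5 / (4 * \<tau>)) * ((q (Suc n) i j)\<^sup>2 + (r (Suc n) i j)\<^sup>2)
        + 1 / (4 * \<tau>) * ((q n i j)\<^sup>2 + (r n i j)\<^sup>2))"
    proof (rule gsum_mono)
      fix i j
      \<comment> \<open>Young's inequality for the mixed product of old and new flux.\<close>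
      have le: "- (3 * s - t) / (2 * \<tau>) * s \<le> (- 5 * s\<^sup>2 + t\<^sup>2) / (4 * \<tau>)" for s t :: real
      proof -
        have "2 * s * t \<le> s\<^sup>2 + t\<^sup>2" using zero_le_power2[of "s - t"] by (simp add: power2_diff)
        then have "2 * (- (3 * s - t) * s) \<le> - 5 * s\<^sup>2 + t\<^sup>2" by (simp add: power2_eq_square algebra_simps)
        then have "2 * (- (3 * s - t) * s) / (4 * \<tau>) \<le> (- 5 * s\<^sup>2 + t\<^sup>2) / (4 * \<tau>)"
          using tau by (intro divide_right_mono) auto
        moreover have "2 * (- (3 * s - t) * s) / (4 * \<tau>) = - (3 * s - t) / (2 * \<tau>) * s"
          using tau by (simp add: field_simps)
        ultimately show ?thesis by (simp only:)
      qed
      have "- (3 * q (Suc n) i j - q n i j) / (2 * \<tau>) * q (Suc n) i j + - (3 * r (Suc n) i j - r n i j) / (2 * \<tau>) * r (Suc n) i j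
          \<le> (- 5 * (q (Suc n) i j)\<^sup>2 + (q n i j)\<^sup>2) / (4 * \<tau>) + (- 5 * (r (Suc n) i j)\<^sup>2 + (r n i j)\<^sup>2) / (4 * \<tau>)"
        by (intro add_mono le)
      also have "\<dots> = (- 5 / (4 * \<tau>)) * ((q (Suc n) i j)\<^sup>2 + (r (Suc n) i j)\<^sup>2)
          + 1 / (4 * \<tau>) * ((q n i j)\<^sup>2 + (r n i j)\<^sup>2)"
        by (simp add: add_divide_distrib diff_divide_distrib algebra_simps)
      finally show "(\<omega> (Suc (Suc n)) (i + 1) j - \<omega> (Suc (Suc n)) i j) / h * q (Suc n) i j
          + (\<omega> (Suc (Suc n)) i (j + 1) - \<omega> (Suc (Suc n)) i j) / h * r (Suc n) i j
          \<le> (- 5 / (4 * \<tau>)) * ((q (Suc n) i j)\<^sup>2 + (r (Suc n) i j)\<^sup>2)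
          + 1 / (4 * \<tau>) * ((q n i j)\<^sup>2 + (r n i j)\<^sup>2)" unfolding wq wr .
    qed
    also have "\<dots> = (- 5 / (4 * \<tau>)) * (b (Suc n))\<^sup>2 + 1 / (4 * \<tau>) * (b n)\<^sup>2"
      unfolding b2 by (simp only: gsum_add gsum_cmult)
    finally have W: "W \<le> (- 5 / (4 * \<tau>)) * (b (Suc n))\<^sup>2 + 1 / (4 * \<tau>) * (b n)\<^sup>2" .
    have "Q \<le> M * e * b (Suc n)"
      unfolding Q_def M_def e_def b_def d_def
      by (rule disc_conv_form_le[where q = "q (Suc n)" and r = "r (Suc n)", OF incr_per qr flux])
    then have "\<epsilon>\<^sup>2 * Q \<le> \<epsilon>\<^sup>2 * (M * e * b (Suc n))" by (rule mult_left_mono) simp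
    \<comment> \<open>Young's inequality is weighted so that the coefficient of
      \<open>e\<^sup>2\<close> is exactly \<open>\<gamma>\<close> and cancels against the quadratic
      form in the energy estimate.\<close>
    also have "\<dots> \<le> \<gamma> * e\<^sup>2 + (\<epsilon>\<^sup>2 * M)\<^sup>2 / (4 * \<gamma>) * (b (Suc n))\<^sup>2"
    proof -
      have "0 \<le> (2 * \<gamma> * e - \<epsilon>\<^sup>2 * M * b (Suc n))\<^sup>2" by simp
      then have "4 * \<gamma> * (\<epsilon>\<^sup>2 * (M * e * b (Suc n))) \<le> 4 * \<gamma> * (\<gamma> * e\<^sup>2) + (\<epsilon>\<^sup>2 * M)\<^sup>2 * (b (Suc n))\<^sup>2"
        by (simp add: power2_diff power_mult_distrib power2_eq_square[of \<gamma>] algebra_simps)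
      also have "\<dots> = 4 * \<gamma> * (\<gamma> * e\<^sup>2 + (\<epsilon>\<^sup>2 * M)\<^sup>2 / (4 * \<gamma>) * (b (Suc n))\<^sup>2)"
        using gamma by (simp add: distrib_left)
      finally show ?thesis by (rule mult_left_le_imp_le) (use gamma in simp)
    qed
    \<comment> \<open>This comparison of coefficients is the time step condition.\<close>
    also have "(\<epsilon>\<^sup>2 * M)\<^sup>2 / (4 * \<gamma>) * (b (Suc n))\<^sup>2 \<le> 1 / (2 * \<tau>) * (b (Suc n))\<^sup>2"
    proof (rule mult_right_mono)
      have eq: "(\<epsilon>\<^sup>2 * M)\<^sup>2 = M\<^sup>2 * \<epsilon> ^ 4" by (simp add: power_mult_distrib)
      \<comment> \<open>Division by zero gives \<open>0\<close>, so a vanishing denominator would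
        turn the time step condition into \<open>\<tau> < 0\<close>.\<close>
      have "M\<^sup>2 * \<epsilon> ^ 4 > 0"
      proof (rule ccontr)
        assume "\<not> ?thesis"
        moreover have "M\<^sup>2 * \<epsilon> ^ 4 \<ge> 0" by simp
        ultimately have "M\<^sup>2 * \<epsilon> ^ 4 = 0" by linarith
        then show False using tau_small tau unfolding M_def by (simp only: div_by_0)
      qed
      then have "\<tau> * (M\<^sup>2 * \<epsilon> ^ 4) \<le> 2 * \<gamma>"
        using tau_small unfolding M_def[symmetric] by (simp add: pos_less_divide_eq less_imp_le)
      then show "(\<epsilon>\<^sup>2 * M)\<^sup>2 / (4 * \<gamma>) \<le> 1 / (2 * \<tau>)"
        unfolding eq using tau gamma by (simp add: field_simps)
    qed simp
    finally have "\<epsilon>\<^sup>2 * Q \<le> \<gamma> * e\<^sup>2 + 1 / (2 * \<tau>) * (b (Suc n))\<^sup>2" by simp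
    moreover have "3 / (4 * \<tau>) * B \<le> (X + 1 / (4 * \<tau>) * B') - (Y + 1 / (4 * \<tau>) * B)"
      if "Y - X \<le> W - (G - S) / 2" "W \<le> (- 5 / (4 * \<tau>)) * B + 1 / (4 * \<tau>) * B'" "S \<le> G + 1 / (2 * \<tau>) * B"
      for X Y B B' G S W :: real
    proof -
      define t where "t = 1 / (4 * \<tau>)"
      have eqs: "3 / (4 * \<tau>) = 3 * t" "- 5 / (4 * \<tau>) = - 5 * t" "1 / (2 * \<tau>) = 2 * t" unfolding t_def by simp_all
      show ?thesis using that unfolding t_def[symmetric] eqs by (simp add: field_simps)
    qed
    ultimately show ?thesis using energy W by blast
  qed
  have step: "sys.l1 (\<lambda>p. state (Suc n) p - state n p) \<le> C * b (Suc n)" for n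
  proof -
    let ?q = "q (Suc n)" and ?r = "r (Suc n)"
    have "sys.l1 (\<lambda>p. state (Suc n) p - state n p) = gsum N (\<lambda>i j. \<bar>incr (Suc n) i j\<bar>)"
      unfolding sys.l1_def gsum_cartesian by (intro sum.cong refl) (simp only: diff)
    also have "\<dots> \<le> gsum N (\<lambda>i j. 1 / h * ((\<bar>?q i j\<bar> + \<bar>?q (i - 1) j\<bar>) + (\<bar>?r i j\<bar> + \<bar>?r i (j - 1)\<bar>)))"
    proof (rule gsum_mono)
      fix i j
      have "\<bar>incr (Suc n) i j\<bar> = 1 / h * \<bar>(?q i j - ?q (i - 1) j) + (?r i j - ?r i (j - 1))\<bar>"
        unfolding flux using h_pos by (simp add: abs_divide abs_minus_commute)
      also have "\<dots> \<le> 1 / h * ((\<bar>?q i j\<bar> + \<bar>?q (i - 1) j\<bar>) + (\<bar>?r i j\<bar> + \<bar>?r i (j - 1)\<bar>))"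
        using h_pos by (intro mult_left_mono) auto
      finally show "\<bar>incr (Suc n) i j\<bar> \<le> 1 / h * ((\<bar>?q i j\<bar> + \<bar>?q (i - 1) j\<bar>) + (\<bar>?r i j\<bar> + \<bar>?r i (j - 1)\<bar>))" .
    qed
    also have "\<dots> = 1 / h * (2 * gsum N (\<lambda>i j. \<bar>?q i j\<bar>) + 2 * gsum N (\<lambda>i j. \<bar>?r i j\<bar>))"
    proof -
      have "(\<lambda>i j. \<bar>?q i j\<bar>) \<in> C_per N" "(\<lambda>i j. \<bar>?r i j\<bar>) \<in> C_per N"
        using qr by (auto simp: C_per_def)
      from gsum_shift[OF this(1), of "-1" 0] gsum_shift[OF this(2), of 0 "-1"]
      show ?thesis unfolding gsum_cmult gsum_add by simp
    qed
    also have "\<dots> \<le> 1 / h * (2 * (real N * b (Suc n)) + 2 * (real N * b (Suc n)))"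
      using qb[of "Suc n"] h_pos by (intro mult_left_mono add_mono) auto
    also have "\<dots> = 4 * real N / h * b (Suc n)" by simp
    also have "\<dots> \<le> C * b (Suc n)" unfolding C_def using b by (intro mult_right_mono) auto
    finally show ?thesis .
  qed
  \<comment> \<open>The flux recursion bounds the differences of \<open>\<omega>\<close> between
    neighbours by two consecutive fluxes; paths through the grid bound the gap of any two cells, and
    there are \<open>N ^ 4\<close> pairs of cells.\<close>
  have grad: "sys.osc (sys.gradient (state (Suc n))) \<le> C * (b n + b (Suc n))" for n
  proof -
    let ?w = "\<omega> (Suc (Suc n))"
    define B where "B = h * real N / (2 * \<tau>) * (3 * b (Suc n) + b n)"
    have part: "gsum N (\<lambda>i j. \<bar>D i j\<bar>) \<le> B"
      if D: "\<And>i j. D i j / h = - (3 * f i j - g i j) / (2 * \<tau>)"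
        and f: "gsum N (\<lambda>i j. \<bar>f i j\<bar>) \<le> real N * b (Suc n)" and g: "gsum N (\<lambda>i j. \<bar>g i j\<bar>) \<le> real N * b n"
      for D f g :: grid
    proof -
      have "gsum N (\<lambda>i j. \<bar>D i j\<bar>) \<le> gsum N (\<lambda>i j. h / (2 * \<tau>) * (3 * \<bar>f i j\<bar> + \<bar>g i j\<bar>))"
      proof (rule gsum_mono)
        fix i j
        have "D i j = h / (2 * \<tau>) * - (3 * f i j - g i j)" using D[of i j] h_pos tau by (simp add: field_simps)
        then have "\<bar>D i j\<bar> = h / (2 * \<tau>) * \<bar>3 * f i j - g i j\<bar>"
          using h_pos tau by (simp add: abs_mult)
        also have "\<dots> \<le> h / (2 * \<tau>) * (3 * \<bar>f i j\<bar> + \<bar>g i j\<bar>)"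
          using h_pos tau by (intro mult_left_mono) auto
        finally show "\<bar>D i j\<bar> \<le> h / (2 * \<tau>) * (3 * \<bar>f i j\<bar> + \<bar>g i j\<bar>)" .
      qed
      also have "\<dots> = h / (2 * \<tau>) * (3 * gsum N (\<lambda>i j. \<bar>f i j\<bar>) + gsum N (\<lambda>i j. \<bar>g i j\<bar>))"
        by (simp only: gsum_cmult gsum_add)
      also have "\<dots> \<le> h / (2 * \<tau>) * (3 * (real N * b (Suc n)) + real N * b n)"
        using f g h_pos tau by (intro mult_left_mono add_mono) auto
      also have "\<dots> = B" unfolding B_def by (simp add: algebra_simps add_divide_distrib)
      finally show ?thesis .
    qed
    have gap: "\<bar>sys.gradient (state (Suc n)) p - sys.gradient (state (Suc n)) p'\<bar> \<le> 2 * B" if "p \<in> I" "p' \<in> I" for p p'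
    proof -
      have ij: "fst p \<in> {1..int N}" "snd p \<in> {1..int N}" "fst p' \<in> {1..int N}" "snd p' \<in> {1..int N}"
        using that by auto
      show ?thesis
        unfolding omega_eq[OF that(1), symmetric] omega_eq[OF that(2), symmetric]
        using grid_abs_diff_le[OF ij, of ?w] part[OF wq qb(1) qb(1)] part[OF wr qb(2) qb(2)] by linarith
    qed
    have "sys.osc (sys.gradient (state (Suc n))) \<le> (\<Sum>p\<in>I. \<Sum>p'\<in>I. 2 * B)"
      unfolding sys.osc_def by (intro sum_mono gap)
    also have "\<dots> = real N ^ 4 * (2 * B)" by (simp add: power4_eq_xxxx)
    also have "\<dots> \<le> real N ^ 4 * (3 * h * real N / \<tau> * (b n + b (Suc n)))"
    proof (intro mult_left_mono)
      have "2 * B = h * real N / \<tau> * (3 * b (Suc n) + b n)" unfolding B_def using tau by (simp add: field_simps)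
      also have "\<dots> \<le> h * real N / \<tau> * (3 * (b n + b (Suc n)))"
        using h_pos tau b[of n] by (intro mult_left_mono) auto
      finally show "2 * B \<le> 3 * h * real N / \<tau> * (b n + b (Suc n))" by (simp add: mult_ac)
    qed simp
    also have "\<dots> \<le> C * (b n + b (Suc n))"
      unfolding C_def mult.assoc[symmetric] using b[of n] b[of "Suc n"] by (intro mult_right_mono) (auto simp: mult_ac)
    finally show ?thesis .
  qed
  have mass: "gsum N (u (Suc n)) = gsum N (u n)" for n
  proof -
    have "gsum N (\<lambda>i j. 1 * incr n i j) = 0"
      using gsum_flux_by_parts[where f = "incr n" and \<phi> = "\<lambda>i j. 1" and q = "q n" and r = "r n", OF _ qr flux]
      by (simp add: C_per_def gsum_def)
    then show ?thesis unfolding incr_def by (simp add: gsum_diff)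
  qed
  have mass_u: "gsum N (u n) = gsum N (u 0)" for n by (induction n) (simp_all add: mass)
  have state_sum: "sum (state n) I = gsum N (u 0)" for n
  proof -
    have "sum (state n) I = gsum N (u (Suc n))"
      unfolding gsum_cartesian by (rule sum.cong) (simp_all add: state_def)
    also have "\<dots> = gsum N (u 0)" by (rule mass_u)
    finally show ?thesis .
  qed
  have "\<exists>p\<in>sys.equilibria. sum p I = sum (state 0) I \<and> (\<forall>i\<in>I. (\<lambda>n. state n i) \<longlonglongrightarrow> p i)"
  proof (rule sys.dissipative_sequence_converges[where x = state and b = b and \<mu> = "1 / (4 * \<tau>)" and \<kappa> = "3 / (4 * \<tau>)" and C = C, OF _ b _ _ _ dec step grad])
    show "state n \<in> sys.supported" for n unfolding sys.supported_def state_def by simp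
    show "C \<ge> 0" unfolding C_def using h_pos by (simp add: max.coboundedI1)
  qed (use tau in \<open>simp_all only: state_sum, simp_all\<close>)
  then obtain p where p: "p \<in> sys.equilibria" "sum p I = gsum N (u 0)" "\<And>i. i \<in> I \<Longrightarrow> (\<lambda>n. state n i) \<longlonglongrightarrow> p i"
    unfolding state_sum by blast
  \<comment> \<open>The limit \<open>p\<close> is a function on the cells of one period;
    \<open>wrap\<close> extends it periodically.\<close>
  define us :: grid where "us = (\<lambda>i j. p (wrap N i, wrap N j))"
  define ws where "ws = chem_potential h N \<epsilon> J us"
  have us: "us \<in> C_per N" unfolding us_def by (rule C_perI) (simp_all add: wrap_periodic)
  have ws: "ws \<in> C_per N" unfolding ws_def by (rule chem_potential_per[OF us])
  have usp: "p z = us (fst z) (snd z)" if "z \<in> I" for z using that unfolding us_def by (auto simp: wrap_id)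
  have wsp: "ws (fst z) (snd z) = sys.gradient p z" if "z \<in> I" for z
    unfolding ws_def by (rule chem_potential_eq[OF us that usp])
  have "steady_state h N \<epsilon> J (u 0) us ws"
    unfolding steady_state_def
  proof (intro conjI)
    have "gsum N us = sum p I" unfolding gsum_cartesian by (intro sum.cong refl usp[symmetric])
    then show "grid_inner N us grid_one = grid_inner N (u 0) grid_one"
      using p(2) unfolding grid_inner_def grid_one_def gsum_def by simp
    show "ws = chem_potential h N \<epsilon> J us" by (rule ws_def)
    have "ws i j = sys.gradient p (1, 1)" for i j
    proof -
      have inI: "(wrap N i, wrap N j) \<in> I" using wrap_in[OF N] by blast
      have "ws i j = ws (wrap N i) (wrap N j)" by (rule C_per_wrap[OF ws])
      also have "\<dots> = sys.gradient p (wrap N i, wrap N j)" using wsp[OF inI] by simp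
      also have "\<dots> = sys.gradient p (1, 1)"
        using p(1) inI sys.a_in unfolding sys.equilibria_def sys.osc_eq_0_iff by blast
      finally show ?thesis .
    qed
    then show "\<exists>c. \<forall>i j. ws i j = c" by blast
  qed
  moreover have conv: "grid_converges N v w"
    if "\<And>i j. i \<in> {1..int N} \<Longrightarrow> j \<in> {1..int N} \<Longrightarrow> (\<lambda>n. v n i j) \<longlonglongrightarrow> w i j" for v w
  proof -
    have "(\<lambda>n. sqrt (\<Sum>i=1..int N. \<Sum>j=1..int N. (v n i j - w i j) * (v n i j - w i j)))
        \<longlonglongrightarrow> sqrt (\<Sum>i=1..int N. \<Sum>j=1..int N. (w i j - w i j) * (w i j - w i j))"
      by (intro tendsto_intros that)
    then show ?thesis unfolding grid_converges_def grid_norm_def grid_inner_def by simp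
  qed
  have "grid_converges N u us"
  proof (rule conv)
    fix i j assume ij: "i \<in> {1..int N}" "j \<in> {1..int N}"
    then have "(i, j) \<in> I" by blast
    from p(3)[OF this] have "(\<lambda>n. u (Suc n) i j) \<longlonglongrightarrow> us i j"
      using usp[OF \<open>(i, j) \<in> I\<close>] ij unfolding state_def by simp
    then show "(\<lambda>n. u n i j) \<longlonglongrightarrow> us i j" by (rule LIMSEQ_imp_Suc)
  qed
  moreover have "grid_converges N \<omega> ws"
  proof (rule conv)
    fix i j assume ij: "i \<in> {1..int N}" "j \<in> {1..int N}"
    then have I: "(i, j) \<in> I" by blast
    have "(\<lambda>n. sys.gradient (state n) (i, j)) \<longlonglongrightarrow> sys.gradient p (i, j)"
      unfolding sys.gradient_def by (intro tendsto_intros p(3) I)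
    then have "(\<lambda>n. sys.gradient (state (Suc n)) (i, j)) \<longlonglongrightarrow> ws i j"
      using LIMSEQ_Suc wsp[OF I] by fastforce
    then have "(\<lambda>n. \<omega> (Suc (Suc n)) i j) \<longlonglongrightarrow> ws i j" using omega_eq[OF I] by simp
    then show "(\<lambda>n. \<omega> n i j) \<longlonglongrightarrow> ws i j" by (rule LIMSEQ_imp_Suc[OF LIMSEQ_imp_Suc])
  qed
  ultimately show ?thesis using us ws by blast
qed

end

theorem theorem4p3:
  fixes L :: real and J :: "real \<times> real \<Rightarrow> real"
  assumes "L > 0" and "admissible_kernel L J"
  shows "\<exists>C\<^sub>J>0. \<forall>(N::nat) (h::real) (\<epsilon>::real) (\<tau>::real) (u :: nat \<Rightarrow> grid) (\<omega> :: nat \<Rightarrow> grid).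
    N \<ge> 1 \<longrightarrow> h = mesh L N \<longrightarrow> \<epsilon> > 0 \<longrightarrow>
    gamma_cont L \<epsilon> J > 0 \<longrightarrow> gamma_disc h N \<epsilon> J > 0 \<longrightarrow>
    \<tau> > 0 \<longrightarrow> \<tau> < 2 * gamma_disc h N \<epsilon> J / (C\<^sub>J * \<epsilon> ^ 4) \<longrightarrow>
    (\<forall>n. u n \<in> C_per N \<and> \<omega> n \<in> C_per N) \<longrightarrow>
    grid_inner N (u 1) grid_one = grid_inner N (u 0) grid_one \<longrightarrow>
    BDF2_scheme h N \<epsilon> J \<tau> u \<omega> \<longrightarrow>
    (\<exists>us\<in>C_per N. \<exists>\<omega>s\<in>C_per N.
       steady_state h N \<epsilon> J (u 0) us \<omega>s \<and>
       grid_converges N u us \<and> grid_converges N \<omega> \<omega>s)"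
proof -
  have J: "C_infinity J" "Omega_periodic L J" "\<And>x. J (- x) = J x"
    using assms(2) unfolding admissible_kernel_def by auto
  have "C_k 1 J" using J(1) unfolding C_infinity_def by blast
  then obtain K where K: "K > 0"
    "\<And>x x' y. \<bar>x\<bar> \<le> 2 * L \<Longrightarrow> \<bar>x'\<bar> \<le> 2 * L \<Longrightarrow> \<bar>y\<bar> \<le> 2 * L \<Longrightarrow> \<bar>J (x, y) - J (x', y)\<bar> \<le> K * \<bar>x - x'\<bar>"
    "\<And>x y y'. \<bar>x\<bar> \<le> 2 * L \<Longrightarrow> \<bar>y\<bar> \<le> 2 * L \<Longrightarrow> \<bar>y'\<bar> \<le> 2 * L \<Longrightarrow> \<bar>J (x, y) - J (x, y')\<bar> \<le> K * \<bar>y - y'\<bar>"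
    using kernel_lipschitz[where R = "2 * L"] by blast
  \<comment> \<open>The constant is fixed before \<open>N\<close>, \<open>h\<close>,
    \<open>\<epsilon>\<close> and \<open>\<tau>\<close> are chosen, since \<open>K\<close> comes
    from \<open>J\<close> and \<open>L\<close> only.\<close>
  show ?thesis
  proof (intro exI[of _ "(2 * K * L\<^sup>2)\<^sup>2"] conjI allI impI)
    show "(2 * K * L\<^sup>2)\<^sup>2 > 0" using K(1) assms(1) by simp
  next
    fix N :: nat and h \<epsilon> \<tau> :: real and u \<omega> :: "nat \<Rightarrow> grid"
    assume hyps: "N \<ge> 1" "h = mesh L N" "\<epsilon> > 0" "gamma_cont L \<epsilon> J > 0" "gamma_disc h N \<epsilon> J > 0" "\<tau> > 0"
      "\<tau> < 2 * gamma_disc h N \<epsilon> J / ((2 * K * L\<^sup>2)\<^sup>2 * \<epsilon> ^ 4)" "\<forall>n. u n \<in> C_per N \<and> \<omega> n \<in> C_per N"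
      "grid_inner N (u 1) grid_one = grid_inner N (u 0) grid_one" "BDF2_scheme h N \<epsilon> J \<tau> u \<omega>"
    have mass: "gsum N (u 1) = gsum N (u 0)" using hyps(9) unfolding grid_inner_def grid_one_def gsum_def by simp
    have per: "u n \<in> C_per N" "\<omega> n \<in> C_per N" for n using hyps(8) by auto
    interpret bdf2_trajectory L J N h \<epsilon> \<tau> K u \<omega>
      by (rule bdf2_trajectory.intro) (fact assms(1) hyps J K mass per)+
    show "\<exists>us\<in>C_per N. \<exists>\<omega>s\<in>C_per N. steady_state h N \<epsilon> J (u 0) us \<omega>s \<and>
       grid_converges N u us \<and> grid_converges N \<omega> \<omega>s"
      by (rule converges_to_steady_state)
  qed
qed

end
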